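(* Let $S$ be a self-avoiding folding string. Then $S$ is planefilling if and only if the $\theta$-loop of $S$ is maximally simple, where $\theta$ is the folding morphism associated to $S$.
   Context: A folding string is a finite word $S=a_1\ldots a_{m-1}$ ($m\ge 2$) over $\{D,U\}$ with first letter $a_1=D$; such an $S$ codes an $m$-fold. $\overline{S}$ is the word obtained from $S$ by reversing it and exchanging $D$ and $U$. For $S=a_1\ldots a_{s-1}$ and $T=b_1\ldots b_{t-1}$ the folding convolution is $S*T=S\,b_1\,\overline{S}\,b_2\,S\,b_3\,\overline{S}\cdots b_{t-1}X$, in which $t$ blocks alternate between $S$ and $\overline S$ beginning with $S$ (so $X=\overline S$ if $t$ is even, $X=S$ if $t$ is odd). This operation is associative; $S^{*1}=S$, $S^{*(n+1)}=S^{*n}*S$. Since $S^{*n}$ is a prefix of $S^{*(n+1)}$, there is an infinite sequence $S^{*\infty}$ having all $S^{*n}$ as prefixes. Let $A=\{a,b,c,d\}$. $\sigma$ is the morphism of $A^*$ with $\sigma(a)=b,\sigma(b)=c,\sigma(c)=d,\sigma(d)=a$, and $\tau$ is the reversal of words in $A^*$. Let $w:\{D,U\}^*\to\mathbb{Z}$ be the homomorphism with $w(D)=1$, $w(U)=-1$. The folding morphism $\theta=\theta_S:A^*\to A^*$ associated to $S$ is the morphism commuting with $\sigma\tau$ such that $\theta(a)=e_0\ldots e_{m-1}$ with $e_0=a$ and $e_i=\sigma^{w(a_1\ldots a_i)}(a)$ for $1\le i\le m-1$; thus $\theta(b)=\sigma\tau\theta(a)$, $\theta(c)=\sigma^2\theta(a)$,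 $\theta(d)=\sigma^3\tau\theta(a)$. Let $f:A^*\to\mathbb{C}$ be the homomorphism (concatenation to addition) with $f(a)=1,f(b)=i,f(c)=-1,f(d)=-i$. A finite or infinite word $u_0u_1u_2\ldots$ over $A$ determines a lattice path starting at $p_0=0$ with $p_{j+1}=p_j+f(u_j)$, traversing successively the unit segments $[p_j,p_{j+1}]$; $K[u]$ denotes this curve. The curve associated to an infinite sequence $a_1a_2a_3\ldots$ over $\{D,U\}$ is the path of the infinite word $e_0e_1e_2\ldots$ with $e_0=a$, $e_i=\sigma^{w(a_1\ldots a_i)}(a)$. Grid points are the Gaussian integers. $S$ is self-avoiding if the curve associated to $S^{*\infty}$ does not traverse any unit segment twice (in either direction). $S$ is planefilling if the curve associated to $S^{*\infty}$ passes twice through every grid point lying in some arbitrarily large circle, i.e. for every $R>0$ there is a disc of radius $R$ such that the curve passes twice through each grid point in this disc. The $\theta$-loop is the closed curve $\widetilde K[\theta(abcd)]$, where $\widetilde K[u]$ is obtained from $K[u]$ by rounding off its corners: at each vertex of the path (all consecutive segments are perpendicular) the corner is cut off near the vertex, so that the curve does not pass through Gaussian integers; for the closed path $\theta(abcd)$ this is also done at the base point $0$. It is simple if and only if the closed path of $\theta(abcd)$ does not traverse any unit segment twice. The string $S$ (or its $\theta$-loop) is called maximally simple if the $\theta$-loop is simple and the region that the $\theta$-loop bounds (by Jordan's theorem) only contains grid points that are passed twice by the (unrounded) closed path of $\theta(abcd)$, where the common start and end at $0$ counts as one passage. *)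

theory Defs
  imports "HOL-Analysis.Analysis" "HOL-Library.Sublist"
begin

section \<open>Folding strings\<close>

datatype crease = D | U

fun flip :: "crease \<Rightarrow> crease" where
  "flip D = U"
| "flip U = D"

definition folding_string :: "crease list \<Rightarrow> bool" where
  "folding_string S \<longleftrightarrow> S \<noteq> [] \<and> hd S = D"

definition bar :: "crease list \<Rightarrow> crease list" where
  "bar S = map flip (rev S)"

text \<open>Since \<open>bar\<close> is an involution, the blocks below alternate between \<open>S\<close> and \<open>bar S\<close>.\<close>

fun fold_conv :: "crease list \<Rightarrow> crease list \<Rightarrow> crease list" where
  "fold_conv S [] = S"
| "fold_conv S (b # T) = S @ b # fold_conv (bar S) T"

text \<open>The empty word is a neutral element of the convolution, so the recursion may start at
  exponent 0; the first power is \<open>S\<close> itself (\<open>fold_power_1\<close>).\<close>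

fun fold_power :: "crease list \<Rightarrow> nat \<Rightarrow> crease list" where
  "fold_power S 0 = []"
| "fold_power S (Suc n) = fold_conv (fold_power S n) S"

text \<open>The infinite sequence with all powers of \<open>S\<close> as prefixes, indexed from 0. The power with
  exponent \<open>i + 1\<close> is long enough to contain position \<open>i\<close>; see \<open>fold_limit_prefix\<close>.\<close>

definition fold_limit :: "crease list \<Rightarrow> nat \<Rightarrow> crease" where
  "fold_limit S i = fold_power S (Suc i) ! i"

lemma bar_bar [simp]: "bar (bar S) = S"
proof -
  have "flip (flip x) = x" for x by (cases x) auto
  then show ?thesis by (simp add: bar_def rev_map comp_def)
qed

lemma bar_Nil [simp]: "bar [] = []"
  by (simp add: bar_def)

lemma fold_conv_Nil_left: "fold_conv [] T = T"
  by (induction T) auto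

lemma fold_power_1: "fold_power S 1 = S"
  by (simp add: fold_conv_Nil_left)

lemma length_bar [simp]: "length (bar S) = length S"
  by (simp add: bar_def)

lemma length_fold_conv:
  "Suc (length (fold_conv S T)) = Suc (length S) * Suc (length T)"
  by (induction S T rule: fold_conv.induct) auto

lemma length_fold_power: "Suc (length (fold_power S n)) = Suc (length S) ^ n"
proof (induction n)
  case (Suc n)
  then show ?case using length_fold_conv[of "fold_power S n" S] by simp
qed simp

lemma prefix_fold_conv: "prefix S (fold_conv S T)"
  by (cases T) auto

lemma prefix_fold_power: "n \<le> k \<Longrightarrow> prefix (fold_power S n) (fold_power S k)"
proof (induction rule: dec_induct)
  case (step k)
  then show ?case using prefix_fold_conv prefix_order.trans by fastforce
qed simp

lemma fold_limit_prefix: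
  assumes "S \<noteq> []" "i < length (fold_power S n)"
  shows "fold_limit S i = fold_power S n ! i"
proof -
  have "Suc i < 2 ^ Suc i" by (rule less_exp)
  also have "(2::nat) ^ Suc i \<le> Suc (length S) ^ Suc i"
    using assms(1) by (intro power_mono) (cases S; auto)+
  also have "\<dots> = Suc (length (fold_power S (Suc i)))"
    by (rule length_fold_power[symmetric])
  finally have i: "i < length (fold_power S (Suc i))" by simp
  have "prefix (fold_power S n) (fold_power S (Suc i)) \<or> prefix (fold_power S (Suc i)) (fold_power S n)"
    using prefix_fold_power[of n "Suc i" S] prefix_fold_power[of "Suc i" n S] by linarith
  then show ?thesis
    unfolding fold_limit_def using i assms(2)
    by (auto simp: prefix_def nth_append simp del: fold_power.simps)
qed

section \<open>Direction words and the folding morphism\<close>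

text \<open>The letters \<open>a\<close>, \<open>b\<close>, \<open>c\<close>, \<open>d\<close>, and the letter permutation \<open>\<sigma>\<close>, called \<open>rot\<close>.\<close>

datatype dir = La | Lb | Lc | Ld

fun rot :: "dir \<Rightarrow> dir" where
  "rot La = Lb"
| "rot Lb = Lc"
| "rot Lc = Ld"
| "rot Ld = La"

text \<open>\<open>rot\<close> has order 4, so integer exponents may be reduced modulo 4.\<close>

definition rot_power :: "int \<Rightarrow> dir \<Rightarrow> dir" where
  "rot_power k = rot ^^ nat (k mod 4)"

fun weight_letter :: "crease \<Rightarrow> int" where
  "weight_letter D = 1"
| "weight_letter U = -1"

definition weight :: "crease list \<Rightarrow> int" where
  "weight S = sum_list (map weight_letter S)"

definition dir_word :: "crease list \<Rightarrow> dir list" where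
  "dir_word S = map (\<lambda>i. rot_power (weight (take i S)) La) [0..<Suc (length S)]"

definition dir_seq :: "(nat \<Rightarrow> crease) \<Rightarrow> nat \<Rightarrow> dir" where
  "dir_seq s i = rot_power (weight (map s [0..<i])) La"

fun theta_letter :: "crease list \<Rightarrow> dir \<Rightarrow> dir list" where
  "theta_letter S La = dir_word S"
| "theta_letter S Lb = map rot (rev (dir_word S))"
| "theta_letter S Lc = map (rot ^^ 2) (dir_word S)"
| "theta_letter S Ld = map (rot ^^ 3) (rev (dir_word S))"

definition theta :: "crease list \<Rightarrow> dir list \<Rightarrow> dir list" where
  "theta S u = concat (map (theta_letter S) u)"

lemma theta_commute: "theta S (map rot (rev u)) = map rot (rev (theta S u))"
proof -
  have "rot (rot (rot (rot x))) = x" for x by (cases x) auto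
  then have "theta_letter S (rot x) = map rot (rev (theta_letter S x))" for x
    by (cases x) (auto simp: rev_map numeral_eq_Suc comp_def)
  then show ?thesis
    by (induction u) (auto simp: theta_def)
qed

section \<open>Lattice paths\<close>

fun step :: "dir \<Rightarrow> complex" where
  "step La = 1"
| "step Lb = \<i>"
| "step Lc = -1"
| "step Ld = -\<i>"

definition displacement :: "dir list \<Rightarrow> complex" where
  "displacement u = sum_list (map step u)"

definition word_vertex :: "dir list \<Rightarrow> nat \<Rightarrow> complex" where
  "word_vertex u j = displacement (take j u)"

definition seq_vertex :: "(nat \<Rightarrow> dir) \<Rightarrow> nat \<Rightarrow> complex" where
  "seq_vertex e j = displacement (map e [0..<j])"

definition grid_points :: "complex set" where
  "grid_points = {z. Re z \<in> \<int> \<and> Im z \<in> \<int>}"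

definition limit_vertex :: "crease list \<Rightarrow> nat \<Rightarrow> complex" where
  "limit_vertex S = seq_vertex (dir_seq (fold_limit S))"

definition self_avoiding :: "crease list \<Rightarrow> bool" where
  "self_avoiding S \<longleftrightarrow>
     inj (\<lambda>j. closed_segment (limit_vertex S j) (limit_vertex S (Suc j)))"

definition planefilling :: "crease list \<Rightarrow> bool" where
  "planefilling S \<longleftrightarrow>
     (\<forall>R>0. \<exists>c. \<forall>z \<in> cball c R \<inter> grid_points. card {j. limit_vertex S j = z} = 2)"

section \<open>The rounded loop\<close>

fun polyline :: "complex list \<Rightarrow> real \<Rightarrow> complex" where
  "polyline [] = linepath 0 0"
| "polyline [x] = linepath x x"
| "polyline [x, y] = linepath x y"
| "polyline (x # y # z # zs) = linepath x y +++ polyline (y # z # zs)"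

text \<open>For a closed path \<open>u\<close>, each corner is cut off at distance \<open>1/4\<close> from its vertex: the middle
  half of every unit segment is kept, and the end of each is joined by a chord to the start of the
  next one. The last chord cuts the corner at the base point.\<close>

definition kept_ends :: "dir list \<Rightarrow> nat \<Rightarrow> complex list" where
  "kept_ends u j =
     [word_vertex u j + step (u ! j) / 4, word_vertex u (Suc j) - step (u ! j) / 4]"

definition rounded_loop :: "dir list \<Rightarrow> real \<Rightarrow> complex" where
  "rounded_loop u = polyline (concat (map (kept_ends u) [0..<length u]) @ [hd (kept_ends u 0)])"

definition loop_word :: "crease list \<Rightarrow> dir list" where
  "loop_word S = theta S [La, Lb, Lc, Ld]"

text \<open>Passages through \<open>z\<close> are counted over \<open>j < length (loop_word S)\<close>, so that the common start
  and end at 0 counts once.\<close>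

definition maximally_simple :: "crease list \<Rightarrow> bool" where
  "maximally_simple S \<longleftrightarrow>
     simple_path (rounded_loop (loop_word S)) \<and>
     (\<forall>z \<in> inside (path_image (rounded_loop (loop_word S))) \<inter> grid_points.
        card {j. j < length (loop_word S) \<and> word_vertex (loop_word S) j = z} = 2)"

lemma loop_word_closed: "displacement (loop_word S) = 0"
proof -
  have neg: "step ((rot ^^ 2) x) = - step x" "step ((rot ^^ 3) x) = - step (rot x)" for x
    by (cases x; simp add: numeral_eq_Suc)+
  have "sum_list (map (step \<circ> (rot ^^ 2)) u) = - sum_list (map step u)"
    "sum_list (map (step \<circ> (rot ^^ 3)) u) = - sum_list (map (step \<circ> rot) u)" for u
    by (induction u) (simp_all add: neg del: funpow.simps)
  then show ?thesis
    by (simp add: loop_word_def theta_def displacement_def)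
qed

end

theory Submission imports Defs begin

text \<open>Horizontal and vertical steps alternate along all curves considered here, so a horizontal unit
segment always leaves a grid point with even coordinate sum, and a vertical one always enters it.
Every unit segment therefore has a fixed orientation, and every unit square (\<open>face\<close>) is a directed
cycle, counterclockwise or clockwise as on a chessboard: each edge has a counterclockwise face on
its left and a clockwise face on its right. The morphism \<open>\<theta>\<close> acts on edges: with \<open>\<lambda>\<close> the
displacement of \<open>\<theta>(a)\<close> (\<open>stretch\<close>) it sends the edge at \<open>p\<close> with letter \<open>x\<close> to the path
\<open>\<theta>(x)\<close> starting at \<open>\<lambda>p\<close> (\<open>subst\<close>). The edge set \<open>E\<close> of the limit curve is invariant under
this action, and its initial pieces are the images of the first edge. Let \<open>m\<close> be the length of
\<open>\<theta>(a)\<close>.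

Suppose that the \<open>\<theta>\<close>-loop uses no edge twice. Its rounding is then a Jordan curve, and every edge
of the loop has exactly one of its two faces inside; since consecutive edges
share their left or their right face, it is always the face on the same side. Let \<open>P\<close> and \<open>N\<close> be the
numbers of counterclockwise and of clockwise faces inside. Counting the edges whose left face is
inside against those whose right face is inside gives \<open>4m = 4P - 4N\<close>; weighting the same count
with the area form gives \<open>2|\<lambda>|\<^sup>2 = 2P + 2N\<close>, because the loop encloses the signed area \<open>|\<lambda>|\<^sup>2\<close>,
and also that the left faces are the inner ones (\<open>face_count\<close>). So \<open>m \<le> |\<lambda>|\<^sup>2\<close>, and equality
means that no clockwise face is inside.

If \<open>S\<close> is planefilling, then \<open>E\<close> contains all four edges of some face; the image of this face is a
translate of the \<open>\<theta>\<close>-loop inside \<open>E\<close>, so the loop uses no edge twice. Moreover, if \<open>|\<lambda>| > 1\<close>,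
all edges in some disc of radius \<open>|\<lambda>|^n\<close> lie in \<open>\<theta>^n\<close>-images of a bounded number of edges, so \<open>|\<lambda>|^(2n)\<close> is
at most a constant times \<open>m^n\<close>, and \<open>|\<lambda>|\<^sup>2 \<le> m\<close> (\<open>stretch_bound\<close>). Hence no clockwise face is inside. At
an inner grid point both clockwise faces must then be cut off by rounded corners, so the point is
passed twice.

Conversely let the loop be maximally simple. An edge of an inner face that did not belong to the
loop would start at an inner grid point which is not passed twice; so with an edge the loop
contains all edges of its left face. Iterating, the left face of an edge of \<open>\<theta>^n(e)\<close> lies in the
\<open>\<theta>^n\<close>-image of the left face of \<open>e\<close> (\<open>face_closed_power\<close>), and symmetrically for right faces.
The loop has \<open>m\<close> left faces but \<open>2m + 2\<close> left turns, so at some left face three left turns follow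
each other. This pattern occurs in \<open>\<theta>(yz)\<close> for a left turn \<open>yz\<close> that occurs, up to a half turn,
on the limit curve; so some \<open>\<theta>^n(a)\<close> contains a complete face (\<open>cycle_in_limit\<close>). The share of edges
of \<open>\<theta>^n(a)\<close> that border a face not completely contained in \<open>\<theta>^n(a)\<close> then decays exponentially in \<open>n\<close>
(\<open>open_edges_bound\<close>), and some edge is far away from all of them. Around that edge, closing up
faces step by step shows that all edges of a large disc belong to \<open>E\<close> (\<open>fill_around\<close>); as \<open>E\<close>
is traversed without repetition, the grid points of the disc are passed exactly twice.\<close>

section \<open>Folding strings as turning sequences\<close>

lemma rot4 [simp]: "rot (rot (rot (rot x))) = x"
  by (cases x) auto

lemma rot_induct [case_names La rot]:
  assumes "P La" "\<And>x. P x \<Longrightarrow> P (rot x)"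
  shows "P x"
proof -
  have "P Lb" using assms(2)[OF assms(1)] by simp
  moreover from this have "P Lc" using assms(2)[of Lb] by simp
  moreover from this have "P Ld" using assms(2)[of Lc] by simp
  ultimately show ?thesis using assms(1) by (cases x) auto
qed

lemma step_rot [simp]: "step (rot x) = \<i> * step x"
  by (cases x) auto

lemma norm_step [simp]: "norm (step x) = 1"
  by (cases x) auto

fun turn :: "crease \<Rightarrow> dir \<Rightarrow> dir" where
  "turn D x = rot x"
| "turn U x = rot (rot (rot x))"

text \<open>The letters met by a path that starts with a given letter and turns according to a folding
string. Unlike a sum of weights, it can be followed letter by letter.\<close>

fun walk :: "dir \<Rightarrow> crease list \<Rightarrow> dir list" where
  "walk x [] = [x]"
| "walk x (c # S) = x # walk (turn c x) S"

lemma length_walk [simp]: "length (walk x S) = Suc (length S)"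
  by (induction S arbitrary: x) auto

lemma walk_nonempty [simp]: "walk x S \<noteq> []"
  by (cases S) auto

lemma hd_walk [simp]: "hd (walk x S) = x"
  by (cases S) auto

lemma walk_append: "walk x (S @ c # T) = walk x S @ walk (turn c (last (walk x S))) T"
  by (induction S arbitrary: x) auto

lemma map_rot_walk: "map rot (walk x S) = walk (rot x) S"
proof (induction S arbitrary: x)
  case (Cons c S)
  have "rot (turn c x) = turn c (rot x)" by (cases c) auto
  then show ?case using Cons by simp
qed simp

lemma turn_flip [simp]: "turn (flip c) (turn c x) = x"
  by (cases c) auto

text \<open>Walking backwards meets the creases in reverse order and with left and right exchanged; this is
why \<open>bar\<close> appears in the convolution.\<close>

lemma rev_walk: "rev (walk x S) = walk (last (walk x S)) (bar S)"
proof (induction S arbitrary: x)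
  case Nil
  then show ?case by simp
next
  case (Cons c S)
  have b: "bar (c # S) = bar S @ [flip c]" by (simp add: bar_def)
  have "last (walk (last (walk (turn c x) S)) (bar S)) = last (rev (walk (turn c x) S))"
    using Cons by simp
  also have "\<dots> = turn c x" by (simp add: last_rev)
  finally show ?case using Cons by (simp add: b walk_append)
qed

lemma rot_power_add1: "rot_power (k + weight_letter c) x = turn c (rot_power k x)"
proof -
  have r4: "(rot ^^ n) x = (rot ^^ (n mod 4)) x" for n
  proof -
    have id: "rot ^^ (4 * q) = id" for q
      by (induction q) (auto simp: fun_eq_iff numeral_eq_Suc)
    have "(rot ^^ n) x = (rot ^^ (4 * (n div 4) + n mod 4)) x" by simp
    also have "\<dots> = (rot ^^ (n mod 4)) x" unfolding funpow_add id by simp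
    finally show ?thesis .
  qed
  have D: "rot_power (k + 1) x = rot (rot_power k x)" for k
  proof -
    have e: "nat ((k + 1) mod 4) = Suc (nat (k mod 4)) mod 4"
      by (simp add: nat_eq_iff zmod_int) presburger
    have "rot_power (k + 1) x = (rot ^^ (Suc (nat (k mod 4)) mod 4)) x"
      unfolding rot_power_def e ..
    also have "\<dots> = (rot ^^ Suc (nat (k mod 4))) x" by (rule r4[symmetric])
    finally show ?thesis by (simp add: rot_power_def)
  qed
  show ?thesis
  proof (cases c)
    case U
    have "rot_power k x = rot (rot_power (k - 1) x)" using D[of "k - 1"] by simp
    then show ?thesis using U by simp
  qed (simp add: D)
qed

lemma rot_power_0 [simp]: "rot_power 0 x = x"
  by (simp add: rot_power_def)

lemma weight_append1: "weight (S @ [c]) = weight S + weight_letter c"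
  by (simp add: weight_def)

lemma last_walk: "last (walk x S) = rot_power (weight S) x"
  by (induction S rule: rev_induct)
     (auto simp: weight_append1 rot_power_add1 walk_append weight_def[of "[]"])

lemma dir_word_walk: "dir_word S = walk La S"
proof (induction S rule: rev_induct)
  case Nil
  show ?case by (simp add: dir_word_def weight_def)
next
  case (snoc c S)
  have "dir_word (S @ [c]) = dir_word S @ [rot_power (weight (S @ [c])) La]"
    by (simp add: dir_word_def)
  then show ?case
    using snoc by (simp add: walk_append last_walk weight_append1 rot_power_add1)
qed

lemma theta_letter_rot: "theta_letter S (rot x) = map rot (rev (theta_letter S x))"
  by (cases x) (auto simp: rev_map numeral_eq_Suc comp_def)

lemma theta_letter_nonempty [simp]: "theta_letter S x \<noteq> []"
  by (cases x) (auto simp: dir_word_walk)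

lemma length_theta_letter [simp]: "length (theta_letter S x) = Suc (length S)"
  by (cases x) (auto simp: dir_word_walk)

text \<open>Since \<open>\<theta>(b)\<close> and \<open>\<theta>(d)\<close> arise by reversal, they turn according to \<open>bar S\<close>.\<close>

definition oriented_string :: "crease list \<Rightarrow> dir \<Rightarrow> crease list" where
  "oriented_string S x = (if x = La \<or> x = Lc then S else bar S)"

lemma bar_oriented_string: "bar (oriented_string S x) = oriented_string S (turn c x)"
  by (cases x; cases c) (auto simp: oriented_string_def)

lemma theta_letter_walk:
  "theta_letter S x = walk (hd (theta_letter S x)) (oriented_string S x)"
proof (induction x rule: rot_induct)
  case La
  show ?case by (simp add: dir_word_walk oriented_string_def)
next
  case (rot x)
  have "theta_letter S (rot x) = map rot (rev (walk (hd (theta_letter S x)) (oriented_string S x)))"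
    using rot theta_letter_rot by metis
  also have "\<dots> = walk (rot (last (walk (hd (theta_letter S x)) (oriented_string S x))))
      (oriented_string S (rot x))"
    using bar_oriented_string[of S x D] by (simp add: rev_walk map_rot_walk)
  finally show ?case by (metis hd_walk)
qed

text \<open>Consecutive images meet with the turn of the letters themselves: the first letter of
\<open>\<theta>(\<sigma>x) = \<sigma>\<tau>\<theta>(x)\<close> is \<open>\<sigma>\<close> applied to the last letter of \<open>\<theta>(x)\<close>.\<close>

lemma hd_theta_letter_turn:
  "hd (theta_letter S (turn c x)) = turn c (last (theta_letter S x))"
proof (cases c)
  case D
  then show ?thesis by (simp add: theta_letter_rot hd_map hd_rev)
next
  case U
  define y where "y = turn U x"
  have x: "x = rot y" by (simp add: y_def)
  have "last (theta_letter S x) = rot (hd (theta_letter S y))"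
    unfolding x by (simp add: theta_letter_rot last_map last_rev)
  then show ?thesis using U by (simp add: y_def)
qed

lemma theta_Cons: "theta S (x # u) = theta_letter S x @ theta S u"
  by (simp add: theta_def)

lemma theta_Nil [simp]: "theta S [] = []"
  by (simp add: theta_def)

lemma theta_append: "theta S (u @ v) = theta S u @ theta S v"
  by (simp add: theta_def)

text \<open>The convolution is made for this identity: the creases of the second string sit between
consecutive images, and the images alternately follow \<open>S\<close> and \<open>bar S\<close>.\<close>

lemma theta_walk:
  "theta S (walk x T) = walk (hd (theta_letter S x)) (fold_conv (oriented_string S x) T)"
proof (induction T arbitrary: x)
  case Nil
  then show ?case using theta_letter_walk[of S x] by (simp add: theta_Cons)
next
  case (Cons c T)
  show ?case
    using Cons[of "turn c x"] theta_letter_walk[of S x]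
    by (simp add: theta_Cons walk_append bar_oriented_string[of S x c] hd_theta_letter_turn)
qed

text \<open>The folding morphism of a convolution is the composition of the morphisms. It suffices to compare
the images of \<open>a\<close>, because both sides commute with \<open>\<sigma>\<tau>\<close>.\<close>

lemma theta_letter_fold_conv: "theta_letter (fold_conv S T) x = theta S (theta_letter T x)"
proof (induction x rule: rot_induct)
  case La
  show ?case using theta_walk[of S La T] by (simp add: dir_word_walk oriented_string_def)
next
  case (rot x)
  then show ?case by (simp add: theta_letter_rot theta_commute)
qed

lemma theta_fold_conv: "theta (fold_conv S T) u = theta S (theta T u)"
  by (induction u) (auto simp: theta_Cons theta_append theta_letter_fold_conv)

lemma theta_letter_Nil: "theta_letter [] x = [x]"
  by (cases x) (auto simp: dir_word_walk numeral_eq_Suc)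

lemma theta_Nil_string: "theta [] u = u"
  by (induction u) (auto simp: theta_Cons theta_letter_Nil)

lemma theta_fold_power_add: "theta (fold_power S (n + k)) u = theta (fold_power S n) (theta (fold_power S k) u)"
  by (induction k arbitrary: u) (auto simp: theta_Nil_string theta_fold_conv)

section \<open>Edges and their images\<close>

type_synonym edge = "complex \<times> dir"

fun edge_list :: "complex \<Rightarrow> dir list \<Rightarrow> edge list" where
  "edge_list p [] = []"
| "edge_list p (x # u) = (p, x) # edge_list (p + step x) u"

lemma displacement_simps [simp]:
  "displacement [] = 0" "displacement (x # u) = step x + displacement u"
  "displacement (u @ v) = displacement u + displacement v"
  by (auto simp: displacement_def)

lemma displacement_map_rot [simp]: "displacement (map rot u) = \<i> * displacement u"
  by (induction u) (auto simp: algebra_simps)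

lemma displacement_rev [simp]: "displacement (rev u) = displacement u"
  by (induction u) auto

lemma length_edge_list [simp]: "length (edge_list p u) = length u"
  by (induction u arbitrary: p) auto

lemma edge_list_append: "edge_list p (u @ v) = edge_list p u @ edge_list (p + displacement u) v"
  by (induction u arbitrary: p) (auto simp: add.assoc)

lemma nth_edge_list: "j < length u \<Longrightarrow> edge_list p u ! j = (p + displacement (take j u), u ! j)"
proof (induction u arbitrary: p j)
  case (Cons x u)
  then show ?case by (cases j) (auto simp: add.assoc)
qed simp

definition shift :: "complex \<Rightarrow> edge \<Rightarrow> edge" where
  "shift q e = (q + fst e, snd e)"

lemma edge_list_shift: "edge_list (q + p) u = map (shift q) (edge_list p u)"
  by (induction u arbitrary: p) (auto simp: shift_def add.assoc)

definition stretch :: "crease list \<Rightarrow> complex" where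
  "stretch S = displacement (dir_word S)"

text \<open>Reversal keeps the displacement of a word and \<open>\<sigma>\<close> multiplies it by \<open>\<i>\<close>, so \<open>\<theta>\<close> acts on
displacements as multiplication by one complex number.\<close>

lemma displacement_theta_letter: "displacement (theta_letter S x) = stretch S * step x"
  by (induction x rule: rot_induct) (simp_all add: stretch_def theta_letter_rot)

lemma displacement_theta: "displacement (theta S u) = stretch S * displacement u"
  by (induction u) (auto simp: theta_Cons displacement_theta_letter algebra_simps)

text \<open>The action of \<open>\<theta>\<close> on edges: the end points are multiplied by \<open>stretch S\<close>, so that images of
consecutive edges are consecutive paths (\<open>edge_list_theta\<close>).\<close>

definition subst :: "crease list \<Rightarrow> edge \<Rightarrow> edge list" where
  "subst S e = edge_list (stretch S * fst e) (theta_letter S (snd e))"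

lemma length_subst [simp]: "length (subst S e) = Suc (length S)"
  by (simp add: subst_def)

lemma edge_list_theta: "edge_list (stretch S * p) (theta S u) = concat (map (subst S) (edge_list p u))"
proof (induction u arbitrary: p)
  case (Cons x u)
  show ?case
    using Cons[of "p + step x"]
    by (simp add: theta_Cons edge_list_append displacement_theta_letter subst_def algebra_simps)
qed simp

lemma stretch_fold_conv: "stretch (fold_conv S T) = stretch S * stretch T"
  using theta_letter_fold_conv[of S T La] displacement_theta[of S "theta_letter T La"]
  by (simp add: stretch_def)

lemma stretch_Nil [simp]: "stretch [] = 1"
  by (simp add: stretch_def dir_word_walk)

lemma stretch_fold_power: "stretch (fold_power S n) = stretch S ^ n"
  by (induction n) (auto simp: stretch_fold_conv)

lemma subst_shift: "subst S (shift q e) = map (shift (stretch S * q)) (subst S e)"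
  by (simp add: subst_def shift_def edge_list_shift[symmetric] algebra_simps)

lemma subst_fold_power_add:
  "subst (fold_power S (n + k)) e = concat (map (subst (fold_power S n)) (subst (fold_power S k) e))"
proof -
  have "theta_letter (fold_power S (n + k)) x = theta (fold_power S n) (theta_letter (fold_power S k) x)" for x
    using theta_fold_power_add[of S n k "[x]"] by (simp add: theta_Cons)
  then show ?thesis
    by (simp add: subst_def stretch_fold_power power_add mult.assoc
        flip: edge_list_theta[of "fold_power S n"])
qed

section \<open>Polygonal paths\<close>

definition side :: "complex list \<Rightarrow> nat \<Rightarrow> complex set" where
  "side vs i = closed_segment (vs ! i) (vs ! Suc i)"

lemma side_Cons [simp]: "side (x # vs) (Suc i) = side vs i"
  by (simp add: side_def)

lemma side_0: "side (x # y # vs) 0 = closed_segment x y"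
  by (simp add: side_def)

lemma pathstart_polyline: "vs \<noteq> [] \<Longrightarrow> pathstart (polyline vs) = hd vs"
  by (induction vs rule: polyline.induct) auto

lemma pathfinish_polyline: "vs \<noteq> [] \<Longrightarrow> pathfinish (polyline vs) = last vs"
  by (induction vs rule: polyline.induct) auto

lemma path_image_polyline:
  "2 \<le> length vs \<Longrightarrow> path_image (polyline vs) = (\<Union>i < length vs - 1. side vs i)"
proof (induction vs rule: polyline.induct)
  case (3 x y)
  have "{..<Suc 0} = {0}" by auto
  then show ?case by (simp add: side_0)
next
  case (4 x y z zs)
  have "path_image (polyline (x # y # z # zs))
      = closed_segment x y \<union> path_image (polyline (y # z # zs))"
    by (simp add: path_image_join pathstart_polyline)
  also have "\<dots> = side (x # y # z # zs) 0 \<union> (\<Union>i < Suc (length zs). side (x # y # z # zs) (Suc i))"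
    using 4 by (simp add: side_0)
  also have "\<dots> = (\<Union>i < Suc (Suc (length zs)). side (x # y # z # zs) i)"
    by (simp add: lessThan_Suc_eq_insert_0[of "Suc (length zs)"] image_image del: side_Cons)
  finally show ?case by simp
qed auto

lemma arc_polyline:
  assumes "2 \<le> length vs"
    and "\<And>i. i < length vs - 1 \<Longrightarrow> vs ! i \<noteq> vs ! Suc i"
    and "\<And>i j. i < j \<Longrightarrow> j < length vs - 1 \<Longrightarrow>
           side vs i \<inter> side vs j \<subseteq> (if j = Suc i then {vs ! j} else {})"
  shows "arc (polyline vs)"
  using assms
proof (induction vs rule: polyline.induct)
  case (3 x y)
  then show ?case using "3.prems"(2)[of 0] by (auto intro: arc_linepath)
next
  case (4 x y z zs)
  have ne: "x \<noteq> y" using "4.prems"(2)[of 0] by simp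
  have arc: "arc (polyline (y # z # zs))"
  proof (rule "4.IH")
    fix i j assume "i < j" "j < length (y # z # zs) - 1"
    then show "side (y # z # zs) i \<inter> side (y # z # zs) j
        \<subseteq> (if j = Suc i then {(y # z # zs) ! j} else {})"
      using "4.prems"(3)[of "Suc i" "Suc j"] by (cases "j = Suc i") simp_all
  next
    fix i assume "i < length (y # z # zs) - 1"
    then show "(y # z # zs) ! i \<noteq> (y # z # zs) ! Suc i"
      using "4.prems"(2)[of "Suc i"] by simp
  qed simp
  have "closed_segment x y \<inter> path_image (polyline (y # z # zs)) \<subseteq> {y}"
  proof
    fix w assume w: "w \<in> closed_segment x y \<inter> path_image (polyline (y # z # zs))"
    then obtain i where i: "i < Suc (length zs)" "w \<in> side (y # z # zs) i"
      using path_image_polyline[of "y # z # zs"] by auto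
    have "w \<in> side (x # y # z # zs) 0 \<inter> side (x # y # z # zs) (Suc i)"
      using w i by (simp add: side_0)
    then show "w \<in> {y}"
      using "4.prems"(3)[of 0 "Suc i"] i(1) by (auto split: if_splits)
  qed
  then show ?case
    using ne arc by (simp add: arc_join arc_linepath pathstart_polyline)
qed auto

lemma simple_path_polyline_closed:
  assumes len: "4 \<le> length vs" and closed: "hd vs = last vs"
    and ne: "\<And>i. i < length vs - 1 \<Longrightarrow> vs ! i \<noteq> vs ! Suc i"
    and disj: "\<And>i j. i < j \<Longrightarrow> j < length vs - 1 \<Longrightarrow>
           side vs i \<inter> side vs j \<subseteq>
             (if j = Suc i then {vs ! j} else if i = 0 \<and> j = length vs - 2 then {hd vs} else {})"
  shows "simple_path (polyline vs)"
proof -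
  obtain x y z zs where vs: "vs = x # y # z # zs" and zs: "zs \<noteq> []"
  proof -
    obtain x vs1 where 1: "vs = x # vs1" "3 \<le> length vs1" using len by (cases vs) auto
    obtain y vs2 where 2: "vs1 = y # vs2" "2 \<le> length vs2" using 1 by (cases vs1) auto
    obtain z vs3 where 3: "vs2 = z # vs3" "1 \<le> length vs3" using 2 by (cases vs2) auto
    show ?thesis using that[of x y z vs3] 1 2 3 by (cases vs3) auto
  qed
  have arc: "arc (polyline (y # z # zs))"
  proof (rule arc_polyline)
    fix i j assume "i < j" "j < length (y # z # zs) - 1"
    then show "side (y # z # zs) i \<inter> side (y # z # zs) j
        \<subseteq> (if j = Suc i then {(y # z # zs) ! j} else {})"
      using disj[of "Suc i" "Suc j"] by (cases "j = Suc i") (simp_all add: vs)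
  next
    fix i assume "i < length (y # z # zs) - 1"
    then show "(y # z # zs) ! i \<noteq> (y # z # zs) ! Suc i"
      using ne[of "Suc i"] by (simp add: vs)
  qed simp
  have int: "closed_segment x y \<inter> path_image (polyline (y # z # zs)) \<subseteq> {x, y}"
  proof
    fix w assume w: "w \<in> closed_segment x y \<inter> path_image (polyline (y # z # zs))"
    then obtain i where i: "i < Suc (length zs)" "w \<in> side (y # z # zs) i"
      using path_image_polyline[of "y # z # zs"] by auto
    have "w \<in> side (x # y # z # zs) 0 \<inter> side (x # y # z # zs) (Suc i)"
      using w i by (simp add: side_0)
    then show "w \<in> {x, y}"
      using disj[of 0 "Suc i"] i(1) by (auto simp: vs split: if_splits)
  qed
  have "x \<noteq> y" using ne[of 0] by (simp add: vs)
  moreover have "last zs = x" using closed zs by (simp add: vs)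
  ultimately show ?thesis
    using int arc zs
    by (simp add: vs simple_path_join_loop arc_linepath pathstart_polyline pathfinish_polyline)
qed

lemma simple_path_polyline_sides:
  assumes "simple_path (polyline vs)" "i < j" "j < length vs - 1"
  shows "finite (side vs i \<inter> side vs j)"
  using assms
proof (induction vs arbitrary: i j rule: polyline.induct)
  case (4 x y z zs)
  have "polyline (x # y # z # zs) = linepath x y +++ polyline (y # z # zs)" by simp
  then have "simple_path (linepath x y +++ polyline (y # z # zs))"
    using "4.prems"(1) by metis
  then obtain arc: "arc (polyline (y # z # zs))"
    and int: "path_image (linepath x y) \<inter> path_image (polyline (y # z # zs)) \<subseteq> {x, y}"
    by (auto simp: pathstart_polyline elim!: simple_path_joinE)
  show ?case
  proof (cases i)
    case 0
    obtain k where j: "j = Suc k" using "4.prems" by (cases j) auto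
    have "side (y # z # zs) k \<subseteq> path_image (polyline (y # z # zs))"
      using "4.prems" j path_image_polyline[of "y # z # zs"] by auto
    then have "side (x # y # z # zs) i \<inter> side (x # y # z # zs) j \<subseteq> {x, y}"
      using int by (auto simp: 0 j side_0)
    then show ?thesis by (rule finite_subset) simp
  next
    case (Suc k)
    obtain l where "j = Suc l" using "4.prems" by (cases j) auto
    then show ?thesis
      using "4.IH"[of k l] "4.prems" Suc arc_imp_simple_path[OF arc] by simp
  qed
qed auto

section \<open>The oriented grid\<close>

definition horizontal :: "dir \<Rightarrow> bool" where
  "horizontal x \<longleftrightarrow> x = La \<or> x = Lc"

lemma horizontal_rot [simp]: "horizontal (rot x) \<longleftrightarrow> \<not> horizontal x"
  by (cases x) (auto simp: horizontal_def)

text \<open>The orientation of the grid: horizontal edges start at points with even coordinate sum, vertical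
edges at points with odd coordinate sum. Each unit segment is a valid edge in exactly one direction.\<close>

definition valid :: "edge \<Rightarrow> bool" where
  "valid e \<longleftrightarrow> (\<exists>a b :: int. fst e = Complex (of_int a) (of_int b) \<and>
     (horizontal (snd e) \<longleftrightarrow> even (a + b)))"

lemma validE:
  assumes "valid (p, x)"
  obtains a b :: int where "p = Complex (of_int a) (of_int b)" "horizontal x \<longleftrightarrow> even (a + b)"
  using assms by (auto simp: valid_def)

lemma validI: "p = Complex (of_int a) (of_int b) \<Longrightarrow> (horizontal x \<longleftrightarrow> even (a + b)) \<Longrightarrow> valid (p, x)"
  by (auto simp: valid_def)

lemma valid_head:
  assumes "valid (p, x)" and "horizontal y \<longleftrightarrow> \<not> horizontal x"
  shows "valid (p + step x, y)"
proof -
  obtain a b :: int where ab: "p = Complex (of_int a) (of_int b)" "horizontal x \<longleftrightarrow> even (a + b)"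
    using assms(1) by (rule validE)
  show ?thesis
  proof (cases x)
    case La then show ?thesis using ab assms(2) by (intro validI[of _ "a + 1" b]) (auto simp: complex_eq_iff)
  next
    case Lb then show ?thesis using ab assms(2) by (intro validI[of _ a "b + 1"]) (auto simp: complex_eq_iff)
  next
    case Lc then show ?thesis using ab assms(2) by (intro validI[of _ "a - 1" b]) (auto simp: complex_eq_iff)
  next
    case Ld then show ?thesis using ab assms(2) by (intro validI[of _ a "b - 1"]) (auto simp: complex_eq_iff)
  qed
qed

lemma horizontal_eq_cases: "(horizontal x \<longleftrightarrow> horizontal y) \<longleftrightarrow> y = x \<or> y = rot (rot x)"
  by (cases x; cases y) (auto simp: horizontal_def)

lemma valid_same_tail: "valid (p, x) \<Longrightarrow> valid (p, y) \<longleftrightarrow> y = x \<or> y = rot (rot x)"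
  unfolding horizontal_eq_cases[symmetric] by (auto simp: valid_def)

lemma valid_same_head:
  assumes "valid (p, x)" "valid (q, y)" "p + step x = q + step y"
  shows "y = x \<or> y = rot (rot x)"
proof -
  have "valid (p + step x, rot x)" using assms(1) by (rule valid_head) simp
  moreover have "valid (p + step x, rot y)" unfolding assms(3) using assms(2) by (rule valid_head) simp
  ultimately have "horizontal (rot x) \<longleftrightarrow> horizontal (rot y)" by (auto simp: valid_def)
  then show ?thesis by (simp add: horizontal_eq_cases[symmetric])
qed

lemma valid_grid: "valid e \<Longrightarrow> fst e \<in> grid_points"
  by (auto simp: valid_def grid_points_def)

text \<open>The cut corners are segments of the sphere of radius \<open>1/4\<close> around a grid point in this norm, which
makes it more convenient than the Euclidean one.\<close>

definition norm1 :: "complex \<Rightarrow> real" where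
  "norm1 z = \<bar>Re z\<bar> + \<bar>Im z\<bar>"

lemma norm1_diff_triangle: "norm1 (a - c) \<le> norm1 (a - b) + norm1 (b - c)"
  by (simp add: norm1_def)

lemma norm1_minus_commute: "norm1 (a - b) = norm1 (b - a)"
  by (simp add: norm1_def)

lemma norm1_times_step [simp]: "norm1 (a * step x) = norm1 a"
  by (cases x) (auto simp: norm1_def)

definition midpt :: "edge \<Rightarrow> complex" where
  "midpt e = fst e + step (snd e) / 2"

text \<open>In twice the scale, the midpoints of edges are integer points with odd coordinate sum, and two such points
have an even distance in the norm \<open>norm1\<close>; by the orientation, a midpoint determines its edge.\<close>

lemma midpt_distinct:
  assumes "valid e" "valid e'" "norm1 (midpt e - midpt e') < 1"
  shows "e = e'"
proof -
  obtain p x q y where e: "e = (p, x)" "e' = (q, y)" by (cases e, cases e')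
  obtain a b :: int where ab: "p = Complex (of_int a) (of_int b)" "horizontal x \<longleftrightarrow> even (a + b)"
    using assms(1) e by (auto elim: validE)
  obtain c d :: int where cd: "q = Complex (of_int c) (of_int d)" "horizontal y \<longleftrightarrow> even (c + d)"
    using assms(2) e by (auto elim: validE)
  define dx :: "dir \<Rightarrow> int" where "dx z = (case z of La \<Rightarrow> 1 | Lb \<Rightarrow> 0 | Lc \<Rightarrow> - 1 | Ld \<Rightarrow> 0)" for z
  define dy :: "dir \<Rightarrow> int" where "dy z = (case z of La \<Rightarrow> 0 | Lb \<Rightarrow> 1 | Lc \<Rightarrow> 0 | Ld \<Rightarrow> - 1)" for z
  have st: "step z = Complex (of_int (dx z)) (of_int (dy z))" for z
    by (cases z) (auto simp: dx_def dy_def complex_eq_iff)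
  define A B :: int where "A = 2 * (a - c) + (dx x - dx y)" and "B = 2 * (b - d) + (dy x - dy y)"
  have "real_of_int A = 2 * Re (midpt e - midpt e')" "real_of_int B = 2 * Im (midpt e - midpt e')"
    unfolding A_def B_def midpt_def e ab cd by (simp_all add: st)
  then have "real_of_int (\<bar>A\<bar> + \<bar>B\<bar>) < real_of_int 2"
    using assms(3) by (simp add: norm1_def abs_mult)
  then have AB: "\<bar>A\<bar> + \<bar>B\<bar> < 2" by (simp only: of_int_less_iff)
  have "even (dx x - dx y + (dy x - dy y))"
    by (cases x; cases y) (simp_all add: dx_def dy_def)
  then have ev: "even (A + B)" unfolding A_def B_def by simp
  have "A \<in> {-1, 0, 1}" "B \<in> {-1, 0, 1}" using AB by auto
  then have zero: "A = 0" "B = 0" using AB ev by auto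
  have "a = c \<and> b = d \<and> x = y"
  proof (cases "horizontal x \<longleftrightarrow> horizontal y")
    case True
    then have ev: "even (a + b) \<longleftrightarrow> even (c + d)" using ab(2) cd(2) by simp
    have "y = x \<or> y = rot (rot x)" using True by (simp add: horizontal_eq_cases)
    then show ?thesis
    proof
      assume "y = x"
      then show ?thesis using zero by (simp add: A_def B_def)
    next
      assume y: "y = rot (rot x)"
      have 1: "dx (rot (rot x)) = - dx x" "dy (rot (rot x)) = - dy x" "odd (dx x + dy x)"
        by (cases x; simp add: dx_def dy_def)+
      then have "c = a + dx x" "d = b + dy x" using zero by (simp_all add: A_def B_def y)
      then have "c + d = (a + b) + (dx x + dy x)" by simp
      then have False using ev 1(3) by (metis even_add)
      then show ?thesis ..
    qed
  next
    case False
    then have "odd (dx x - dx y)" by (cases x; cases y; simp add: dx_def horizontal_def)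
    moreover have "dx x - dx y = 2 * (c - a)" using zero(1) by (simp add: A_def)
    ultimately show ?thesis by simp
  qed
  then show ?thesis using e ab cd by simp
qed

text \<open>Coordinates in which the edge is the real interval from \<open>-1/2\<close> to \<open>1/2\<close>.\<close>

definition local_coord :: "edge \<Rightarrow> complex \<Rightarrow> complex" where
  "local_coord e z = (z - midpt e) * cnj (step (snd e))"

lemma step_cnj [simp]: "step x * cnj (step x) = 1" "cnj (step x) * step x = 1"
  by (cases x; simp)+

lemma local_coord_inverse: "z = midpt e + step (snd e) * local_coord e z"
proof -
  have "step (snd e) * ((z - midpt e) * cnj (step (snd e)))
      = (z - midpt e) * (step (snd e) * cnj (step (snd e)))" by (simp only: mult_ac)
  also have "\<dots> = z - midpt e" by simp
  finally have "step (snd e) * local_coord e z = z - midpt e" unfolding local_coord_def .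
  then show ?thesis by (metis add_diff_cancel_left' diff_eq_eq add.commute)
qed

lemma local_coord_midpt [simp]: "local_coord e (midpt e + step (snd e) * w) = w"
proof -
  have "step (snd e) * w * cnj (step (snd e)) = w * (step (snd e) * cnj (step (snd e)))"
    by (simp only: mult_ac)
  then show ?thesis by (simp add: local_coord_def)
qed

lemma norm1_times_cnj_step [simp]: "norm1 (a * cnj (step x)) = norm1 a"
  by (cases x) (auto simp: norm1_def)

lemma norm1_local_coord: "norm1 (local_coord e z) = norm1 (z - midpt e)"
  by (simp add: local_coord_def)

lemma local_coord_grid:
  assumes "valid e" "w \<in> grid_points"
  shows "1 / 2 \<le> \<bar>Re (local_coord e w)\<bar>" "\<bar>Im (local_coord e w)\<bar> \<in> \<int>"
proof -
  obtain a b :: int where ab: "fst e = Complex (of_int a) (of_int b)"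
    using assms(1) by (auto simp: valid_def)
  obtain c d :: int where cd: "w = Complex (of_int c) (of_int d)"
    using assms(2) unfolding grid_points_def by (metis (mono_tags) Ints_cases complex.collapse mem_Collect_eq)
  have h: "1 / 2 \<le> \<bar>real_of_int k - 1 / 2\<bar>" for k
  proof (cases "1 \<le> k")
    case True
    then have "1 \<le> real_of_int k" by simp
    then show ?thesis by linarith
  next
    case False
    then have "k \<le> 0" by simp
    then have "real_of_int k \<le> 0" by simp
    then show ?thesis by linarith
  qed
  show "1 / 2 \<le> \<bar>Re (local_coord e w)\<bar>"
  proof (cases "snd e")
    case La then show ?thesis using h[of "c - a"] by (simp add: local_coord_def midpt_def ab cd algebra_simps)
  next
    case Lb then show ?thesis using h[of "d - b"] by (simp add: local_coord_def midpt_def ab cd algebra_simps)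
  next
    case Lc then show ?thesis using h[of "a - c"] by (simp add: local_coord_def midpt_def ab cd algebra_simps)
  next
    case Ld then show ?thesis using h[of "b - d"] by (simp add: local_coord_def midpt_def ab cd algebra_simps)
  qed
  show "\<bar>Im (local_coord e w)\<bar> \<in> \<int>"
    by (cases "snd e") (auto simp: local_coord_def midpt_def ab cd)
qed

section \<open>Rounding a closed turning path\<close>

lemma grid_points_eqI:
  assumes "p \<in> grid_points" "q \<in> grid_points" "norm1 (p - q) < 1"
  shows "p = q"
proof -
  obtain a b c d :: int where "Re p = of_int a" "Im p = of_int b" "Re q = of_int c" "Im q = of_int d"
    using assms unfolding grid_points_def by (auto elim!: Ints_cases)
  moreover from this have "real_of_int (\<bar>a - c\<bar> + \<bar>b - d\<bar>) < real_of_int 1"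
    using assms(3) by (simp add: norm1_def)
  then have "\<bar>a - c\<bar> + \<bar>b - d\<bar> < 1" by (simp only: of_int_less_iff)
  ultimately show ?thesis by (auto simp: complex_eq_iff)
qed

text \<open>What the topology needs to know of the \<open>\<theta>\<close>-loop: it is closed, it starts horizontally, and it
turns left or right at each corner, the base point included.\<close>

locale turning_loop =
  fixes u :: "dir list"
  assumes length_ge: "3 \<le> length u"
    and closed: "displacement u = 0"
    and horizontal_first: "horizontal (u ! 0)"
    and turning: "j < length u \<Longrightarrow>
      u ! (Suc j mod length u) = rot (u ! j) \<or> u ! (Suc j mod length u) = rot (rot (rot (u ! j)))"
begin

abbreviation "n \<equiv> length u"
abbreviation "vtx j \<equiv> word_vertex u j"
abbreviation "dirv j \<equiv> step (u ! j)"
abbreviation "nxt j \<equiv> Suc j mod n"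

definition edge_at :: "nat \<Rightarrow> edge" where
  "edge_at j = (vtx j, u ! j)"

lemma edge_list_nth: "j < n \<Longrightarrow> edge_list 0 u ! j = edge_at j"
  by (simp add: nth_edge_list edge_at_def word_vertex_def)

lemma set_edge_list: "set (edge_list 0 u) = edge_at ` {..<n}"
proof -
  have "edge_list 0 u = map edge_at [0..<n]"
    by (intro nth_equalityI) (auto simp: edge_list_nth)
  then show ?thesis by (simp add: atLeast0LessThan)
qed

lemma nxt_less [simp]: "nxt j < n"
  using length_ge by (intro mod_less_divisor) auto

lemma vtx_Suc: "j < n \<Longrightarrow> vtx (Suc j) = vtx j + dirv j"
  by (simp add: word_vertex_def take_Suc_conv_app_nth)

lemma vtx_0 [simp]: "vtx 0 = 0" by (simp add: word_vertex_def)

lemma vtx_nxt: "j < n \<Longrightarrow> vtx (nxt j) = vtx j + dirv j"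
proof (cases "Suc j = n")
  case True
  assume "j < n"
  then have "vtx j + dirv j = vtx n" using vtx_Suc[of j] True by simp
  also have "\<dots> = 0" by (simp add: word_vertex_def closed)
  finally show ?thesis using True by simp
next
  case False
  assume "j < n"
  then show ?thesis using False vtx_Suc[of j] by simp
qed

lemma nxt_inj: "j < n \<Longrightarrow> k < n \<Longrightarrow> nxt j = nxt k \<Longrightarrow> j = k"
  by (cases "Suc j = n"; cases "Suc k = n") auto

lemma dirv_nxt: "j < n \<Longrightarrow> dirv (nxt j) = \<i> * dirv j \<or> dirv (nxt j) = - \<i> * dirv j"
  using turning[of j] by auto

lemma horizontal_nxt: "j < n \<Longrightarrow> horizontal (u ! nxt j) \<longleftrightarrow> \<not> horizontal (u ! j)"
  using turning[of j] by auto

lemma valid_edge_at: "j < n \<Longrightarrow> valid (edge_at j)"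
proof (induction j)
  case 0
  show ?case
    unfolding edge_at_def using horizontal_first by (intro validI[of _ 0 0]) (auto simp: complex_eq_iff)
next
  case (Suc j)
  then have "valid (vtx j + dirv j, u ! Suc j)"
    using horizontal_nxt[of j] by (intro valid_head) (auto simp: edge_at_def)
  then show ?case using Suc.prems by (simp add: edge_at_def vtx_Suc)
qed

definition kept :: "nat \<Rightarrow> complex set" where
  "kept j = closed_segment (vtx j + dirv j / 4) (vtx (Suc j) - dirv j / 4)"

definition chord :: "nat \<Rightarrow> complex set" where
  "chord j = closed_segment (vtx (Suc j) - dirv j / 4) (vtx (nxt j) + dirv (nxt j) / 4)"

lemma kept_memE:
  assumes "z \<in> kept j" "j < n"
  obtains t where "\<bar>t\<bar> \<le> 1 / 4" "z = midpt (edge_at j) + of_real t * dirv j"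
proof -
  obtain r where r: "0 \<le> r" "r \<le> 1"
    "z = (1 - r) *\<^sub>R (vtx j + dirv j / 4) + r *\<^sub>R (vtx (Suc j) - dirv j / 4)"
    using assms(1) unfolding kept_def closed_segment_def by blast
  have "z = midpt (edge_at j) + of_real (r / 2 - 1 / 4) * dirv j"
    unfolding r(3) using assms(2)
    by (simp add: midpt_def edge_at_def vtx_Suc scaleR_conv_of_real field_simps)
  moreover have "\<bar>r / 2 - 1 / 4\<bar> \<le> 1 / 4" using r(1,2) by linarith
  ultimately show ?thesis using that by blast
qed

lemma chord_memE:
  assumes "z \<in> chord j" "j < n"
  obtains t where "0 \<le> t" "t \<le> 1"
    "z = vtx (nxt j) - of_real ((1 - t) / 4) * dirv j + of_real (t / 4) * dirv (nxt j)"
proof -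
  obtain t where t: "0 \<le> t" "t \<le> 1"
    "z = (1 - t) *\<^sub>R (vtx (Suc j) - dirv j / 4) + t *\<^sub>R (vtx (nxt j) + dirv (nxt j) / 4)"
    using assms(1) unfolding chord_def closed_segment_def by blast
  have "vtx (Suc j) = vtx (nxt j)" using assms(2) by (simp add: vtx_Suc vtx_nxt)
  then have "z = vtx (nxt j) - of_real ((1 - t) / 4) * dirv j + of_real (t / 4) * dirv (nxt j)"
    unfolding t(3) by (simp add: scaleR_conv_of_real field_simps)
  then show ?thesis using that t by blast
qed

lemma norm1_kept:
  assumes "z \<in> kept j" "j < n"
  shows "norm1 (z - midpt (edge_at j)) \<le> 1 / 4"
proof -
  obtain t where t: "\<bar>t\<bar> \<le> 1 / 4" "z = midpt (edge_at j) + of_real t * dirv j"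
    using assms by (rule kept_memE)
  then have "norm1 (z - midpt (edge_at j)) = norm1 (of_real t)" by simp
  then show ?thesis using t(1) by (simp add: norm1_def)
qed

lemma chord_local:
  assumes "z \<in> chord j" "j < n"
  obtains t c where "0 \<le> t" "t \<le> 1" "c = 1 \<or> c = - 1" "dirv (nxt j) = of_real c * (\<i> * dirv j)"
    "z - vtx (nxt j) = Complex (- (1 - t) / 4) (c * t / 4) * dirv j"
proof -
  obtain t where t: "0 \<le> t" "t \<le> 1"
    "z = vtx (nxt j) - of_real ((1 - t) / 4) * dirv j + of_real (t / 4) * dirv (nxt j)"
    using assms by (rule chord_memE)
  obtain c :: real where c: "c = 1 \<or> c = - 1" "dirv (nxt j) = of_real c * (\<i> * dirv j)"
    using dirv_nxt[OF assms(2)] by (metis mult_minus_left mult_1 of_real_1 of_real_minus)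
  have gen: "w - a * s + b * (c * (\<i> * s)) - w = (- a + b * c * \<i>) * s" for w a b c s :: complex
    by (simp add: algebra_simps)
  have "Complex (- (1 - t) / 4) (c * t / 4) = - of_real ((1 - t) / 4) + of_real (t / 4) * of_real c * \<i>"
    by (simp add: complex_eq_iff field_simps)
  then have "z - vtx (nxt j) = Complex (- (1 - t) / 4) (c * t / 4) * dirv j"
    unfolding t(3) c(2) gen by simp
  then show ?thesis using that t(1,2) c by blast
qed

lemma norm1_chord:
  assumes "z \<in> chord j" "j < n"
  shows "norm1 (z - vtx (nxt j)) = 1 / 4"
  using assms
proof (rule chord_local)
  fix t c :: real
  assume t: "0 \<le> t" "t \<le> 1" and c: "c = 1 \<or> c = - 1"
    and z: "z - vtx (nxt j) = Complex (- (1 - t) / 4) (c * t / 4) * dirv j"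
  have "\<bar>- (1 - t) / 4\<bar> + \<bar>c * t / 4\<bar> = 1 / 4" using t c by (auto simp: field_simps)
  then show ?thesis unfolding z norm1_times_step by (simp add: norm1_def)
qed

lemma vtx_grid: "j < n \<Longrightarrow> vtx j \<in> grid_points"
  using valid_grid[OF valid_edge_at[of j]] by (simp add: edge_at_def)

definition corners :: "complex list" where
  "corners = concat (map (kept_ends u) [0..<n]) @ [hd (kept_ends u 0)]"

lemma rounded_loop_corners: "rounded_loop u = polyline corners"
  by (simp add: rounded_loop_def corners_def)

lemma length_corners [simp]: "length corners = 2 * n + 1"
proof -
  have "length (concat (map (kept_ends u) [0..<k])) = 2 * k" for k
    by (induction k) (auto simp: kept_ends_def)
  then show ?thesis by (simp add: corners_def)
qed

lemma nth_corners:
  "j < n \<Longrightarrow> corners ! (2 * j) = vtx j + dirv j / 4"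
  "j < n \<Longrightarrow> corners ! Suc (2 * j) = vtx (Suc j) - dirv j / 4"
  "j < n \<Longrightarrow> corners ! Suc (Suc (2 * j)) = vtx (nxt j) + dirv (nxt j) / 4"
proof -
  define c where "c k = concat (map (kept_ends u) [0..<k])" for k
  have len: "length (c k) = 2 * k" for k
    unfolding c_def by (induction k) (auto simp: kept_ends_def)
  have c: "j < k \<Longrightarrow> c k ! (2 * j) = vtx j + dirv j / 4 \<and> c k ! Suc (2 * j) = vtx (Suc j) - dirv j / 4" for j k
  proof (induction k)
    case (Suc k)
    have s: "c (Suc k) = c k @ kept_ends u k" by (simp add: c_def)
    show ?case
    proof (cases "j = k")
      case True
      then show ?thesis by (simp add: s nth_append len kept_ends_def)
    next
      case False
      then have "j < k" using Suc.prems by simp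
      then show ?thesis using Suc.IH by (simp add: s nth_append len)
    qed
  qed simp
  have cn: "corners = c n @ [hd (kept_ends u 0)]" by (simp add: corners_def c_def)
  show 1: "corners ! (2 * j) = vtx j + dirv j / 4" if "j < n" for j
    using c[OF that] that by (simp add: cn nth_append len)
  show "corners ! Suc (2 * j) = vtx (Suc j) - dirv j / 4" if "j < n"
    using c[OF that] that by (simp add: cn nth_append len)
  show "corners ! Suc (Suc (2 * j)) = vtx (nxt j) + dirv (nxt j) / 4" if j: "j < n"
  proof (cases "Suc j = n")
    case True
    then have "Suc (Suc (2 * j)) = length (c n)" by (simp add: len)
    then show ?thesis using True by (simp add: cn nth_append kept_ends_def)
  next
    case False
    then show ?thesis using 1[of "Suc j"] j by simp
  qed
qed

lemma side_even: "j < n \<Longrightarrow> side corners (2 * j) = kept j"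
  by (simp add: side_def kept_def nth_corners)

lemma side_odd: "j < n \<Longrightarrow> side corners (Suc (2 * j)) = chord j"
  by (simp add: side_def chord_def nth_corners)

lemma path_image_rounded: "path_image (rounded_loop u) = (\<Union>j<n. kept j \<union> chord j)"
proof -
  have *: "(\<Union>i<2 * k. A i) = (\<Union>j<k. A (2 * j) \<union> A (Suc (2 * j)))" for A :: "nat \<Rightarrow> complex set" and k
    by (induction k) (auto simp: lessThan_Suc)
  have "path_image (rounded_loop u) = (\<Union>i<2 * n. side corners i)"
    using length_ge by (simp add: rounded_loop_corners path_image_polyline)
  then show ?thesis unfolding * by (simp add: side_even side_odd)
qed

lemma corners_nonempty: "corners \<noteq> []"
  by (simp add: corners_def)

lemma pathfinish_rounded: "pathfinish (rounded_loop u) = pathstart (rounded_loop u)"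
proof -
  have "hd corners = corners ! 0" by (simp add: hd_conv_nth corners_nonempty)
  moreover have "last corners = corners ! Suc (Suc (2 * (n - 1)))"
  proof -
    have "Suc (Suc (2 * (n - 1))) = 2 * n" using length_ge by simp
    then show ?thesis by (simp add: last_conv_nth corners_nonempty)
  qed
  moreover have "corners ! Suc (Suc (2 * (n - 1))) = corners ! 0"
  proof -
    have n: "Suc (n - 1) = n" "n - 1 < n" "0 < n" using length_ge by linarith+
    have "corners ! Suc (Suc (2 * (n - 1))) = vtx (nxt (n - 1)) + dirv (nxt (n - 1)) / 4"
      using n(2) by (rule nth_corners(3))
    also have "\<dots> = vtx 0 + dirv 0 / 4" unfolding n(1) by simp
    also have "\<dots> = corners ! 0" using nth_corners(1)[OF n(3)] by simp
    finally show ?thesis .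
  qed
  ultimately show ?thesis
    by (simp add: rounded_loop_corners pathstart_polyline pathfinish_polyline corners_nonempty)
qed

text \<open>An edge traversed twice contributes its middle half twice to the rounded curve.\<close>

lemma distinct_if_simple_rounded:
  assumes "simple_path (rounded_loop u)"
  shows "distinct (edge_list 0 u)"
  unfolding distinct_conv_nth
proof (intro allI impI notI)
  have less: False if "i < j" "j < n" "edge_at i = edge_at j" for i j
  proof -
    have "kept i = kept j" using that by (simp add: kept_def vtx_Suc edge_at_def)
    then have "finite (kept i)"
      using simple_path_polyline_sides[of corners "2 * i" "2 * j"] assms that
      by (simp add: rounded_loop_corners side_even)
    then have "dirv i / 2 = 0"
      using that by (simp add: kept_def vtx_Suc algebra_simps)
    then show False by (cases "u ! i") auto
  qed
  fix i j assume "i < length (edge_list 0 u)" "j < length (edge_list 0 u)" "i \<noteq> j"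
    "edge_list 0 u ! i = edge_list 0 u ! j"
  then show False using less[of i j] less[of j i] by (auto simp: edge_list_nth nat_neq_iff)
qed

end

lemma Complex_times_step_eq: "Complex a b * step x = Complex c d * step x \<longleftrightarrow> a = c \<and> b = d"
proof -
  have "step x \<noteq> 0" by (cases x) auto
  then show ?thesis by simp
qed

locale simple_turning_loop = turning_loop +
  assumes distinct_edges: "distinct (edge_list 0 u)"
begin

lemma edge_at_inj: "j < n \<Longrightarrow> k < n \<Longrightarrow> edge_at j = edge_at k \<Longrightarrow> j = k"
  using distinct_edges by (simp add: distinct_conv_nth edge_list_nth) metis

lemma kept_disjoint:
  assumes "j < n" "k < n" "j \<noteq> k"
  shows "kept j \<inter> kept k = {}"
proof (rule ccontr)
  assume "kept j \<inter> kept k \<noteq> {}"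
  then obtain z where z: "z \<in> kept j" "z \<in> kept k" by blast
  have "norm1 (midpt (edge_at j) - midpt (edge_at k)) \<le>
      norm1 (z - midpt (edge_at j)) + norm1 (z - midpt (edge_at k))"
    using norm1_diff_triangle[of "midpt (edge_at j)" _ z] norm1_minus_commute by metis
  also have "\<dots> < 1" using norm1_kept[OF z(1) assms(1)] norm1_kept[OF z(2) assms(2)] by simp
  finally have "edge_at j = edge_at k"
    using midpt_distinct valid_edge_at assms by blast
  then show False using edge_at_inj assms by blast
qed

text \<open>At a grid point that is passed twice, the four valid edges are all used; so the second passage has
the opposite directions of the first, and its cut corner is the point reflection of the other one.\<close>

lemma chord_disjoint:
  assumes jk: "j < n" "k < n" "j \<noteq> k"
  shows "chord j \<inter> chord k = {}"
proof (rule ccontr)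
  assume "chord j \<inter> chord k \<noteq> {}"
  then obtain z where z: "z \<in> chord j" "z \<in> chord k" by blast
  have "norm1 (vtx (nxt j) - vtx (nxt k)) \<le> norm1 (z - vtx (nxt j)) + norm1 (z - vtx (nxt k))"
    using norm1_diff_triangle[of "vtx (nxt j)" _ z] norm1_minus_commute by metis
  also have "\<dots> < 1" using norm1_chord[OF z(1) jk(1)] norm1_chord[OF z(2) jk(2)] by simp
  finally have w: "vtx (nxt j) = vtx (nxt k)" using grid_points_eqI vtx_grid nxt_less by blast
  have heads: "vtx j + dirv j = vtx k + dirv k" using w vtx_nxt jk by simp
  have "u ! k \<noteq> u ! j"
    using heads edge_at_inj[of j k] jk by (auto simp: edge_at_def)
  then have "u ! k = rot (rot (u ! j))"
    using valid_same_head[of "vtx j" "u ! j" "vtx k" "u ! k"] valid_edge_at jk heads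
    by (auto simp: edge_at_def)
  then have sk: "dirv k = - dirv j" by simp
  have "u ! nxt k \<noteq> u ! nxt j"
    using w edge_at_inj[of "nxt j" "nxt k"] nxt_inj[of j k] jk by (auto simp: edge_at_def)
  then have "u ! nxt k = rot (rot (u ! nxt j))"
    using valid_same_tail[of "vtx (nxt j)" "u ! nxt j" "u ! nxt k"]
      valid_edge_at[of "nxt j"] valid_edge_at[of "nxt k"] w
    by (auto simp: edge_at_def)
  then have sk': "dirv (nxt k) = - dirv (nxt j)" by simp
  obtain t c where t: "0 \<le> t" "t \<le> 1" "c = 1 \<or> c = - 1" "dirv (nxt j) = of_real c * (\<i> * dirv j)"
    "z - vtx (nxt j) = Complex (- (1 - t) / 4) (c * t / 4) * dirv j"
    using z(1) jk(1) by (rule chord_local)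
  obtain r d where r: "0 \<le> r" "r \<le> 1" "d = 1 \<or> d = - 1" "dirv (nxt k) = of_real d * (\<i> * dirv k)"
    "z - vtx (nxt k) = Complex (- (1 - r) / 4) (d * r / 4) * dirv k"
    using z(2) jk(2) by (rule chord_local)
  have "of_real d * (\<i> * dirv j) = of_real c * (\<i> * dirv j)"
    using t(4) r(4) sk sk' by auto
  moreover have "dirv j \<noteq> 0" by (cases "u ! j") auto
  ultimately have cd: "d = c" by auto
  have "Complex (- (1 - r) / 4) (d * r / 4) * dirv k = Complex ((1 - r) / 4) (- (d * r / 4)) * dirv j"
    unfolding sk by (simp add: complex_eq_iff field_simps)
  then have "Complex (- (1 - t) / 4) (c * t / 4) * dirv j = Complex ((1 - r) / 4) (- (c * r / 4)) * dirv j"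
    using t(5) r(5) w cd by metis
  then have "- (1 - t) / 4 = (1 - r) / 4" "c * t / 4 = - (c * r / 4)"
    unfolding Complex_times_step_eq by blast+
  then have "t = 1" "r = 1" and "c * t = - (c * r)" using t(1,2) r(1,2) by auto
  then show False using t(3) by auto
qed

text \<open>A cut corner at \<open>w\<close> and the middle half of an edge can touch only if the edge ends at \<open>w\<close>, and
then only in an end point of the cut corner. That the edge is the one before or after this corner
follows from the orientation of the grid.\<close>

lemma kept_chord:
  assumes jk: "j < n" "k < n" and z: "z \<in> kept j" "z \<in> chord k"
  shows "(j = k \<and> z = vtx (Suc j) - dirv j / 4) \<or> (j = nxt k \<and> z = vtx j + dirv j / 4)"
proof -
  let ?e = "edge_at j"
  define w where "w = vtx (nxt k)"
  define L where "L = local_coord ?e w"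
  obtain t where t: "\<bar>t\<bar> \<le> 1 / 4" "z = midpt ?e + of_real t * dirv j"
    using z(1) jk(1) by (rule kept_memE)
  have s: "step (snd ?e) = dirv j" by (simp add: edge_at_def)
  have w_eq: "w = midpt ?e + dirv j * L"
    using local_coord_inverse[of w ?e] s by (simp add: L_def)
  have "z - w = (of_real t - L) * dirv j"
    unfolding t(2) w_eq by (simp add: algebra_simps)
  then have "norm1 (of_real t - L) = 1 / 4"
    using norm1_chord[OF z(2) jk(2)] unfolding w_def by simp
  then have n1: "\<bar>t - Re L\<bar> + \<bar>Im L\<bar> = 1 / 4" by (simp add: norm1_def)
  have "1 / 2 \<le> \<bar>Re L\<bar>"
    unfolding L_def w_def using jk by (intro local_coord_grid valid_edge_at vtx_grid nxt_less)
  then have L0: "Im L = 0" and L1: "(Re L = 1 / 2 \<and> t = 1 / 4) \<or> (Re L = - 1 / 2 \<and> t = - 1 / 4)"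
    using n1 t(1) by (auto simp: abs_if split: if_splits)
  obtain r c where r: "0 \<le> r" "r \<le> 1" "c = 1 \<or> c = - 1" "dirv (nxt k) = of_real c * (\<i> * dirv k)"
    "z - vtx (nxt k) = Complex (- (1 - r) / 4) (c * r / 4) * dirv k"
    using z(2) jk(2) by (rule chord_local)
  from L1 show ?thesis
  proof
    assume h: "Re L = 1 / 2 \<and> t = 1 / 4"
    then have L: "L = 1 / 2" using L0 by (simp add: complex_eq_iff)
    have w1: "w = vtx j + dirv j" unfolding w_eq L by (simp add: midpt_def edge_at_def)
    have t4: "t = 1 / 4" using h ..
    have z1: "z = w - dirv j / 4" unfolding t(2) w1 t4 by (simp add: midpt_def edge_at_def)
    have heads: "vtx j + dirv j = vtx k + dirv k" using w1 vtx_nxt jk by (simp add: w_def)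
    then have cs: "u ! j = u ! k \<or> u ! j = rot (rot (u ! k))"
      using valid_same_head[of "vtx k" "u ! k" "vtx j" "u ! j"] valid_edge_at jk by (simp add: edge_at_def)
    have "\<not> u ! j = rot (rot (u ! k))"
    proof
      assume "u ! j = rot (rot (u ! k))"
      then have "dirv j = - dirv k" by simp
      then have "z - vtx (nxt k) = Complex (1 / 4) 0 * dirv k"
        using z1 unfolding w_def by (simp add: complex_eq_iff)
      then have "- (1 - r) / 4 = 1 / 4" using r(5) Complex_times_step_eq by metis
      then show False using r by simp
    qed
    then have "edge_at j = edge_at k" using cs heads by (auto simp: edge_at_def)
    then have "j = k" using edge_at_inj jk by blast
    then show ?thesis using z1 jk by (simp add: w_def vtx_nxt vtx_Suc)
  next
    assume h: "Re L = - 1 / 2 \<and> t = - 1 / 4"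
    then have "L = - 1 / 2" using L0 by (simp add: complex_eq_iff)
    then have w1: "w = vtx j" unfolding w_eq by (simp add: midpt_def edge_at_def)
    have t4: "t = - 1 / 4" using h ..
    have z1: "z = w + dirv j / 4" unfolding t(2) w1 t4 by (simp add: midpt_def edge_at_def)
    have cs: "u ! j = u ! nxt k \<or> u ! j = rot (rot (u ! nxt k))"
      using valid_same_tail[of "vtx (nxt k)" "u ! nxt k" "u ! j"] valid_edge_at[of "nxt k"]
        valid_edge_at[of j] w1 jk by (simp add: edge_at_def w_def)
    have "\<not> u ! j = rot (rot (u ! nxt k))"
    proof
      assume "u ! j = rot (rot (u ! nxt k))"
      then have "dirv j = - (of_real c * (\<i> * dirv k))" by (simp add: r(4))
      then have "z - vtx (nxt k) = Complex 0 (- c / 4) * dirv k"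
        using z1 unfolding w_def by (simp add: complex_eq_iff)
      then have "- (1 - r) / 4 = 0 \<and> c * r / 4 = - c / 4" using r(5) Complex_times_step_eq by metis
      then show False using r(3) by auto
    qed
    then have "edge_at j = edge_at (nxt k)" using cs w1 by (auto simp: edge_at_def w_def)
    then have "j = nxt k" using edge_at_inj jk by simp
    then show ?thesis using z1 w1 by simp
  qed
qed

lemma simple_rounded: "simple_path (rounded_loop u)"
  unfolding rounded_loop_corners
proof (rule simple_path_polyline_closed)
  show "4 \<le> length corners" using length_ge by simp
  show "hd corners = last corners"
    using pathfinish_rounded
    by (simp add: rounded_loop_corners pathstart_polyline pathfinish_polyline corners_nonempty)
next
  fix i assume i: "i < length corners - 1"
  define j where "j = i div 2"
  have j: "j < n" using i by (auto simp: j_def)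
  have "i = 2 * j \<or> i = Suc (2 * j)" by (auto simp: j_def)
  then show "corners ! i \<noteq> corners ! Suc i"
  proof
    assume "i = 2 * j"
    moreover have "vtx j + dirv j / 4 \<noteq> vtx (Suc j) - dirv j / 4"
      using j by (cases "u ! j") (auto simp: vtx_Suc complex_eq_iff)
    ultimately show ?thesis using nth_corners[OF j] by simp
  next
    assume "i = Suc (2 * j)"
    moreover have "vtx (Suc j) - dirv j / 4 \<noteq> vtx (nxt j) + dirv (nxt j) / 4"
    proof -
      have "- dirv j \<noteq> dirv (nxt j)" using dirv_nxt[OF j] by (cases "u ! j") (auto simp: complex_eq_iff)
      then show ?thesis using j by (auto simp: vtx_Suc vtx_nxt add_eq_0_iff)
    qed
    ultimately show ?thesis using nth_corners[OF j] by simp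
  qed
next
  fix i k assume ik: "i < k" "k < length corners - 1"
  define a where "a = i div 2"
  define b where "b = k div 2"
  have ab: "a < n" "b < n" "a \<le> b" using ik by (auto simp: a_def b_def)
  have ci: "i = 2 * a \<or> i = Suc (2 * a)" and ck: "k = 2 * b \<or> k = Suc (2 * b)"
    by (auto simp: a_def b_def)
  let ?R = "if k = Suc i then {corners ! k} else if i = 0 \<and> k = length corners - 2 then {hd corners} else {}"
  have h0: "hd corners = vtx 0 + dirv 0 / 4"
  proof -
    have "0 < n" using length_ge by linarith
    then show ?thesis using nth_corners(1)[of 0] by (simp add: hd_conv_nth corners_nonempty)
  qed
  from ci ck show "side corners i \<inter> side corners k \<subseteq> ?R"
  proof (elim disjE)
    assume e: "i = 2 * a" "k = 2 * b"
    then show ?thesis using kept_disjoint[of a b] ab ik by (simp add: side_even)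
  next
    assume e: "i = Suc (2 * a)" "k = Suc (2 * b)"
    then show ?thesis using chord_disjoint[of a b] ab ik by (simp add: side_odd)
  next
    assume e: "i = 2 * a" "k = Suc (2 * b)"
    show ?thesis
    proof
      fix z assume "z \<in> side corners i \<inter> side corners k"
      then have "z \<in> kept a" "z \<in> chord b" using e ab by (auto simp: side_even side_odd)
      then consider "a = b" "z = vtx (Suc a) - dirv a / 4" | "a = nxt b" "z = vtx a + dirv a / 4"
        using kept_chord ab by blast
      then show "z \<in> ?R"
      proof cases
        case 1
        then show ?thesis using e ab nth_corners(2)[of b] by simp
      next
        case 2
        then have "Suc b = n" using ab by (cases "Suc b = n") auto
        then have "a = 0" using 2 by simp
        moreover have "k = length corners - 2" "k \<noteq> Suc i"
          using e \<open>Suc b = n\<close> \<open>a = 0\<close> length_ge by auto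
        moreover have "z = hd corners" using 2(2) h0 \<open>a = 0\<close> by metis
        ultimately show ?thesis using e by simp
      qed
    qed
  next
    assume e: "i = Suc (2 * a)" "k = 2 * b"
    show ?thesis
    proof
      fix z assume "z \<in> side corners i \<inter> side corners k"
      then have "z \<in> chord a" "z \<in> kept b" using e ab by (auto simp: side_even side_odd)
      moreover have "b \<noteq> a" using e ik by auto
      ultimately have 1: "b = nxt a" "z = vtx b + dirv b / 4"
        using kept_chord ab by blast+
      then have "b = Suc a" using ab e ik by (cases "Suc a = n") auto
      then show "z \<in> ?R" using e ab 1 nth_corners(1)[of b] by simp
    qed
  qed
qed

end

section \<open>Faces and the signed area\<close>

text \<open>Faces are represented by their centres. The edges around the left face of \<open>e\<close> are \<open>e\<close>, \<open>lnext e\<close> and so on; those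
around its right face are \<open>e\<close>, \<open>rnext e\<close> and so on.\<close>

definition left_face :: "edge \<Rightarrow> complex" where
  "left_face e = midpt e + \<i> * step (snd e) / 2"

definition right_face :: "edge \<Rightarrow> complex" where
  "right_face e = midpt e - \<i> * step (snd e) / 2"

definition lnext :: "edge \<Rightarrow> edge" where
  "lnext e = (fst e + step (snd e), rot (snd e))"

definition rnext :: "edge \<Rightarrow> edge" where
  "rnext e = (fst e + step (snd e), rot (rot (rot (snd e))))"

lemma lnext4 [simp]: "lnext (lnext (lnext (lnext e))) = e"
  by (simp add: lnext_def)

lemma rnext4 [simp]: "rnext (rnext (rnext (rnext e))) = e"
  by (cases "snd e") (simp_all add: rnext_def prod_eq_iff)

lemma left_face_lnext [simp]: "left_face (lnext e) = left_face e"
  by (simp add: left_face_def lnext_def midpt_def field_simps)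

lemma right_face_rnext [simp]: "right_face (rnext e) = right_face e"
  by (simp add: right_face_def rnext_def midpt_def field_simps)

lemma valid_lnext: "valid e \<Longrightarrow> valid (lnext e)"
  unfolding lnext_def by (rule valid_head) auto

lemma valid_rnext: "valid e \<Longrightarrow> valid (rnext e)"
  unfolding rnext_def by (rule valid_head) auto

text \<open>The one-form \<open>x dy - y dx\<close>; its integral along a closed path is twice the enclosed signed area.\<close>

definition area_form :: "edge \<Rightarrow> real" where
  "area_form e = Im (cnj (fst e) * step (snd e))"

lemma finite_grid: "bounded B \<Longrightarrow> finite (B \<inter> grid_points)"
proof -
  assume "bounded B"
  then obtain r where r: "\<And>z. z \<in> B \<Longrightarrow> norm z \<le> r" unfolding bounded_iff by blast
  have "B \<inter> grid_points \<subseteq> (\<lambda>(a, b). Complex (of_int a) (of_int b)) ` ({- \<lceil>r\<rceil>..\<lceil>r\<rceil>} \<times> {- \<lceil>r\<rceil>..\<lceil>r\<rceil>})"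
  proof
    fix z assume z: "z \<in> B \<inter> grid_points"
    then obtain a b :: int where ab: "Re z = of_int a" "Im z = of_int b"
      unfolding grid_points_def by (auto elim!: Ints_cases)
    have "\<bar>real_of_int a\<bar> \<le> r" "\<bar>real_of_int b\<bar> \<le> r"
      using abs_Re_le_cmod[of z] abs_Im_le_cmod[of z] r[of z] z ab by auto
    then have "a \<in> {- \<lceil>r\<rceil>..\<lceil>r\<rceil>}" "b \<in> {- \<lceil>r\<rceil>..\<lceil>r\<rceil>}"
      by (simp_all add: abs_le_iff) linarith+
    then show "z \<in> (\<lambda>(a, b). Complex (of_int a) (of_int b)) ` ({- \<lceil>r\<rceil>..\<lceil>r\<rceil>} \<times> {- \<lceil>r\<rceil>..\<lceil>r\<rceil>})"
      using ab by (intro image_eqI[of _ _ "(a, b)"]) (auto simp: complex_eq_iff)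
  qed
  then show ?thesis by (rule finite_subset) simp
qed

lemma sum_dir: "(\<Sum>x\<in>UNIV. f x) = f La + f Lb + f Lc + f Ld" for f :: "dir \<Rightarrow> 'b :: comm_monoid_add"
proof -
  have U: "(UNIV :: dir set) = {La, Lb, Lc, Ld}" using dir.exhaust by auto
  show ?thesis unfolding U by (simp add: add.assoc)
qed

lemma finite_dir [simp]: "finite (UNIV :: dir set)"
proof -
  have U: "(UNIV :: dir set) = {La, Lb, Lc, Ld}" using dir.exhaust by auto
  show ?thesis unfolding U by simp
qed

lemma card_dir [simp]: "card (UNIV :: dir set) = 4"
  using sum_dir[of "\<lambda>_. 1 :: nat"] by simp

text \<open>The edge with a given left face (or right face) and a given direction; it need not be valid.\<close>

definition left_edge :: "complex \<times> dir \<Rightarrow> edge" where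
  "left_edge = (\<lambda>(c, x). (c - (1 + \<i>) / 2 * step x, x))"

definition right_edge :: "complex \<times> dir \<Rightarrow> edge" where
  "right_edge = (\<lambda>(c, x). (c - (1 - \<i>) / 2 * step x, x))"

lemma left_face_eq: "left_face e = c \<longleftrightarrow> e = left_edge (c, snd e)"
proof -
  have "left_face e = fst e + (1 + \<i>) / 2 * step (snd e)"
    by (simp add: left_face_def midpt_def field_simps)
  then show ?thesis by (auto simp: left_edge_def prod_eq_iff eq_diff_eq)
qed

lemma right_face_eq: "right_face e = c \<longleftrightarrow> e = right_edge (c, snd e)"
proof -
  have "right_face e = fst e + (1 - \<i>) / 2 * step (snd e)"
    by (simp add: right_face_def midpt_def field_simps)
  then show ?thesis by (auto simp: right_edge_def prod_eq_iff eq_diff_eq)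
qed

lemma lnext_left_edge: "lnext (left_edge (c, x)) = left_edge (c, rot x)"
  by (simp add: lnext_def left_edge_def field_simps)

lemma rnext_right_edge: "rnext (right_edge (c, x)) = right_edge (c, rot (rot (rot x)))"
  by (simp add: rnext_def right_edge_def field_simps)

lemma valid_left_edge: "valid (left_edge (c, x)) \<Longrightarrow> valid (left_edge (c, y))"
proof -
  assume v: "valid (left_edge (c, x))"
  have 1: "valid (left_edge (c, rot x))" if "valid (left_edge (c, x))" for x
    using valid_lnext[OF that] by (simp add: lnext_left_edge)
  have "y \<in> {x, rot x, rot (rot x), rot (rot (rot x))}" by (cases x; cases y) auto
  then show ?thesis using v 1[of x] 1[of "rot x"] 1[of "rot (rot x)"] by auto
qed

lemma valid_right_edge: "valid (right_edge (c, x)) \<Longrightarrow> valid (right_edge (c, y))"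
proof -
  assume v: "valid (right_edge (c, x))"
  have 1: "valid (right_edge (c, rot (rot (rot x))))" if "valid (right_edge (c, x))" for x
    using valid_rnext[OF that] by (simp add: rnext_right_edge)
  have "y \<in> {x, rot x, rot (rot x), rot (rot (rot x))}" by (cases x; cases y) auto
  then show ?thesis
    using v 1[of x] 1[of "rot (rot (rot x))"] 1[of "rot (rot x)"] by auto
qed

lemma sum_face_boundaries_left:
  "(\<Sum>e\<in>left_edge ` (C \<times> UNIV). area_form e) = 2 * real (card C)"
  "card (left_edge ` (C \<times> UNIV)) = 4 * card C"
proof -
  have inj: "inj_on left_edge (C \<times> UNIV)" by (auto simp: inj_on_def left_edge_def)
  have "(\<Sum>e\<in>left_edge ` (C \<times> UNIV). area_form e) = (\<Sum>c\<in>C. \<Sum>x\<in>UNIV. area_form (left_edge (c, x)))"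
    by (simp add: sum.reindex[OF inj] sum.cartesian_product)
  also have "\<dots> = (\<Sum>c\<in>C. 2)"
    by (simp add: sum_dir area_form_def left_edge_def algebra_simps)
  finally show "(\<Sum>e\<in>left_edge ` (C \<times> UNIV). area_form e) = 2 * real (card C)" by simp
  show "card (left_edge ` (C \<times> UNIV)) = 4 * card C"
    by (simp add: card_image[OF inj] card_cartesian_product)
qed

lemma sum_face_boundaries_right:
  "(\<Sum>e\<in>right_edge ` (C \<times> UNIV). area_form e) = - 2 * real (card C)"
  "card (right_edge ` (C \<times> UNIV)) = 4 * card C"
proof -
  have inj: "inj_on right_edge (C \<times> UNIV)" by (auto simp: inj_on_def right_edge_def)
  have "(\<Sum>e\<in>right_edge ` (C \<times> UNIV). area_form e) = (\<Sum>c\<in>C. \<Sum>x\<in>UNIV. area_form (right_edge (c, x)))"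
    by (simp add: sum.reindex[OF inj] sum.cartesian_product)
  also have "\<dots> = (\<Sum>c\<in>C. - 2)"
    by (simp add: sum_dir area_form_def right_edge_def algebra_simps)
  finally show "(\<Sum>e\<in>right_edge ` (C \<times> UNIV). area_form e) = - 2 * real (card C)" by simp
  show "card (right_edge ` (C \<times> UNIV)) = 4 * card C"
    by (simp add: card_image[OF inj] card_cartesian_product)
qed

section \<open>The inside of the rounded loop\<close>

context simple_turning_loop
begin

abbreviation "curve \<equiv> path_image (rounded_loop u)"
abbreviation "region \<equiv> inside (path_image (rounded_loop u))"

lemmas jordan = Jordan_inside_outside[OF simple_rounded pathfinish_rounded]

lemma region_connected:
  assumes "connected T" "T \<inter> curve = {}" "a \<in> T" "b \<in> T"
  shows "a \<in> region \<longleftrightarrow> b \<in> region"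
proof -
  have "connected_component (- curve) a b" "connected_component (- curve) b a"
    using assms unfolding connected_component_def by blast+
  then show ?thesis using inside_same_component by blast
qed

text \<open>The only points of the rounded loop in the rectangle of width \<open>1/2\<close> and height \<open>1\<close> around the
midpoint of an edge lie on that edge, and only if it belongs to the loop.\<close>

lemma crossing_curve:
  assumes e: "valid e" and z: "z = midpt e + step (snd e) * Complex a b" "z \<in> curve"
    and ab: "\<bar>a\<bar> < 1 / 4" "\<bar>b\<bar> \<le> 1 / 2"
  shows "\<exists>j<n. e = edge_at j \<and> b = 0"
proof -
  obtain j where j: "j < n" "z \<in> kept j \<or> z \<in> chord j"
    using z(2) unfolding path_image_rounded by blast
  have loc: "local_coord e z = Complex a b" unfolding z(1) by simp
  have "z \<notin> chord j"
  proof
    assume "z \<in> chord j"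
    define w where "w = vtx (nxt j)"
    have "local_coord e z - local_coord e w = (z - w) * cnj (step (snd e))"
      by (simp add: local_coord_def algebra_simps)
    then have "norm1 (local_coord e z - local_coord e w) = 1 / 4"
      using norm1_chord[OF \<open>z \<in> chord j\<close> j(1)] by (simp add: w_def)
    then have "\<bar>a - Re (local_coord e w)\<bar> \<le> 1 / 4"
      using abs_ge_zero[of "b - Im (local_coord e w)"]
      unfolding loc norm1_def minus_complex.sel complex.sel by linarith
    moreover have "1 / 2 \<le> \<bar>Re (local_coord e w)\<bar>"
      unfolding w_def using e by (intro local_coord_grid vtx_grid nxt_less)
    ultimately show False using ab(1) by linarith
  qed
  then have kj: "z \<in> kept j" using j by blast
  have "norm1 (z - midpt e) = norm1 (Complex a b)"
    using norm1_local_coord[of e z] loc by simp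
  then have "norm1 (z - midpt e) < 3 / 4" using ab by (simp add: norm1_def)
  moreover have "norm1 (midpt e - midpt (edge_at j)) \<le> norm1 (midpt e - z) + norm1 (z - midpt (edge_at j))"
    by (rule norm1_diff_triangle)
  ultimately have "norm1 (midpt e - midpt (edge_at j)) < 1"
    using norm1_kept[OF kj j(1)] norm1_minus_commute[of z "midpt e"] by linarith
  then have ej: "e = edge_at j" using midpt_distinct e valid_edge_at j(1) by blast
  obtain t where t: "z = midpt (edge_at j) + of_real t * dirv j"
    using kj j(1) by (rule kept_memE)
  have "local_coord e z = of_real t * (dirv j * cnj (dirv j))"
    unfolding t ej local_coord_def by (simp add: edge_at_def)
  then have "local_coord e z = of_real t" by simp
  then have "b = 0" using loc by (simp add: complex_eq_iff)
  then show ?thesis using ej j(1) by blast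
qed

lemma left_right_same:
  assumes "valid e" "e \<notin> edge_at ` {..<n}"
  shows "left_face e \<in> region \<longleftrightarrow> right_face e \<in> region"
proof (rule region_connected)
  show "closed_segment (right_face e) (left_face e) \<inter> curve = {}"
  proof (rule ccontr)
    assume "\<not> ?thesis"
    then obtain z r where z: "z \<in> curve" "0 \<le> r" "r \<le> 1"
        "z = (1 - r) *\<^sub>R right_face e + r *\<^sub>R left_face e"
      unfolding closed_segment_def by blast
    have "z = midpt e + of_real (r - 1 / 2) * (\<i> * step (snd e))"
      unfolding z(4) left_face_def right_face_def by (simp add: scaleR_conv_of_real field_simps)
    also have "\<dots> = midpt e + step (snd e) * Complex 0 (r - 1 / 2)"
    proof -
      have "Complex 0 (r - 1 / 2) = of_real (r - 1 / 2) * \<i>" by (simp add: complex_eq_iff)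
      then show ?thesis by (simp only: mult_ac)
    qed
    finally have zm: "z = midpt e + step (snd e) * Complex 0 (r - 1 / 2)" .
    have "\<bar>r - 1 / 2\<bar> \<le> 1 / 2" using z(2,3) by linarith
    then obtain j where "j < n" "e = edge_at j"
      using crossing_curve[OF assms(1) zm z(1)] by fastforce
    then show False using assms(2) by blast
  qed
qed auto

text \<open>The two halves of this rectangle, left of the edge for \<open>c = 1\<close> and right of it for \<open>c = -1\<close>; each
contains the centre of the face on its side.\<close>

definition half :: "edge \<Rightarrow> real \<Rightarrow> complex set" where
  "half e c = (\<lambda>w. midpt e + step (snd e) * w) ` {w. \<bar>Re w\<bar> < 1 / 4 \<and> 0 < c * Im w \<and> c * Im w \<le> 1 / 2}"

lemma half_connected: "connected (half e c)"
proof -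
  have "convex ({w. \<bar>Re w\<bar> < 1 / 4} \<inter> ({w. 0 < c * Im w} \<inter> {w. c * Im w \<le> 1 / 2}))"
  proof (intro convex_Int)
    show "convex {w. \<bar>Re w\<bar> < 1 / 4}"
      using convex_Int[OF convex_halfspace_Re_gt[of "- 1 / 4"] convex_halfspace_Re_lt[of "1 / 4"]]
      by (rule back_subst[of convex]) (auto simp: abs_less_iff)
    have lin: "linear (\<lambda>w. c * Im w)" by (intro linearI) (auto simp: algebra_simps)
    show "convex {w. 0 < c * Im w}"
      using convex_linear_vimage[OF lin convex_real_interval(3)[of 0]]
      by (rule back_subst[of convex]) auto
    show "convex {w. c * Im w \<le> 1 / 2}"
      using convex_linear_vimage[OF lin convex_real_interval(2)[of "1 / 2"]]
      by (rule back_subst[of convex]) auto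
  qed
  then have "connected {w. \<bar>Re w\<bar> < 1 / 4 \<and> 0 < c * Im w \<and> c * Im w \<le> 1 / 2}"
    by (rule back_subst[of connected, OF convex_connected]) auto
  then show ?thesis unfolding half_def
    by (rule connected_continuous_image[rotated]) (intro continuous_intros)
qed

lemma half_disjoint:
  assumes "valid e" "c = 1 \<or> c = - 1"
  shows "half e c \<inter> curve = {}"
proof (rule ccontr)
  assume "\<not> ?thesis"
  then obtain w where w: "\<bar>Re w\<bar> < 1 / 4" "0 < c * Im w" "c * Im w \<le> 1 / 2"
    "midpt e + step (snd e) * w \<in> curve" unfolding half_def by blast
  have "w = Complex (Re w) (Im w)" by simp
  moreover have "\<bar>Im w\<bar> \<le> 1 / 2" using w(2,3) assms(2) by auto
  ultimately have "Im w = 0" using crossing_curve[OF assms(1) _ w(4) w(1)] by metis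
  then show False using w(2) by simp
qed

text \<open>By the Jordan curve theorem each point of the curve is a boundary point of both its inside and its
outside. Near the midpoint of an edge of the loop only the two half rectangles are off the curve, so
one of them is inside and the other one is outside.\<close>

lemma left_right_differ:
  assumes j: "j < n"
  shows "left_face (edge_at j) \<in> region \<longleftrightarrow> right_face (edge_at j) \<notin> region"
proof -
  let ?e = "edge_at j"
  let ?T = "half ?e 1 \<union> half ?e (- 1)"
  have v: "valid ?e" using j by (rule valid_edge_at)
  have s: "step (snd ?e) = dirv j" by (simp add: edge_at_def)
  have l: "left_face ?e \<in> half ?e 1"
    unfolding half_def left_face_def by (rule image_eqI[of _ _ "\<i> / 2"]) auto
  have r: "right_face ?e \<in> half ?e (- 1)"
    unfolding half_def right_face_def by (rule image_eqI[of _ _ "- \<i> / 2"]) auto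
  have L: "z \<in> region \<longleftrightarrow> left_face ?e \<in> region" if "z \<in> half ?e 1" for z
    using region_connected[OF half_connected half_disjoint[OF v] that l] by blast
  have R: "z \<in> region \<longleftrightarrow> right_face ?e \<in> region" if "z \<in> half ?e (- 1)" for z
    using region_connected[OF half_connected half_disjoint[OF v] that r] by blast
  have near: "z \<in> ?T \<union> curve" if z: "dist (midpt ?e) z < 1 / 4" for z
  proof -
    define w where "w = local_coord ?e z"
    have zw: "z = midpt ?e + step (snd ?e) * w" unfolding w_def by (rule local_coord_inverse)
    have "norm w < 1 / 4" using z unfolding zw dist_norm by (simp add: norm_mult)
    then have w: "\<bar>Re w\<bar> < 1 / 4" "\<bar>Im w\<bar> < 1 / 4"
      using abs_Re_le_cmod[of w] abs_Im_le_cmod[of w] by linarith+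
    consider "Im w > 0" | "Im w < 0" | "Im w = 0" by linarith
    then show ?thesis
    proof cases
      case 1
      then have "z \<in> half ?e 1" unfolding half_def zw using w by auto
      then show ?thesis by blast
    next
      case 2
      then have "z \<in> half ?e (- 1)" unfolding half_def zw using w by auto
      then show ?thesis by blast
    next
      case 3
      then have wr: "w = of_real (Re w)" by (simp add: complex_eq_iff)
      have "z = (1 - (2 * Re w + 1 / 2)) *\<^sub>R (vtx j + dirv j / 4)
          + (2 * Re w + 1 / 2) *\<^sub>R (vtx (Suc j) - dirv j / 4)"
        unfolding zw s by (subst wr)
          (simp add: midpt_def edge_at_def vtx_Suc j scaleR_conv_of_real field_simps)
      moreover have "0 \<le> 2 * Re w + 1 / 2" "2 * Re w + 1 / 2 \<le> 1" using w by linarith+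
      ultimately have "z \<in> kept j" unfolding kept_def closed_segment_def by blast
      then show ?thesis using j unfolding path_image_rounded by blast
    qed
  qed
  have mid: "midpt ?e \<in> curve"
  proof -
    have "midpt ?e = (1 - 1 / 2) *\<^sub>R (vtx j + dirv j / 4) + (1 / 2) *\<^sub>R (vtx (Suc j) - dirv j / 4)"
      by (simp add: midpt_def edge_at_def vtx_Suc j scaleR_conv_of_real field_simps)
    moreover have "(0::real) \<le> 1 / 2" "1 / 2 \<le> (1::real)" by auto
    ultimately have "midpt ?e \<in> kept j" unfolding kept_def closed_segment_def by blast
    then show ?thesis using j unfolding path_image_rounded by blast
  qed
  have "midpt ?e \<in> closure region" "midpt ?e \<in> closure (outside curve)"
    using mid jordan unfolding frontier_def by blast+
  then obtain a b where a: "a \<in> region" "dist (midpt ?e) a < 1 / 4"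
    and b: "b \<in> outside curve" "dist (midpt ?e) b < 1 / 4"
    unfolding closure_approachable by (metis dist_commute zero_less_divide_1_iff zero_less_numeral)
  have "a \<notin> curve" "b \<notin> curve" "b \<notin> region" using a b jordan by blast+
  then have "a \<in> ?T" "b \<in> ?T" using near a b by blast+
  then show ?thesis using L R a(1) \<open>b \<notin> region\<close> by blast
qed

text \<open>At a left turn two consecutive edges share the left face, at a right turn the right face.\<close>

lemma left_face_nxt:
  assumes j: "j < n"
  shows "left_face (edge_at (nxt j)) \<in> region \<longleftrightarrow> left_face (edge_at j) \<in> region"
  using turning[OF j]
proof
  assume "u ! nxt j = rot (u ! j)"
  then have "edge_at (nxt j) = lnext (edge_at j)" using vtx_nxt[OF j] by (simp add: edge_at_def lnext_def)
  then show ?thesis by simp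
next
  assume "u ! nxt j = rot (rot (rot (u ! j)))"
  then have "edge_at (nxt j) = rnext (edge_at j)" using vtx_nxt[OF j] by (simp add: edge_at_def rnext_def)
  then have "right_face (edge_at (nxt j)) = right_face (edge_at j)" by simp
  then show ?thesis using left_right_differ[OF j] left_right_differ[of "nxt j"] by simp
qed

lemma left_face_all: "j < n \<Longrightarrow> left_face (edge_at j) \<in> region \<longleftrightarrow> left_face (edge_at 0) \<in> region"
proof (induction j)
  case (Suc j)
  then show ?case using left_face_nxt[of j] by simp
qed simp

definition ccw_faces :: "complex set" where
  "ccw_faces = {c \<in> region. valid (left_edge (c, La))}"

definition cw_faces :: "complex set" where
  "cw_faces = {c \<in> region. valid (right_edge (c, La))}"

lemma left_inside_edges: "{e. valid e \<and> left_face e \<in> region} = left_edge ` (ccw_faces \<times> UNIV)"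
proof (intro equalityI subsetI)
  fix e assume e: "e \<in> {e. valid e \<and> left_face e \<in> region}"
  have eq: "left_edge (left_face e, snd e) = e"
    using iffD1[OF left_face_eq[of e "left_face e"] refl] by (rule sym)
  have "valid (left_edge (left_face e, snd e))" unfolding eq using e by simp
  then have "valid (left_edge (left_face e, La))" by (rule valid_left_edge)
  then have "(left_face e, snd e) \<in> ccw_faces \<times> UNIV"
    using e by (simp add: ccw_faces_def)
  then have "left_edge (left_face e, snd e) \<in> left_edge ` (ccw_faces \<times> UNIV)" by (rule imageI)
  then show "e \<in> left_edge ` (ccw_faces \<times> UNIV)" unfolding eq .
next
  fix e assume "e \<in> left_edge ` (ccw_faces \<times> UNIV)"
  then obtain c x where e: "e = left_edge (c, x)" "c \<in> ccw_faces" by auto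
  have "left_face e = c"
    unfolding e(1) by (simp add: left_face_def left_edge_def midpt_def field_simps)
  moreover have "valid (left_edge (c, La))" "c \<in> region" using e(2) by (simp_all add: ccw_faces_def)
  moreover have "valid e" unfolding e(1) using calculation(2) by (rule valid_left_edge)
  ultimately show "e \<in> {e. valid e \<and> left_face e \<in> region}" by simp
qed

lemma right_inside_edges: "{e. valid e \<and> right_face e \<in> region} = right_edge ` (cw_faces \<times> UNIV)"
proof (intro equalityI subsetI)
  fix e assume e: "e \<in> {e. valid e \<and> right_face e \<in> region}"
  have eq: "right_edge (right_face e, snd e) = e"
    using iffD1[OF right_face_eq[of e "right_face e"] refl] by (rule sym)
  have "valid (right_edge (right_face e, snd e))" unfolding eq using e by simp
  then have "valid (right_edge (right_face e, La))" by (rule valid_right_edge)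
  then have "(right_face e, snd e) \<in> cw_faces \<times> UNIV"
    using e by (simp add: cw_faces_def)
  then have "right_edge (right_face e, snd e) \<in> right_edge ` (cw_faces \<times> UNIV)" by (rule imageI)
  then show "e \<in> right_edge ` (cw_faces \<times> UNIV)" unfolding eq .
next
  fix e assume "e \<in> right_edge ` (cw_faces \<times> UNIV)"
  then obtain c x where e: "e = right_edge (c, x)" "c \<in> cw_faces" by auto
  have "right_face e = c"
    unfolding e(1) by (simp add: right_face_def right_edge_def midpt_def field_simps)
  moreover have "valid (right_edge (c, La))" "c \<in> region" using e(2) by (simp_all add: cw_faces_def)
  moreover have "valid e" unfolding e(1) using calculation(2) by (rule valid_right_edge)
  ultimately show "e \<in> {e. valid e \<and> right_face e \<in> region}" by simp
qed

lemma finite_faces: "finite ccw_faces" "finite cw_faces"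
proof -
  have bnd: "bounded ((\<lambda>c. c - q) ` region)" for q
    using jordan bounded_translation_minus by blast
  have fin: "finite {c \<in> region. c - q \<in> grid_points}" for q
  proof (rule finite_imageD[of "\<lambda>c. c - q"])
    show "finite ((\<lambda>c. c - q) ` {c \<in> region. c - q \<in> grid_points})"
      by (rule finite_subset[OF _ finite_grid[OF bnd]]) auto
  qed (simp add: inj_on_def)
  show "finite ccw_faces"
    by (rule finite_subset[OF _ fin[of "(1 + \<i>) / 2"]])
       (auto simp: ccw_faces_def left_edge_def dest: valid_grid)
  show "finite cw_faces"
    by (rule finite_subset[OF _ fin[of "(1 - \<i>) / 2"]])
       (auto simp: cw_faces_def right_edge_def dest: valid_grid)
qed

text \<open>Let \<open>A\<close> and \<open>J\<close> be the sets of valid edges with the left and the right face inside, and \<open>E\<close>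
the edges of the loop. Off \<open>E\<close> the sets \<open>A\<close> and \<open>J\<close> agree, while \<open>E\<close> lies completely in one of
them and misses the other. If it were \<open>J = E \<union> A\<close>, the integral of the area form over the loop
would be negative, as clockwise faces contribute \<open>-2\<close> to the integral over \<open>J\<close> and counterclockwise ones \<open>2\<close> to the
integral over \<open>A\<close>. So \<open>A = E \<union> J\<close>, and counting and integrating over both sides gives the two
equations.\<close>

lemma face_count:
  assumes area: "(\<Sum>j<n. area_form (edge_at j)) \<ge> 0"
  shows "\<And>j. j < n \<Longrightarrow> left_face (edge_at j) \<in> region"
    and "4 * card ccw_faces = n + 4 * card cw_faces"
    and "(\<Sum>j<n. area_form (edge_at j)) = 2 * real (card ccw_faces + card cw_faces)"
proof -
  define A where "A = {e. valid e \<and> left_face e \<in> region}"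
  define J where "J = {e. valid e \<and> right_face e \<in> region}"
  define E where "E = edge_at ` {..<n}"
  have fin: "finite A" "finite J" "finite E"
    unfolding A_def J_def E_def left_inside_edges right_inside_edges
    using finite_faces by auto
  have inj: "inj_on edge_at {..<n}" using edge_at_inj by (auto simp: inj_on_def)
  have E: "card E = n" "(\<Sum>e\<in>E. area_form e) = (\<Sum>j<n. area_form (edge_at j))"
    unfolding E_def using inj by (simp_all add: card_image sum.reindex)
  have cards: "card A = 4 * card ccw_faces" "card J = 4 * card cw_faces"
    "(\<Sum>e\<in>A. area_form e) = 2 * real (card ccw_faces)"
    "(\<Sum>e\<in>J. area_form e) = - 2 * real (card cw_faces)"
    unfolding A_def J_def left_inside_edges right_inside_edges
    by (simp_all only: sum_face_boundaries_left sum_face_boundaries_right)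
  have off: "e \<in> A \<longleftrightarrow> e \<in> J" if "e \<notin> E" for e
    using left_right_same[of e] that by (auto simp: A_def J_def E_def)
  have left: "left_face (edge_at 0) \<in> region"
  proof (rule ccontr)
    assume "\<not> ?thesis"
    then have "left_face (edge_at j) \<notin> region" "right_face (edge_at j) \<in> region" if "j < n" for j
      using left_face_all left_right_differ that by blast+
    then have "E \<subseteq> J" "E \<inter> A = {}" using valid_edge_at by (auto simp: E_def J_def A_def)
    then have J: "J = E \<union> A" "E \<inter> A = {}" using off by blast+
    have "card J = n + card A" "(\<Sum>e\<in>J. area_form e) = (\<Sum>e\<in>E. area_form e) + (\<Sum>e\<in>A. area_form e)"
      unfolding J(1) using fin J(2) E(1) by (simp_all add: card_Un_disjoint sum.union_disjoint)
    then have "- 2 * real (card cw_faces) \<ge> 0" "card J = n + card A"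
      using area E(2) cards by linarith+
    then have "card cw_faces = 0" by simp
    then show False using cards \<open>card J = n + card A\<close> length_ge by simp
  qed
  show all: "left_face (edge_at j) \<in> region" if "j < n" for j
    using left left_face_all that by blast
  have "E \<subseteq> A" "E \<inter> J = {}"
    using all left_right_differ valid_edge_at by (auto simp: E_def J_def A_def)
  then have A: "A = E \<union> J" "E \<inter> J = {}" using off by blast+
  have "card A = n + card J" "(\<Sum>e\<in>A. area_form e) = (\<Sum>e\<in>E. area_form e) + (\<Sum>e\<in>J. area_form e)"
    unfolding A(1) using fin A(2) E(1) by (simp_all add: card_Un_disjoint sum.union_disjoint)
  then show "4 * card ccw_faces = n + 4 * card cw_faces"
    "(\<Sum>j<n. area_form (edge_at j)) = 2 * real (card ccw_faces + card cw_faces)"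
    using E(2) cards by simp_all
qed

text \<open>On the way from a grid point to the centre of an adjacent face, the rounded loop is met only where it cuts
off exactly this corner of the face; \<open>d / 2\<close> is the vector from the point to the centre.\<close>

lemma corner_region:
  assumes w: "w \<in> grid_points" and eps: "\<bar>Re d\<bar> = 1" "\<bar>Im d\<bar> = 1"
    and free: "\<And>j. j < n \<Longrightarrow> vtx (nxt j) = w \<Longrightarrow> dirv (nxt j) - dirv j \<noteq> d"
  shows "w \<in> region \<longleftrightarrow> w + d / 2 \<in> region"
proof (rule region_connected)
  show "closed_segment w (w + d / 2) \<inter> curve = {}"
  proof (rule ccontr)
    assume "\<not> ?thesis"
    then obtain z t where z: "z \<in> curve" and t: "0 \<le> t" "t \<le> 1"
        "z = (1 - t) *\<^sub>R w + t *\<^sub>R (w + d / 2)"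
      unfolding closed_segment_def by blast
    have zw: "z = w + of_real (t / 2) * d"
      unfolding t(3) by (simp add: scaleR_conv_of_real algebra_simps)
    obtain j where j: "j < n" "z \<in> kept j \<or> z \<in> chord j"
      using z unfolding path_image_rounded by blast
    define f where "f = d * cnj (dirv j)"
    have f: "\<bar>Re f\<bar> = 1" "\<bar>Im f\<bar> = 1" unfolding f_def using eps by (cases "u ! j"; simp)+
    have df: "d = f * dirv j" unfolding f_def by (simp add: mult.assoc)
    from j(2) show False
    proof
      assume "z \<in> kept j"
      then obtain r where r: "\<bar>r\<bar> \<le> 1 / 4" "z = midpt (edge_at j) + of_real r * dirv j"
        using j(1) by (rule kept_memE)
      define L where "L = local_coord (edge_at j) w"
      have L: "1 / 2 \<le> \<bar>Re L\<bar>" "\<bar>Im L\<bar> \<in> \<int>"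
        unfolding L_def using local_coord_grid[OF valid_edge_at[OF j(1)] w] by blast+
      have "w = midpt (edge_at j) + dirv j * L"
        using local_coord_inverse[of w "edge_at j"] by (simp add: L_def edge_at_def)
      then have "of_real r * dirv j = (L + of_real (t / 2) * f) * dirv j"
        using zw r(2) df by (simp add: algebra_simps)
      moreover have "dirv j \<noteq> 0" by (cases "u ! j") auto
      ultimately have "of_real r = L + of_real (t / 2) * f" by simp
      then have rl: "r = Re L + t / 2 * Re f" "0 = Im L + t / 2 * Im f"
        by (simp_all add: complex_eq_iff)
      then have "\<bar>Im L\<bar> = t / 2" using f t by (auto simp: abs_if split: if_splits)
      moreover obtain k :: int where "\<bar>Im L\<bar> = of_int k" using L(2) by (auto elim: Ints_cases)
      ultimately have k: "of_int k = t / 2" by simp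
      then have "0 \<le> real_of_int k" "real_of_int k < 1" using t by auto
      then have "k = 0" by linarith
      then have "t = 0" using k by simp
      then show False using rl(1) r(1) L(1) by simp
    next
      assume zc: "z \<in> chord j"
      define v where "v = vtx (nxt j)"
      have n1: "norm1 (z - v) = 1 / 4" unfolding v_def using zc j(1) by (rule norm1_chord)
      have "v \<in> grid_points" unfolding v_def by (rule vtx_grid) simp
      then obtain a b a' b' :: int where
        ab: "Re w = of_int a" "Im w = of_int b" "Re v = of_int a'" "Im v = of_int b'"
        using w unfolding grid_points_def by (auto elim!: Ints_cases)
      have big: "1 / 4 < \<bar>of_int x + t / 2 * y - of_int x'\<bar>" if "x \<noteq> x'" "\<bar>y\<bar> = 1" for x x' :: int and y
      proof -
        have "1 \<le> \<bar>x - x'\<bar>" using that by simp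
        then have "1 \<le> \<bar>real_of_int x - real_of_int x'\<bar>" by linarith
        moreover have "\<bar>t / 2 * y\<bar> \<le> 1 / 2" using that t by (simp add: abs_mult)
        ultimately show ?thesis by linarith
      qed
      have "\<bar>of_int a + t / 2 * Re d - of_int a'\<bar> + \<bar>of_int b + t / 2 * Im d - of_int b'\<bar> = 1 / 4"
        using n1 unfolding norm1_def zw by (simp add: ab)
      then have "a = a'" "b = b'" using big[of a a' "Re d"] big[of b b' "Im d"] eps by linarith+
      then have wv: "w = v" using ab by (simp add: complex_eq_iff)
      obtain r c where r: "0 \<le> r" "r \<le> 1" "c = 1 \<or> c = - 1" "dirv (nxt j) = of_real c * (\<i> * dirv j)"
        "z - vtx (nxt j) = Complex (- (1 - r) / 4) (c * r / 4) * dirv j"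
        using zc j(1) by (rule chord_local)
      have "Complex (t / 2 * Re f) (t / 2 * Im f) * dirv j = of_real (t / 2) * d"
      proof -
        have "Complex (t / 2 * Re f) (t / 2 * Im f) = of_real (t / 2) * f" by (simp add: complex_eq_iff)
        then show ?thesis unfolding df by simp
      qed
      also have "\<dots> = z - vtx (nxt j)" unfolding zw using wv v_def by simp
      finally have "t / 2 * Re f = - (1 - r) / 4" "t / 2 * Im f = c * r / 4"
        using r(5) Complex_times_step_eq by metis+
      moreover have "Re f = 1 \<or> Re f = - 1" "Im f = 1 \<or> Im f = - 1" using f by linarith+
      ultimately have "Re f = - 1" "Im f = c"
        using r(1-3) t(1,2) by auto
      then have fc: "f = of_real c * \<i> - 1" by (simp add: complex_eq_iff)
      have "dirv (nxt j) - dirv j = d" unfolding df fc r(4) by (simp add: algebra_simps)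
      then show False using free[OF j(1)] wv v_def by blast
    qed
  qed
qed auto

end

section \<open>The loop of a folding string\<close>

lemma nth_concat_blocks:
  assumes "\<And>x. x \<in> set xs \<Longrightarrow> length (f x) = m" "i < length xs" "r < m"
  shows "concat (map f xs) ! (m * i + r) = f (xs ! i) ! r"
  using assms
proof (induction xs arbitrary: i)
  case (Cons x xs)
  then show ?case by (cases i) (auto simp: nth_append add.assoc)
qed simp

lemma nth_walk_Suc: "j < length S \<Longrightarrow> walk x S ! Suc j = turn (S ! j) (walk x S ! j)"
proof (induction S arbitrary: x j)
  case (Cons c S)
  have "walk y S ! 0 = y" for y by (cases S) auto
  then show ?case using Cons by (cases j) auto
qed simp

text \<open>A string of \<open>m - 1\<close> creases codes an \<open>m\<close>-fold.\<close>

definition fold_count :: "crease list \<Rightarrow> nat" where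
  "fold_count S = Suc (length S)"

text \<open>The letters of the \<open>\<theta>\<close>-loop as a periodic sequence, so that subwords across the base point need no
special treatment.\<close>

definition loop_letter :: "crease list \<Rightarrow> nat \<Rightarrow> dir" where
  "loop_letter S j = theta_letter S ((rot ^^ (j div fold_count S)) La) ! (j mod fold_count S)"

lemma length_loop_word: "length (loop_word S) = 4 * fold_count S"
  unfolding loop_word_def theta_def fold_count_def by (simp add: dir_word_walk)

lemma rot_funpow_4: "(rot ^^ (4 + k)) x = (rot ^^ k) x"
  by (simp add: funpow_add numeral_eq_Suc)

lemma nth_loop_word: "loop_word S ! (j mod (4 * fold_count S)) = loop_letter S j"
proof -
  let ?m = "fold_count S"
  have m: "0 < ?m" by (simp add: fold_count_def)
  have base: "loop_word S ! j = loop_letter S j" if "j < 4 * ?m" for j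
  proof -
    have "loop_word S = concat (map (theta_letter S) [La, Lb, Lc, Ld])"
      by (simp add: loop_word_def theta_def)
    moreover have "concat (map (theta_letter S) [La, Lb, Lc, Ld]) ! (?m * (j div ?m) + j mod ?m)
        = theta_letter S ([La, Lb, Lc, Ld] ! (j div ?m)) ! (j mod ?m)"
      using that m by (intro nth_concat_blocks) (auto simp: fold_count_def less_mult_imp_div_less)
    moreover have "j div ?m < 4" using that by (simp add: less_mult_imp_div_less)
    then have "j div ?m \<in> {0, 1, 2, 3}" by auto
    then have "[La, Lb, Lc, Ld] ! (j div ?m) = (rot ^^ (j div ?m)) La" by (auto simp: numeral_eq_Suc)
    ultimately show ?thesis by (simp add: loop_letter_def)
  qed
  have period: "loop_letter S (j + 4 * ?m * q) = loop_letter S j" for j q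
  proof (induction q)
    case (Suc q)
    have s: "j + 4 * ?m * Suc q = (j + 4 * ?m * q) + 4 * ?m" by simp
    have "(j + 4 * ?m * Suc q) div ?m = 4 + (j + 4 * ?m * q) div ?m"
      unfolding s using m by simp
    moreover have "(j + 4 * ?m * Suc q) mod ?m = (j + 4 * ?m * q) mod ?m"
      unfolding s by (rule mod_mult_self1)
    ultimately show ?case using Suc by (simp add: loop_letter_def rot_funpow_4)
  qed simp
  have "loop_letter S j = loop_letter S (j mod (4 * ?m) + 4 * ?m * (j div (4 * ?m)))" by simp
  also have "\<dots> = loop_letter S (j mod (4 * ?m))" by (rule period)
  finally show ?thesis using base[of "j mod (4 * ?m)"] m by simp
qed

lemma theta_letter_nth_Suc:
  "r < length S \<Longrightarrow> \<exists>c. theta_letter S x ! Suc r = turn c (theta_letter S x ! r)"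
  using theta_letter_walk[of S x] nth_walk_Suc[of r "oriented_string S x" "hd (theta_letter S x)"]
  by (auto simp: oriented_string_def split: if_splits)

lemma loop_letter_Suc:
  "\<exists>c. loop_letter S (Suc j) = turn c (loop_letter S j)"
proof -
  let ?m = "fold_count S" and ?x = "(rot ^^ (j div fold_count S)) La"
  have m: "0 < ?m" by (simp add: fold_count_def)
  show ?thesis
  proof (cases "Suc (j mod ?m) = ?m")
    case True
    then have "Suc j div ?m = Suc (j div ?m)" "Suc j mod ?m = 0"
      by (simp_all add: div_Suc mod_Suc)
    then have "loop_letter S (Suc j) = hd (theta_letter S (rot ?x))"
      by (simp add: loop_letter_def hd_conv_nth)
    also have "\<dots> = turn D (last (theta_letter S ?x))" using hd_theta_letter_turn[of S D ?x] by simp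
    also have "last (theta_letter S ?x) = loop_letter S j"
      using True by (simp add: loop_letter_def last_conv_nth fold_count_def)
    finally show ?thesis by blast
  next
    case False
    then have "Suc j div ?m = j div ?m" "Suc j mod ?m = Suc (j mod ?m)"
      by (simp_all add: div_Suc mod_Suc)
    moreover have "j mod ?m < length S" using False m by (simp add: fold_count_def less_Suc_eq)
        (metis less_Suc_eq mod_less_divisor zero_less_Suc)
    ultimately show ?thesis
      using theta_letter_nth_Suc[of "j mod ?m" S ?x] by (simp add: loop_letter_def)
  qed
qed

lemma turning_loop_word:
  assumes "S \<noteq> []"
  shows "turning_loop (loop_word S)"
proof
  have m: "2 \<le> fold_count S" using assms by (cases S) (auto simp: fold_count_def)
  then show "3 \<le> length (loop_word S)" by (simp add: length_loop_word)
  show "displacement (loop_word S) = 0" by (rule loop_word_closed)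
  show "horizontal (loop_word S ! 0)"
  proof -
    have "dir_word S ! 0 = La" unfolding dir_word_walk by (cases S) auto
    then show ?thesis
      using nth_loop_word[of S 0] by (simp add: loop_letter_def horizontal_def)
  qed
  fix j assume j: "j < length (loop_word S)"
  obtain c where "loop_letter S (Suc j) = turn c (loop_letter S j)" using loop_letter_Suc by blast
  moreover have "loop_word S ! j = loop_letter S j"
    using nth_loop_word[of S j] j by (simp add: length_loop_word)
  ultimately show "loop_word S ! (Suc j mod length (loop_word S)) = rot (loop_word S ! j) \<or>
      loop_word S ! (Suc j mod length (loop_word S)) = rot (rot (rot (loop_word S ! j)))"
    using nth_loop_word[of S "Suc j"] by (cases c) (simp_all add: length_loop_word)
qed

fun left_turns :: "dir list \<Rightarrow> nat" where
  "left_turns (x # y # w) = (if y = rot x then 1 else 0) + left_turns (y # w)"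
| "left_turns w = 0"

lemma left_turns_append:
  "v \<noteq> [] \<Longrightarrow> w \<noteq> [] \<Longrightarrow>
     left_turns (v @ w) = left_turns v + (if hd w = rot (last v) then 1 else 0) + left_turns w"
proof (induction v rule: left_turns.induct)
  case ("2_2" x)
  then show ?case by (cases w) auto
qed auto

lemma left_turns_walk: "left_turns (walk x S) = count_list S D"
proof (induction S arbitrary: x)
  case (Cons c S)
  have "left_turns (x # walk y S) = (if y = rot x then 1 else 0) + left_turns (walk y S)" for y
    by (cases S) auto
  moreover have "turn c x = rot x \<longleftrightarrow> c = D" by (cases c; cases x) auto
  ultimately show ?case using Cons by (simp split: if_splits)
qed simp

lemma left_turns_card: "left_turns w = card {j. Suc j < length w \<and> w ! Suc j = rot (w ! j)}"
proof (induction w rule: left_turns.induct)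
  case (1 x y w)
  let ?A = "{j. Suc j < length (y # w) \<and> (y # w) ! Suc j = rot ((y # w) ! j)}"
  have "{j. Suc j < length (x # y # w) \<and> (x # y # w) ! Suc j = rot ((x # y # w) ! j)}
      = (if y = rot x then {0} else {}) \<union> Suc ` ?A" (is "?B = ?C")
  proof (intro set_eqI)
    fix j show "j \<in> ?B \<longleftrightarrow> j \<in> ?C" by (cases j) auto
  qed
  moreover have "finite ?A" by (rule finite_subset[of _ "{..<length (y # w)}"]) auto
  ultimately show ?case using 1 by (auto simp: card_image card_insert_if)
qed auto

lemma count_D_bar: "count_list (bar S) D + count_list S D = length S"
proof (induction S)
  case (Cons c S)
  then show ?case by (cases c) (auto simp: bar_def)
qed (simp add: bar_def)

text \<open>Two of the sides turn according to \<open>S\<close> and two according to \<open>bar S\<close>, which together have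
\<open>2(m - 1)\<close> left turns; the four junctions are further left turns.\<close>

lemma loop_left_turns:
  "card {j. j < length (loop_word S) \<and>
      loop_word S ! (Suc j mod length (loop_word S)) = rot (loop_word S ! j)} = 2 * fold_count S + 2"
proof -
  let ?w = "loop_word S @ [hd (loop_word S)]"
  have ne: "loop_word S \<noteq> []" using length_loop_word[of S] by (auto simp: fold_count_def)
  have "{j. j < length (loop_word S) \<and>
      loop_word S ! (Suc j mod length (loop_word S)) = rot (loop_word S ! j)}
    = {j. Suc j < length ?w \<and> ?w ! Suc j = rot (?w ! j)}"
  proof (intro Collect_cong conj_cong)
    fix j
    show "j < length (loop_word S) \<longleftrightarrow> Suc j < length ?w" by simp
    assume "Suc j < length ?w"
    then consider "Suc j = length (loop_word S)" | "Suc j < length (loop_word S)" by force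
    then show "loop_word S ! (Suc j mod length (loop_word S)) = rot (loop_word S ! j) \<longleftrightarrow>
        ?w ! Suc j = rot (?w ! j)"
    proof cases
      case 1
      then have "Suc j mod length (loop_word S) = 0" "?w ! Suc j = hd (loop_word S)"
        "?w ! j = loop_word S ! j" by (simp_all add: nth_append)
      then show ?thesis using ne by (simp add: hd_conv_nth)
    next
      case 2
      then show ?thesis by (simp add: nth_append)
    qed
  qed
  then have "card {j. j < length (loop_word S) \<and>
      loop_word S ! (Suc j mod length (loop_word S)) = rot (loop_word S ! j)} = left_turns ?w"
    by (simp only: left_turns_card)
  also have "left_turns ?w = 2 * fold_count S + 2"
  proof -
    have blk: "left_turns (theta_letter S x) = count_list (oriented_string S x) D" for x
      using theta_letter_walk[of S x] left_turns_walk by metis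
    have jn: "hd (theta_letter S (rot x)) = rot (last (theta_letter S x))" for x
      using hd_theta_letter_turn[of S D x] by simp
    have w: "?w = theta_letter S La @ theta_letter S Lb @ theta_letter S Lc @ theta_letter S Ld
        @ [hd (theta_letter S La)]"
      by (simp add: loop_word_def theta_def dir_word_walk)
    have "left_turns ?w = 4 + (count_list (oriented_string S La) D + count_list (oriented_string S Lb) D
        + count_list (oriented_string S Lc) D + count_list (oriented_string S Ld) D)"
      unfolding w using jn[of La] jn[of Lb] jn[of Lc] jn[of Ld]
      by (simp add: left_turns_append blk del: theta_letter.simps)
    then show ?thesis
      using count_D_bar[of S] by (simp add: oriented_string_def fold_count_def)
  qed
  finally show ?thesis .
qed

definition path_area :: "complex \<Rightarrow> dir list \<Rightarrow> real" where
  "path_area p u = sum_list (map area_form (edge_list p u))"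

lemma path_area_simps [simp]:
  "path_area p [] = 0" "path_area p (x # u) = area_form (p, x) + path_area (p + step x) u"
  by (auto simp: path_area_def)

lemma path_area_translate: "path_area p u = path_area 0 u + Im (cnj p * displacement u)"
proof (induction u arbitrary: p)
  case (Cons x u)
  have "path_area (p + step x) u = path_area 0 u + Im (cnj (p + step x) * displacement u)"
    "path_area (step x) u = path_area 0 u + Im (cnj (step x) * displacement u)"
    using Cons[of "p + step x"] Cons[of "step x"] by auto
  then show ?case by (simp add: area_form_def algebra_simps)
qed simp

lemma path_area_append:
  "path_area p (u @ v) = path_area p u + path_area (p + displacement u) v"
  by (induction u arbitrary: p) (auto simp: add.assoc)

lemma path_area_map_rot: "path_area 0 (map rot u) = path_area 0 u"
proof (induction u)
  case (Cons x u)
  have "path_area (step (rot x)) (map rot u) = path_area 0 (map rot u)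
      + Im (cnj (step (rot x)) * displacement (map rot u))"
    by (rule path_area_translate)
  moreover have "path_area (step x) u = path_area 0 u + Im (cnj (step x) * displacement u)"
    by (rule path_area_translate)
  moreover have "cnj (step (rot x)) * displacement (map rot u) = cnj (step x) * displacement u"
    by (simp add: algebra_simps)
  ultimately show ?case using Cons by (simp add: area_form_def)
qed simp

lemma path_area_rev: "path_area 0 (rev u) = - path_area 0 u"
proof (induction u)
  case (Cons x u)
  have "path_area (step x) u = path_area 0 u + Im (cnj (step x) * displacement u)"
    by (rule path_area_translate)
  then show ?case using Cons by (simp add: path_area_append area_form_def)
qed simp

text \<open>Rotation keeps the area under a path and reversal changes its sign, so the contributions of the
four sides cancel, and the square spanned by the corners remains.\<close>

lemma loop_area: "path_area 0 (loop_word S) = 2 * (cmod (stretch S))\<^sup>2"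
proof -
  define a where "a = path_area 0 (theta_letter S La)"
  have rt: "path_area 0 (theta_letter S (rot x)) = - path_area 0 (theta_letter S x)" for x
    by (simp only: theta_letter_rot path_area_map_rot path_area_rev)
  have ar: "path_area 0 (theta_letter S Lb) = - a" "path_area 0 (theta_letter S Lc) = a"
    "path_area 0 (theta_letter S Ld) = - a"
    using rt[of La] rt[of Lb] rt[of Lc] by (simp_all only: a_def rot.simps minus_minus)
  define l where "l = stretch S"
  have w: "loop_word S = theta_letter S La @ theta_letter S Lb @ theta_letter S Lc @ theta_letter S Ld"
    by (simp add: loop_word_def theta_def)
  have "path_area 0 (loop_word S) = a + (- a + Im (cnj l * (l * \<i>)))
      + (a + Im (cnj (l + l * \<i>) * (l * - 1)))
      + (- a + Im (cnj (l + l * \<i> + l * - 1) * (l * - \<i>)))"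
    unfolding w path_area_append displacement_theta_letter l_def[symmetric]
      path_area_translate[of "0 + l * step La"]
      path_area_translate[of "0 + l * step La + l * step Lb"]
      path_area_translate[of "0 + l * step La + l * step Lb + l * step Lc"] ar a_def[symmetric]
    by simp
  also have "\<dots> = 2 * (cmod l)\<^sup>2"
    unfolding cmod_power2 by (simp add: algebra_simps power2_eq_square)
  finally show ?thesis by (simp add: l_def)
qed

section \<open>The edges of the limit curve\<close>

definition limit_edge :: "crease list \<Rightarrow> nat \<Rightarrow> edge" where
  "limit_edge S j = (limit_vertex S j, dir_seq (fold_limit S) j)"

lemma limit_vertex_Suc: "limit_vertex S (Suc j) = limit_vertex S j + step (dir_seq (fold_limit S) j)"
  by (simp add: limit_vertex_def seq_vertex_def)

lemma limit_vertex_0 [simp]: "limit_vertex S 0 = 0"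
  by (simp add: limit_vertex_def seq_vertex_def)

lemma dir_seq_Suc: "dir_seq s (Suc j) = turn (s j) (dir_seq s j)"
  by (simp add: dir_seq_def weight_append1 rot_power_add1)

lemma limit_edge_0: "limit_edge S 0 = (0, La)"
  by (simp add: limit_edge_def dir_seq_def weight_def)

lemma limit_edge_Suc: "limit_edge S (Suc j) = lnext (limit_edge S j) \<or> limit_edge S (Suc j) = rnext (limit_edge S j)"
  by (cases "fold_limit S j")
     (auto simp: limit_edge_def limit_vertex_Suc dir_seq_Suc lnext_def rnext_def)

lemma valid_limit_edge: "valid (limit_edge S j)"
proof (induction j)
  case 0
  show ?case unfolding limit_edge_0
    by (rule validI[of _ 0 0]) (auto simp: complex_eq_iff horizontal_def)
next
  case (Suc j)
  then show ?case using limit_edge_Suc[of S j] valid_lnext valid_rnext by metis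
qed

lemma fold_count_fold_power: "fold_count (fold_power S n) = fold_count S ^ n"
  by (simp add: fold_count_def length_fold_power)

lemma subst_prefix:
  assumes "S \<noteq> []"
  shows "subst (fold_power S n) (0, La) = map (limit_edge S) [0..<fold_count S ^ n]"
proof (rule nth_equalityI)
  let ?W = "dir_word (fold_power S n)"
  show len: "length (subst (fold_power S n) (0, La)) = length (map (limit_edge S) [0..<fold_count S ^ n])"
    using fold_count_fold_power[of S n] by (simp add: fold_count_def)
  fix j assume "j < length (subst (fold_power S n) (0, La))"
  then have j: "j < Suc (length (fold_power S n))" by simp
  have letter: "?W ! i = dir_seq (fold_limit S) i" if "i < Suc (length (fold_power S n))" for i
  proof -
    have "map (fold_limit S) [0..<i] = take i (fold_power S n)"
      using that by (intro nth_equalityI) (auto simp: fold_limit_prefix[OF assms])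
    then show ?thesis using that by (simp add: dir_word_def dir_seq_def del: upt_Suc)
  qed
  have lenW: "length ?W = Suc (length (fold_power S n))" by (simp add: dir_word_walk)
  have "take j ?W = map (dir_seq (fold_limit S)) [0..<j]"
    using j letter lenW by (intro nth_equalityI) auto
  then have "edge_list 0 ?W ! j = limit_edge S j"
    using j letter[of j] by (simp add: nth_edge_list lenW limit_edge_def limit_vertex_def seq_vertex_def)
  then have "subst (fold_power S n) (0, La) ! j = limit_edge S j" by (simp add: subst_def)
  moreover have "j < fold_count S ^ n" using j fold_count_fold_power[of S n] by (simp add: fold_count_def)
  ultimately show "subst (fold_power S n) (0, La) ! j = map (limit_edge S) [0..<fold_count S ^ n] ! j"
    by simp
qed

lemma fold_count_ge_2: "S \<noteq> [] \<Longrightarrow> 2 \<le> fold_count S"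
  by (cases S) (auto simp: fold_count_def)

lemma less_fold_count_power: "S \<noteq> [] \<Longrightarrow> i < fold_count S ^ i"
proof -
  assume "S \<noteq> []"
  then have "2 ^ i \<le> fold_count S ^ i" by (intro power_mono fold_count_ge_2) auto
  then show ?thesis using less_exp[of i] by linarith
qed

text \<open>The limit curve is invariant under \<open>\<theta>\<close>, with block \<open>i\<close> of length \<open>m^n\<close> being the image of edge
\<open>i\<close> under \<open>\<theta>^n\<close>.\<close>

lemma subst_limit_edge:
  assumes "S \<noteq> []"
  shows "subst (fold_power S n) (limit_edge S i)
    = map (\<lambda>r. limit_edge S (fold_count S ^ n * i + r)) [0..<fold_count S ^ n]"
proof (rule nth_equalityI)
  let ?M = "fold_count S ^ n"
  have len: "length (subst (fold_power S n) e) = ?M" for e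
    using fold_count_fold_power[of S n] by (simp add: fold_count_def)
  show "length (subst (fold_power S n) (limit_edge S i)) = length (map (\<lambda>r. limit_edge S (?M * i + r)) [0..<?M])"
    by (simp add: len del: length_subst)
  fix r assume "r < length (subst (fold_power S n) (limit_edge S i))"
  then have r: "r < ?M" by (simp only: len)
  have i: "i < fold_count S ^ i" using less_fold_count_power[OF assms] .
  have lt: "?M * i + r < fold_count S ^ (n + i)"
  proof -
    have "?M * i + r < ?M * Suc i" using r by simp
    also have "\<dots> \<le> ?M * fold_count S ^ i" using i by (intro mult_le_mono2) simp
    finally show ?thesis by (simp add: power_add)
  qed
  have "subst (fold_power S (n + i)) (0, La)
      = concat (map (subst (fold_power S n)) (map (limit_edge S) [0..<fold_count S ^ i]))"
    unfolding subst_fold_power_add subst_prefix[OF assms] ..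
  then have "map (limit_edge S) [0..<fold_count S ^ (n + i)]
      = concat (map (subst (fold_power S n)) (map (limit_edge S) [0..<fold_count S ^ i]))"
    unfolding subst_prefix[OF assms] .
  moreover have "concat (map (subst (fold_power S n)) (map (limit_edge S) [0..<fold_count S ^ i])) ! (?M * i + r)
      = subst (fold_power S n) (map (limit_edge S) [0..<fold_count S ^ i] ! i) ! r"
    using i r by (intro nth_concat_blocks len) simp_all
  ultimately have "limit_edge S (?M * i + r) = subst (fold_power S n) (limit_edge S i) ! r"
    using lt i by (metis add_0 diff_zero length_upt nth_map nth_upt)
  then show "subst (fold_power S n) (limit_edge S i) ! r = map (\<lambda>r. limit_edge S (?M * i + r)) [0..<?M] ! r"
    using r by simp
qed

lemma inj_limit_edge:
  assumes "self_avoiding S"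
  shows "inj (limit_edge S)"
proof (rule injI)
  fix i j assume "limit_edge S i = limit_edge S j"
  then have "limit_vertex S i = limit_vertex S j" "limit_vertex S (Suc i) = limit_vertex S (Suc j)"
    by (auto simp: limit_edge_def limit_vertex_Suc)
  then show "i = j" using assms unfolding self_avoiding_def inj_def by metis
qed

abbreviation limit_edges :: "crease list \<Rightarrow> edge set" where
  "limit_edges S \<equiv> range (limit_edge S)"

lemma limit_edges_subst:
  assumes "S \<noteq> []" "f \<in> limit_edges S"
  shows "\<exists>e\<in>limit_edges S. f \<in> set (subst (fold_power S n) e)"
proof -
  obtain j where j: "f = limit_edge S j" using assms(2) by blast
  let ?M = "fold_count S ^ n"
  have "0 < ?M" by (simp add: fold_count_def)
  then have "j mod ?M < ?M" "j = ?M * (j div ?M) + j mod ?M" by simp_all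
  then have "f \<in> set (subst (fold_power S n) (limit_edge S (j div ?M)))"
    unfolding subst_limit_edge[OF assms(1)] set_map set_upt j
    by (metis atLeast0LessThan imageI lessThan_iff)
  then show ?thesis by blast
qed

lemma subst_distance:
  assumes "f \<in> set (subst S e)"
  shows "norm (fst f - stretch S * fst e) \<le> fold_count S"
proof -
  have d: "norm (displacement u) \<le> length u" for u
  proof (induction u)
    case (Cons x u)
    then show ?case using norm_triangle_ineq[of "step x" "displacement u"] by simp
  qed simp
  obtain j where j: "j < length (subst S e)" "f = subst S e ! j"
    using assms by (auto simp: in_set_conv_nth)
  then have "f = (stretch S * fst e + displacement (take j (theta_letter S (snd e))), theta_letter S (snd e) ! j)"
    by (simp add: subst_def nth_edge_list)
  then show ?thesis
    using d[of "take j (theta_letter S (snd e))"] j(1) by (simp add: fold_count_def)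
qed

text \<open>The passages through a grid point correspond to the edges leaving it, of which the orientation
allows just two.\<close>

lemma vertex_full:
  assumes "self_avoiding S" "valid (z, x)"
  shows "card {j. limit_vertex S j = z} = 2 \<longleftrightarrow>
    (z, x) \<in> limit_edges S \<and> (z, rot (rot x)) \<in> limit_edges S"
proof -
  have inj: "inj (limit_edge S)" using assms(1) by (rule inj_limit_edge)
  have ne: "rot (rot x) \<noteq> x" by (cases x) auto
  have sub: "limit_edge S ` {j. limit_vertex S j = z} \<subseteq> {(z, x), (z, rot (rot x))}"
  proof
    fix e assume "e \<in> limit_edge S ` {j. limit_vertex S j = z}"
    then obtain j where z: "z = limit_vertex S j" and e: "e = limit_edge S j" by blast
    have "valid (z, snd (limit_edge S j))"
      using valid_limit_edge[of S j] z by (simp add: limit_edge_def)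
    then have "snd (limit_edge S j) = x \<or> snd (limit_edge S j) = rot (rot x)"
      using valid_same_tail[OF assms(2)] by blast
    then show "e \<in> {(z, x), (z, rot (rot x))}"
      unfolding e z by (auto simp: limit_edge_def)
  qed
  have card: "card {j. limit_vertex S j = z} = card (limit_edge S ` {j. limit_vertex S j = z})"
    using inj by (intro card_image[symmetric]) (auto intro: inj_on_subset)
  have img: "limit_edge S ` {j. limit_vertex S j = z} = limit_edges S \<inter> {(z, x), (z, rot (rot x))}"
    using sub by (auto simp: limit_edge_def)
  show ?thesis
  proof
    assume "card {j. limit_vertex S j = z} = 2"
    then have "card (limit_edges S \<inter> {(z, x), (z, rot (rot x))}) = card {(z, x), (z, rot (rot x))}"
      using card img ne by simp
    then have "limit_edges S \<inter> {(z, x), (z, rot (rot x))} = {(z, x), (z, rot (rot x))}"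
      by (intro card_subset_eq) auto
    then show "(z, x) \<in> limit_edges S \<and> (z, rot (rot x)) \<in> limit_edges S" by blast
  next
    assume "(z, x) \<in> limit_edges S \<and> (z, rot (rot x)) \<in> limit_edges S"
    then have "limit_edges S \<inter> {(z, x), (z, rot (rot x))} = {(z, x), (z, rot (rot x))}" by blast
    then show "card {j. limit_vertex S j = z} = 2" using card img ne by simp
  qed
qed

section \<open>Planefilling bounds the stretching factor\<close>

lemma card_grid_cball_le:
  assumes "0 \<le> r"
  shows "real (card (cball a r \<inter> grid_points)) \<le> (2 * r + 1)\<^sup>2"
proof -
  define I where "I x = {\<lceil>x - r\<rceil>..\<lfloor>x + r\<rfloor>}" for x :: real
  have cI: "real (card (I x)) \<le> 2 * r + 1" for x
  proof -
    have "real_of_int (\<lfloor>x + r\<rfloor> - \<lceil>x - r\<rceil> + 1) \<le> 2 * r + 1"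
      using le_of_int_ceiling[of "x - r"] of_int_floor_le[of "x + r"] by linarith
    then show ?thesis using assms by (simp add: I_def)
  qed
  have "cball a r \<inter> grid_points \<subseteq> (\<lambda>(x, y). Complex (of_int x) (of_int y)) ` (I (Re a) \<times> I (Im a))"
  proof
    fix z assume z: "z \<in> cball a r \<inter> grid_points"
    then obtain x y :: int where xy: "Re z = of_int x" "Im z = of_int y"
      unfolding grid_points_def by (auto elim!: Ints_cases)
    have "norm (z - a) \<le> r" using z by (simp add: dist_norm norm_minus_commute)
    then have "\<bar>of_int x - Re a\<bar> \<le> r" "\<bar>of_int y - Im a\<bar> \<le> r"
      using abs_Re_le_cmod[of "z - a"] abs_Im_le_cmod[of "z - a"] xy by auto
    then have "x \<in> I (Re a)" "y \<in> I (Im a)"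
      unfolding I_def by (simp_all add: ceiling_le_iff le_floor_iff abs_le_iff)
    then show "z \<in> (\<lambda>(x, y). Complex (of_int x) (of_int y)) ` (I (Re a) \<times> I (Im a))"
      using xy by (intro image_eqI[of _ _ "(x, y)"]) (auto simp: complex_eq_iff)
  qed
  then have "card (cball a r \<inter> grid_points) \<le> card (I (Re a) \<times> I (Im a))"
    by (intro surj_card_le) (auto simp: I_def)
  then have "real (card (cball a r \<inter> grid_points)) \<le> real (card (I (Re a))) * real (card (I (Im a)))"
    by (simp only: card_cartesian_product of_nat_mult[symmetric] of_nat_le_iff)
  also have "\<dots> \<le> (2 * r + 1) * (2 * r + 1)"
    using cI assms by (intro mult_mono) auto
  finally show ?thesis by (simp add: power2_eq_square)
qed

lemma card_grid_cball_ge: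
  assumes "4 \<le> r"
  shows "r\<^sup>2 / 16 \<le> real (card (cball a r \<inter> grid_points))"
proof -
  define k where "k = nat \<lfloor>r / 2\<rfloor>"
  define g where "g = (\<lambda>(i, j). Complex (of_int (\<lfloor>Re a\<rfloor> + int i)) (of_int (\<lfloor>Im a\<rfloor> + int j)))"
  have k: "r / 4 \<le> real k" "real k \<le> r / 2"
    unfolding k_def using assms by linarith+
  have "g ` ({1..k} \<times> {1..k}) \<subseteq> cball a r \<inter> grid_points"
  proof clarify
    fix i j assume ij: "i \<in> {1..k}" "j \<in> {1..k}"
    have o: "\<bar>of_int (\<lfloor>x\<rfloor> + int i) - x\<bar> \<le> r / 2" if "i \<in> {1..k}" for x :: real and i
    proof -
      have "1 \<le> real i" "real i \<le> real k" using that by auto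
      moreover have "of_int \<lfloor>x\<rfloor> \<le> x" "x < of_int \<lfloor>x\<rfloor> + 1" by linarith+
      moreover have "of_int (\<lfloor>x\<rfloor> + int i) = of_int \<lfloor>x\<rfloor> + real i" by simp
      ultimately show ?thesis using k(2) by linarith
    qed
    have "norm (g (i, j) - a) \<le> \<bar>Re (g (i, j) - a)\<bar> + \<bar>Im (g (i, j) - a)\<bar>" by (rule cmod_le)
    also have "\<dots> \<le> r / 2 + r / 2" using o[OF ij(1), of "Re a"] o[OF ij(2), of "Im a"]
      by (simp add: g_def)
    finally have "g (i, j) \<in> cball a r" by (simp add: dist_norm norm_minus_commute)
    moreover have "g (i, j) \<in> grid_points" by (simp add: g_def grid_points_def)
    ultimately show "g (i, j) \<in> cball a r \<inter> grid_points" by blast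
  qed
  moreover have "inj_on g ({1..k} \<times> {1..k})" by (auto simp: inj_on_def g_def)
  moreover have "finite (cball a r \<inter> grid_points)" by (intro finite_grid) simp
  ultimately have "card ({1..k} \<times> {1..k}) \<le> card (cball a r \<inter> grid_points)"
    by (metis card_image card_mono)
  then have "k * k \<le> card (cball a r \<inter> grid_points)" by (simp add: card_cartesian_product)
  then have "real k * real k \<le> real (card (cball a r \<inter> grid_points))"
    by (simp only: of_nat_mult[symmetric] of_nat_le_iff)
  moreover have "r / 4 * (r / 4) \<le> real k * real k" using k assms by (intro mult_mono) auto
  ultimately show ?thesis by (simp add: power2_eq_square)
qed

lemma grid_valid: "z \<in> grid_points \<Longrightarrow> \<exists>x. valid (z, x)"
proof -
  assume "z \<in> grid_points"
  then obtain a b :: int where ab: "Re z = of_int a" "Im z = of_int b"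
    unfolding grid_points_def by (auto elim!: Ints_cases)
  then have "z = Complex (of_int a) (of_int b)" by (simp add: complex_eq_iff)
  then have "valid (z, if even (a + b) then La else Lb)"
    by (rule validI) (auto simp: horizontal_def)
  then show ?thesis ..
qed

lemma full_disc:
  assumes "self_avoiding S" "planefilling S" "0 < R"
  obtains c where "\<And>z x. z \<in> cball c R \<Longrightarrow> valid (z, x) \<Longrightarrow> (z, x) \<in> limit_edges S"
proof -
  obtain c where c: "\<forall>z\<in>cball c R \<inter> grid_points. card {j. limit_vertex S j = z} = 2"
    using assms unfolding planefilling_def by blast
  have "(z, x) \<in> limit_edges S" if "z \<in> cball c R" "valid (z, x)" for z x
    using c that valid_grid[OF that(2)] vertex_full[OF assms(1) that(2)] by auto
  then show ?thesis using that by blast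
qed

lemma planefilling_face:
  assumes "self_avoiding S" "planefilling S"
  obtains q where "set (edge_list q [La, Lb, Lc, Ld]) \<subseteq> limit_edges S"
proof -
  obtain c where c: "\<And>z x. z \<in> cball c 3 \<Longrightarrow> valid (z, x) \<Longrightarrow> (z, x) \<in> limit_edges S"
    using full_disc[OF assms, of 3] by auto
  define b where "b = \<lfloor>Im c\<rfloor>"
  define a where "a = (if even (\<lfloor>Re c\<rfloor> + b) then \<lfloor>Re c\<rfloor> else \<lfloor>Re c\<rfloor> + 1)"
  have ev: "even (a + b)" by (auto simp: a_def)
  define q where "q = Complex (of_int a) (of_int b)"
  have near: "q + Complex s t \<in> cball c 3" if "s \<in> {0, 1}" "t \<in> {0, 1}" for s t
  proof -
    have "\<bar>of_int a + s - Re c\<bar> \<le> 2" "\<bar>of_int b + t - Im c\<bar> \<le> 1"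
      unfolding a_def b_def using that by (auto simp: abs_le_iff) linarith+
    then have "norm (q + Complex s t - c) \<le> 3"
      using cmod_le[of "q + Complex s t - c"] by (simp add: q_def)
    then show ?thesis by (simp add: dist_norm norm_minus_commute)
  qed
  have v: "valid (q + Complex (of_int s) (of_int t), x)" if "horizontal x \<longleftrightarrow> even (s + t)" for s t x
    using that ev by (intro validI[of _ "a + s" "b + t"]) (auto simp: q_def complex_eq_iff)
  have "(q, La) \<in> limit_edges S"
    using c[OF near[of 0 0], of La] v[of La 0 0] by (simp add: horizontal_def zero_complex.code[symmetric])
  moreover have "(q + 1, Lb) \<in> limit_edges S"
    using c[OF near[of 1 0], of Lb] v[of Lb 1 0] by (simp add: horizontal_def one_complex.code[symmetric])
  moreover have "(q + 1 + \<i>, Lc) \<in> limit_edges S"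
  proof -
    have "Complex 1 1 = 1 + \<i>" by (simp add: complex_eq_iff)
    then show ?thesis using c[OF near[of 1 1], of Lc] v[of Lc 1 1] by (simp add: horizontal_def add.assoc)
  qed
  moreover have "(q + \<i>, Ld) \<in> limit_edges S"
  proof -
    have "Complex 0 1 = \<i>" by (simp add: complex_eq_iff)
    then show ?thesis using c[OF near[of 0 1], of Ld] v[of Ld 0 1] by (simp add: horizontal_def)
  qed
  ultimately have "set (edge_list q [La, Lb, Lc, Ld]) \<subseteq> limit_edges S" by (simp add: add.commute)
  then show ?thesis by (rule that)
qed

lemma distinct_concat_subst:
  assumes "S \<noteq> []" "self_avoiding S" "distinct es" "set es \<subseteq> limit_edges S"
  shows "distinct (concat (map (subst S) es))"
  using assms(3,4)
proof (induction es)
  case (Cons e es)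
  let ?m = "fold_count S"
  have m: "0 < ?m" by (simp add: fold_count_def)
  have inj: "limit_edge S a = limit_edge S b \<longleftrightarrow> a = b" for a b
    using inj_limit_edge[OF assms(2)] by (rule inj_eq)
  have one: "subst S (limit_edge S i) = map (\<lambda>r. limit_edge S (?m * i + r)) [0..<?m]" for i
    using subst_limit_edge[OF assms(1), of 1 i] by (simp add: fold_conv_Nil_left)
  obtain i where i: "e = limit_edge S i" using Cons.prems by auto
  have "distinct (subst S e)"
    unfolding i one by (simp add: distinct_map inj_on_def inj)
  moreover have "set (subst S e) \<inter> set (subst S e') = {}" if "e' \<in> set es" for e'
  proof (rule ccontr)
    assume ne: "set (subst S e) \<inter> set (subst S e') \<noteq> {}"
    have "e' \<in> limit_edges S" using Cons.prems that by auto
    then obtain i' where i': "e' = limit_edge S i'" by blast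
    obtain f where f: "f \<in> set (subst S e)" "f \<in> set (subst S e')" using ne by blast
    obtain r where r: "r < ?m" "f = limit_edge S (?m * i + r)" using f(1) unfolding i one by auto
    obtain r' where r': "r' < ?m" "f = limit_edge S (?m * i' + r')" using f(2) unfolding i' one by auto
    have "?m * i + r = ?m * i' + r'" using r(2) r'(2) inj by simp
    then have "(?m * i + r) div ?m = (?m * i' + r') div ?m" by simp
    then have "i = i'" using r(1) r'(1) by simp
    then show False using Cons.prems that i i' by simp
  qed
  ultimately show ?case using Cons by auto
qed simp

lemma edge_list_loop: "edge_list (stretch S * q) (loop_word S) = concat (map (subst S) (edge_list q [La, Lb, Lc, Ld]))"
  unfolding loop_word_def by (rule edge_list_theta)

lemma edge_list_loop_shift:
  "concat (map (subst S) (edge_list q [La, Lb, Lc, Ld])) = map (shift (stretch S * q)) (edge_list 0 (loop_word S))"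
  using edge_list_shift[of "stretch S * q" 0 "loop_word S"] edge_list_loop[of S q] by simp

text \<open>The image of the face is a translate of the loop and consists of different pieces of the limit curve.\<close>

lemma distinct_loop_if_face:
  assumes "S \<noteq> []" "self_avoiding S" "set (edge_list q [La, Lb, Lc, Ld]) \<subseteq> limit_edges S"
  shows "distinct (edge_list 0 (loop_word S))"
proof -
  have "distinct (edge_list q [La, Lb, Lc, Ld])" by simp
  then have "distinct (concat (map (subst S) (edge_list q [La, Lb, Lc, Ld])))"
    using assms by (intro distinct_concat_subst)
  then show ?thesis unfolding edge_list_loop_shift by (simp add: distinct_map)
qed

text \<open>Suppose that \<open>|\<lambda>|\<^sup>2 > m\<close>, and let \<open>n\<close> be large. A disc of radius \<open>|\<lambda>|^n\<close> has at least
\<open>|\<lambda>|^(2n) / 16\<close> grid points. If all edges in it belong to the limit curve, they are covered by the \<open>\<theta>^n\<close>-images of edges starting in a disc whose radius does not depend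
on \<open>n\<close>, and each image has \<open>m^n\<close> edges.\<close>

lemma stretch_bound:
  assumes S: "S \<noteq> []" "self_avoiding S" "planefilling S"
  shows "(cmod (stretch S))\<^sup>2 \<le> real (fold_count S)"
proof (rule ccontr)
  define l where "l = cmod (stretch S)"
  define m where "m = real (fold_count S)"
  assume "\<not> ?thesis"
  then have lm: "m < l\<^sup>2" by (simp add: l_def m_def)
  have m: "2 \<le> m" using fold_count_ge_2[OF S(1)] by (simp add: m_def)
  have l0: "0 \<le> l" by (simp add: l_def)
  have l1: "1 < l"
  proof (rule ccontr)
    assume "\<not> 1 < l"
    then have "l\<^sup>2 \<le> 1" using l0 by (simp add: power_le_one)
    then show False using lm m by simp
  qed
  define K where "K = m / (l - 1)"
  have K: "0 \<le> K" "K * l = K + m" using l1 m by (simp_all add: K_def field_simps)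
  have dist: "norm (fst f - stretch S ^ n * fst e) \<le> K * (l ^ n - 1)"
    if "f \<in> set (subst (fold_power S n) e)" for f e n
    using that
  proof (induction n arbitrary: f)
    case 0
    then show ?case by (simp add: subst_def theta_letter_Nil)
  next
    case (Suc n)
    have "subst (fold_power S (1 + n)) e = concat (map (subst (fold_power S 1)) (subst (fold_power S n) e))"
      by (rule subst_fold_power_add)
    then obtain g where g: "g \<in> set (subst (fold_power S n) e)" "f \<in> set (subst S g)"
      using Suc.prems by (auto simp: fold_conv_Nil_left)
    have "fst f - stretch S ^ Suc n * fst e
        = (fst f - stretch S * fst g) + stretch S * (fst g - stretch S ^ n * fst e)"
      by (simp add: algebra_simps)
    then have "norm (fst f - stretch S ^ Suc n * fst e)
        \<le> norm (fst f - stretch S * fst g) + l * norm (fst g - stretch S ^ n * fst e)"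
      by (metis l_def norm_mult norm_triangle_ineq)
    also have "\<dots> \<le> m + l * (K * (l ^ n - 1))"
      using subst_distance[OF g(2)] Suc.IH[OF g(1)] l0 by (intro add_mono mult_left_mono) (simp_all add: m_def)
    also have "\<dots> = K * (l ^ Suc n - 1)" using K(2) by (simp add: algebra_simps)
    finally show ?case .
  qed
  define Q where "Q = (2 * (1 + K) + 1)\<^sup>2"
  have key: "l ^ (2 * n) \<le> 64 * Q * m ^ n" if n: "4 \<le> l ^ n" for n
  proof -
    let ?R = "l ^ n" and ?L = "stretch S ^ n"
    have nL: "norm ?L = ?R" by (simp add: l_def norm_power)
    have L0: "?L \<noteq> 0" using nL n by (metis norm_zero not_numeral_le_zero)
    obtain c where c: "\<And>z x. z \<in> cball c ?R \<Longrightarrow> valid (z, x) \<Longrightarrow> (z, x) \<in> limit_edges S"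
      using full_disc[OF S(2,3), of ?R] n by auto
    let ?D = "cball (c / ?L) (1 + K) \<inter> grid_points"
    have finD: "finite ?D" by (intro finite_grid) simp
    have "cball c ?R \<inter> grid_points \<subseteq> fst ` (\<Union>e\<in>?D \<times> UNIV. set (subst (fold_power S n) e))"
    proof
      fix z assume z: "z \<in> cball c ?R \<inter> grid_points"
      then obtain x where "valid (z, x)" using grid_valid by blast
      then have "(z, x) \<in> limit_edges S" using c z by blast
      then obtain e where e: "e \<in> limit_edges S" "(z, x) \<in> set (subst (fold_power S n) e)"
        using limit_edges_subst[OF S(1)] by blast
      have "norm (z - ?L * fst e) \<le> K * (?R - 1)" using dist[OF e(2)] by simp
      also have "\<dots> \<le> K * ?R" using K(1) by (simp add: algebra_simps)
      finally have 1: "norm (z - ?L * fst e) \<le> K * ?R" .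
      have "norm (?L * fst e - c) \<le> norm (?L * fst e - z) + norm (z - c)"
        using norm_triangle_ineq[of "?L * fst e - z" "z - c"] by simp
      also have "\<dots> \<le> K * ?R + ?R"
        using 1 z by (intro add_mono) (auto simp: norm_minus_commute dist_norm)
      finally have 2: "norm (?L * fst e - c) \<le> (1 + K) * ?R" by (simp add: algebra_simps)
      have "?L * fst e - c = ?L * (fst e - c / ?L)" using L0 by (simp add: algebra_simps)
      then have "?R * norm (fst e - c / ?L) \<le> (1 + K) * ?R" using 2 by (simp add: norm_mult nL)
      then have "norm (fst e - c / ?L) \<le> 1 + K" using n by (simp add: mult.commute)
      moreover have "fst e \<in> grid_points" using e(1) valid_limit_edge valid_grid by blast
      ultimately have "e \<in> ?D \<times> UNIV"
        by (cases e) (auto simp: dist_norm norm_minus_commute)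
      then show "z \<in> fst ` (\<Union>e\<in>?D \<times> UNIV. set (subst (fold_power S n) e))"
        using e(2) by force
    qed
    then have "card (cball c ?R \<inter> grid_points) \<le> card (\<Union>e\<in>?D \<times> UNIV. set (subst (fold_power S n) e))"
      using finD by (intro surj_card_le) auto
    also have "\<dots> \<le> (\<Sum>e\<in>?D \<times> UNIV. card (set (subst (fold_power S n) e)))"
      using finD by (intro card_UN_le) simp
    also have "\<dots> \<le> (\<Sum>e\<in>?D \<times> (UNIV :: dir set). fold_count S ^ n)"
    proof (rule sum_mono)
      fix e
      show "card (set (subst (fold_power S n) e)) \<le> fold_count S ^ n"
        using card_length[of "subst (fold_power S n) e"] fold_count_fold_power[of S n]
        by (simp add: fold_count_def)
    qed
    also have "\<dots> = 4 * card ?D * fold_count S ^ n" by (simp add: card_cartesian_product)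
    finally have "real (card (cball c ?R \<inter> grid_points)) \<le> real (4 * card ?D * fold_count S ^ n)"
      by (simp only: of_nat_le_iff)
    also have "\<dots> = 4 * real (card ?D) * m ^ n" by (simp add: m_def)
    also have "\<dots> \<le> 4 * Q * m ^ n"
      using card_grid_cball_le[of "1 + K" "c / ?L"] K(1) m unfolding Q_def by (intro mult_right_mono) auto
    finally have "?R\<^sup>2 / 16 \<le> 4 * Q * m ^ n"
      using card_grid_cball_ge[OF n, of c] by linarith
    then show ?thesis by (simp add: power_mult[symmetric] mult_ac)
  qed
  define q where "q = l\<^sup>2 / m"
  have q: "1 < q" using lm m by (simp add: q_def)
  obtain a where a: "64 * Q < q ^ a" using real_arch_pow[OF q] by blast
  obtain b where b: "4 < l ^ b" using real_arch_pow[OF l1] by blast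
  \<comment> \<open>The summand \<open>b\<close> makes the radius large enough for counting, the summand \<open>a\<close> gives the contradiction.\<close>
  have "4 \<le> l ^ (a + b)"
  proof -
    have "l ^ b \<le> l ^ (a + b)" using l1 by (intro power_increasing) auto
    then show ?thesis using b by simp
  qed
  then have "l ^ (2 * (a + b)) \<le> 64 * Q * m ^ (a + b)" by (rule key)
  then have "q ^ (a + b) \<le> 64 * Q"
    using m by (simp add: q_def power_divide power_mult[symmetric] divide_le_eq)
  moreover have "q ^ a \<le> q ^ (a + b)" using q by (intro power_increasing) auto
  ultimately show False using a by simp
qed

section \<open>Planefilling implies maximally simple\<close>

lemma (in turning_loop) sum_area: "(\<Sum>j<n. area_form (edge_at j)) = path_area 0 u"
proof -
  have "path_area 0 u = (\<Sum>j<n. map area_form (edge_list 0 u) ! j)"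
    unfolding path_area_def by (simp add: sum_list_sum_nth atLeast0LessThan)
  then show ?thesis by (simp add: edge_list_nth)
qed

lemma (in simple_turning_loop) card_passages:
  assumes x: "valid (z, x)"
  shows "card {j. j < n \<and> vtx j = z} = card (edge_at ` {..<n} \<inter> {(z, x), (z, rot (rot x))})"
proof -
  let ?P = "{j. j < n \<and> vtx j = z}"
  have sub: "edge_at ` ?P \<subseteq> {(z, x), (z, rot (rot x))}"
  proof
    fix e assume "e \<in> edge_at ` ?P"
    then obtain i where i: "i < n" "vtx i = z" "e = edge_at i" by blast
    have e: "e = (z, u ! i)" unfolding i(3) edge_at_def i(2) ..
    have "valid e" unfolding i(3) using i(1) by (rule valid_edge_at)
    then have "u ! i = x \<or> u ! i = rot (rot x)"
      unfolding e using valid_same_tail[OF x] by blast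
    then show "e \<in> {(z, x), (z, rot (rot x))}" unfolding e by blast
  qed
  have "edge_at ` ?P = edge_at ` {..<n} \<inter> {(z, x), (z, rot (rot x))}"
  proof
    show "edge_at ` ?P \<subseteq> edge_at ` {..<n} \<inter> {(z, x), (z, rot (rot x))}" using sub by auto
    show "edge_at ` {..<n} \<inter> {(z, x), (z, rot (rot x))} \<subseteq> edge_at ` ?P"
      by (auto simp: edge_at_def)
  qed
  moreover have "card (edge_at ` ?P) = card ?P"
    using edge_at_inj by (intro card_image) (auto simp: inj_on_def)
  ultimately show ?thesis by simp
qed

text \<open>Under the bound no clockwise face is inside. Each of the two clockwise faces at an inner grid point
\<open>z\<close> must therefore be separated from \<open>z\<close> by a cut corner, and this takes two passages through \<open>z\<close>.\<close>

lemma maximally_simple_if_stretch_bound: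
  assumes S: "S \<noteq> []" and dist: "distinct (edge_list 0 (loop_word S))"
    and bound: "(cmod (stretch S))\<^sup>2 \<le> real (fold_count S)"
  shows "maximally_simple S"
proof -
  interpret turning_loop "loop_word S" using S by (rule turning_loop_word)
  interpret simple_turning_loop "loop_word S" using dist by unfold_locales
  have area: "(\<Sum>j<n. area_form (edge_at j)) = 2 * (cmod (stretch S))\<^sup>2"
    unfolding sum_area by (rule loop_area)
  then have area0: "(\<Sum>j<n. area_form (edge_at j)) \<ge> 0" by simp
  have "card ccw_faces = fold_count S + card cw_faces"
    using face_count(2)[OF area0] by (simp add: length_loop_word)
  moreover have "(cmod (stretch S))\<^sup>2 = real (card ccw_faces + card cw_faces)"
    using face_count(3)[OF area0] area by simp
  ultimately have "card cw_faces = 0" using bound by simp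
  then have no_cw: "cw_faces = {}" using finite_faces by simp
  have "card {j. j < n \<and> vtx j = z} = 2" if z: "z \<in> region" "z \<in> grid_points" for z
  proof -
    obtain x where x: "valid (z, x)" using grid_valid[OF z(2)] by blast
    \<comment> \<open>Here \<open>(1 - \<i>) * step y / 2\<close> leads from \<open>z\<close> to the right face of the edge \<open>(z, y)\<close>.\<close>
    have corner: "\<exists>j<n. vtx (nxt j) = z \<and> dirv (nxt j) - dirv j = (1 - \<i>) * step y"
      if y: "valid (z, y)" for y
    proof (rule ccontr)
      assume none: "\<not> ?thesis"
      let ?d = "(1 - \<i>) * step y"
      have "\<bar>Re ?d\<bar> = 1" "\<bar>Im ?d\<bar> = 1" by (cases y; simp)+
      then have "z + ?d / 2 \<in> region"
        using corner_region[OF z(2), of ?d] none z(1) by blast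
      moreover have "right_edge (z + ?d / 2, y) = (z, y)" by (simp add: right_edge_def)
      ultimately have "z + ?d / 2 \<in> cw_faces"
        using y valid_right_edge[of "z + ?d / 2" y La] by (simp add: cw_faces_def)
      then show False using no_cw by blast
    qed
    have "valid (z, rot (rot x))" using x valid_same_tail by blast
    then obtain k where k: "k < n" "vtx (nxt k) = z" "dirv (nxt k) - dirv k = (1 - \<i>) * step (rot (rot x))"
      using corner by blast
    obtain j where j: "j < n" "vtx (nxt j) = z" "dirv (nxt j) - dirv j = (1 - \<i>) * step x"
      using corner[OF x] by blast
    have "j \<noteq> k" using j(3) k(3) by (cases x) (auto simp: complex_eq_iff)
    then have "nxt j \<noteq> nxt k" using nxt_inj j(1) k(1) by blast
    let ?P = "{j. j < n \<and> vtx j = z}"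
    have "card (edge_at ` {..<n} \<inter> {(z, x), (z, rot (rot x))}) \<le> card {(z, x), (z, rot (rot x))}"
      by (intro card_mono) auto
    also have "\<dots> \<le> 2" by (simp add: card_insert_if)
    finally have "card ?P \<le> 2" unfolding card_passages[OF x] .
    moreover have "card {nxt j, nxt k} \<le> card ?P"
      using j(2) k(2) nxt_less by (intro card_mono) auto
    ultimately show ?thesis using \<open>nxt j \<noteq> nxt k\<close> by simp
  qed
  then show ?thesis unfolding maximally_simple_def using simple_rounded by blast
qed

theorem maximally_simple_if_planefilling:
  assumes "S \<noteq> []" "self_avoiding S" "planefilling S"
  shows "maximally_simple S"
proof -
  obtain q where "set (edge_list q [La, Lb, Lc, Ld]) \<subseteq> limit_edges S"
    using planefilling_face assms(2,3) by blast
  then have "distinct (edge_list 0 (loop_word S))" using distinct_loop_if_face assms(1,2) by blast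
  then show ?thesis using maximally_simple_if_stretch_bound stretch_bound assms by blast
qed

section \<open>Faces of a maximally simple loop\<close>

text \<open>The left face of an edge \<open>f\<close> of the loop is inside. If no corner of the loop separates it from the
starting point \<open>z\<close> of the next edge around it, then \<open>z\<close> is inside and is passed twice, so that both valid edges
leaving \<open>z\<close> belong to the loop. If some corner does, this corner already contains the next edge.\<close>

lemma loop_left_closed:
  assumes "S \<noteq> []" "maximally_simple S"
  shows "distinct (edge_list 0 (loop_word S))"
    and "f \<in> set (edge_list 0 (loop_word S)) \<Longrightarrow> lnext f \<in> set (edge_list 0 (loop_word S))"
proof -
  interpret turning_loop "loop_word S" using assms(1) by (rule turning_loop_word)
  have simple: "simple_path (rounded_loop (loop_word S))"
    and twice: "\<And>z. z \<in> inside (path_image (rounded_loop (loop_word S))) \<Longrightarrow> z \<in> grid_points \<Longrightarrow>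
        card {j. j < n \<and> vtx j = z} = 2"
    using assms(2) unfolding maximally_simple_def by blast+
  show dist: "distinct (edge_list 0 (loop_word S))" using simple by (rule distinct_if_simple_rounded)
  interpret simple_turning_loop "loop_word S" using dist by unfold_locales
  have edges: "set (edge_list 0 (loop_word S)) = edge_at ` {..<n}"
    by (rule set_edge_list)
  have area0: "(\<Sum>j<n. area_form (edge_at j)) \<ge> 0"
    unfolding sum_area loop_area by simp
  assume "f \<in> set (edge_list 0 (loop_word S))"
  then obtain k where k: "k < n" "f = edge_at k" unfolding edges by blast
  define z where "z = fst (lnext f)"
  define y where "y = snd (lnext f)"
  have zy: "lnext f = (z, y)" by (simp add: z_def y_def)
  have v: "valid (z, y)" using valid_lnext[OF valid_edge_at[OF k(1)]] k(2) zy by simp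
  have z: "z \<in> grid_points" using valid_grid[OF v] by simp
  have face: "left_face (z, y) \<in> region"
    using face_count(1)[OF area0 k(1)] k(2) zy left_face_lnext[of f] by simp
  \<comment> \<open>Half of \<open>?d\<close> leads from \<open>z\<close> to the left face of \<open>(z, y)\<close>.\<close>
  let ?d = "(1 + \<i>) * step y"
  have lf: "left_face (z, y) = z + ?d / 2" by (simp add: left_face_def midpt_def field_simps)
  show "lnext f \<in> set (edge_list 0 (loop_word S))"
  proof (cases "\<exists>j<n. vtx (nxt j) = z \<and> dirv (nxt j) - dirv j = ?d")
    case True
    then obtain j where j: "j < n" "vtx (nxt j) = z" "dirv (nxt j) - dirv j = ?d" by blast
    have "valid (z, loop_word S ! nxt j)"
      using valid_edge_at[of "nxt j"] j(2) by (simp add: edge_at_def)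
    then have c: "loop_word S ! nxt j = y \<or> loop_word S ! nxt j = rot (rot y)"
      using valid_same_tail[OF v] by blast
    have "loop_word S ! nxt j \<noteq> rot (rot y)"
    proof
      assume "loop_word S ! nxt j = rot (rot y)"
      then have "- step y - dirv j = ?d" using j(3) by simp
      then show False by (cases y; cases "loop_word S ! j") (auto simp: complex_eq_iff)
    qed
    then have "lnext f = edge_at (nxt j)" using c j(2) zy by (simp add: edge_at_def)
    then show ?thesis unfolding edges using nxt_less by blast
  next
    case False
    have "\<bar>Re ?d\<bar> = 1" "\<bar>Im ?d\<bar> = 1" by (cases y; simp)+
    then have "z \<in> region \<longleftrightarrow> z + ?d / 2 \<in> region"
      using corner_region[OF z, of ?d] False by blast
    then have "z \<in> region" using face lf by simp
    then have "card {j. j < n \<and> vtx j = z} = 2" using twice z by blast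
    then have c2: "card (edge_at ` {..<n} \<inter> {(z, y), (z, rot (rot y))}) = 2" using card_passages[OF v] by simp
    have "rot (rot y) \<noteq> y" by (cases y) auto
    then have "card {(z, y), (z, rot (rot y))} = 2" by simp
    then have "edge_at ` {..<n} \<inter> {(z, y), (z, rot (rot y))} = {(z, y), (z, rot (rot y))}"
      using c2 by (intro card_subset_eq) auto
    then show ?thesis unfolding edges zy by blast
  qed
qed

definition cycle :: "(edge \<Rightarrow> edge) \<Rightarrow> edge \<Rightarrow> edge set" where
  "cycle nx e = {e, nx e, nx (nx e), nx (nx (nx e))}"

lemma cycle_lnext: "cycle lnext (lnext e) = cycle lnext e"
  by (auto simp: cycle_def)

lemma cycle_closed: "(\<And>f. f \<in> X \<Longrightarrow> nx f \<in> X) \<Longrightarrow> f \<in> X \<Longrightarrow> cycle nx f \<subseteq> X"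
  by (simp add: cycle_def)

lemma cycle_lnext_edge_list: "\<exists>q. cycle lnext e = set (edge_list q [La, Lb, Lc, Ld])"
proof -
  have a: "cycle lnext (q, La) = set (edge_list q [La, Lb, Lc, Ld])" for q
    by (simp add: cycle_def lnext_def)
  have "snd e = La \<or> snd (lnext e) = La \<or> snd (lnext (lnext e)) = La \<or> snd (lnext (lnext (lnext e))) = La"
    by (cases "snd e") (auto simp: lnext_def)
  then obtain e' where "snd e' = La" "cycle lnext e' = cycle lnext e"
    using cycle_lnext by metis
  then show ?thesis using a[of "fst e'"] by (metis prod.collapse)
qed

definition subst_set :: "crease list \<Rightarrow> edge set \<Rightarrow> edge set" where
  "subst_set S X = (\<Union>e\<in>X. set (subst S e))"

lemma subst_set_mono: "X \<subseteq> Y \<Longrightarrow> subst_set S X \<subseteq> subst_set S Y"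
  by (auto simp: subst_set_def)

lemma subst_set_fold_power_add:
  "subst_set (fold_power S (n + k)) X = subst_set (fold_power S n) (subst_set (fold_power S k) X)"
  by (auto simp: subst_set_def subst_fold_power_add)

lemma lnext_shift: "lnext (shift q e) = shift q (lnext e)"
  by (simp add: lnext_def shift_def add.assoc)

text \<open>The image of every face on the side given by \<open>nx\<close> (\<open>lnext\<close> or \<open>rnext\<close>) is a union of complete
faces on that side. All faces are meant, without regard to the orientation of the grid: the image of
each face on one side is a translate of the same loop.\<close>

definition face_closed :: "(edge \<Rightarrow> edge) \<Rightarrow> crease list \<Rightarrow> bool" where
  "face_closed nx S \<longleftrightarrow> (\<forall>e. \<forall>f\<in>subst_set S (cycle nx e). nx f \<in> subst_set S (cycle nx e))"

lemma face_closed_cycle: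
  "face_closed nx S \<Longrightarrow> f \<in> subst_set S (cycle nx e) \<Longrightarrow> cycle nx f \<subseteq> subst_set S (cycle nx e)"
  by (rule cycle_closed) (unfold face_closed_def, blast+)

lemma face_closed_lnext:
  assumes "S \<noteq> []" "maximally_simple S"
  shows "face_closed lnext S"
  unfolding face_closed_def
proof (intro allI ballI)
  fix e f assume f: "f \<in> subst_set S (cycle lnext e)"
  obtain q where q: "cycle lnext e = set (edge_list q [La, Lb, Lc, Ld])"
    using cycle_lnext_edge_list by blast
  have sub: "subst_set S (cycle lnext e) = shift (stretch S * q) ` set (edge_list 0 (loop_word S))"
    unfolding q subst_set_def using arg_cong[OF edge_list_loop_shift[of S q], of set] by simp
  then obtain g where "g \<in> set (edge_list 0 (loop_word S))" "f = shift (stretch S * q) g" using f by auto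
  then show "lnext f \<in> subst_set S (cycle lnext e)"
    unfolding sub using loop_left_closed(2)[OF assms] by (simp add: lnext_shift)
qed

lemma face_closed_power:
  assumes "face_closed nx S" and nx4: "\<And>f. nx (nx (nx (nx f))) = f"
  shows "face_closed nx (fold_power S n)"
proof (induction n)
  case 0
  have "subst_set [] X = X" for X by (auto simp: subst_set_def subst_def theta_letter_Nil)
  then show ?case using nx4 by (auto simp: face_closed_def cycle_def)
next
  case (Suc n)
  show ?case
    unfolding face_closed_def
  proof (intro allI ballI)
    fix e f assume f: "f \<in> subst_set (fold_power S (Suc n)) (cycle nx e)"
    have eq: "subst_set (fold_power S (Suc n)) X = subst_set (fold_power S n) (subst_set S X)" for X
      using subst_set_fold_power_add[of S n 1] by (simp add: fold_conv_Nil_left)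
    obtain g where g: "g \<in> subst_set S (cycle nx e)" "f \<in> set (subst (fold_power S n) g)"
      using f unfolding eq subst_set_def[of "fold_power S n"] by blast
    have "f \<in> subst_set (fold_power S n) (cycle nx g)"
      using g(2) by (auto simp: subst_set_def cycle_def)
    then have "nx f \<in> subst_set (fold_power S n) (cycle nx g)"
      using Suc unfolding face_closed_def by blast
    then show "nx f \<in> subst_set (fold_power S (Suc n)) (cycle nx e)"
      unfolding eq using subst_set_mono[OF face_closed_cycle[OF assms(1) g(1)]] by blast
  qed
qed

text \<open>The symmetry \<open>\<sigma>\<tau>\<close> on edges: the path is reversed, reflected in a point and rotated by a quarter
turn. It commutes with \<open>\<theta>\<close> and exchanges left and right faces.\<close>

definition mirror :: "edge \<Rightarrow> edge" where
  "mirror e = (- \<i> * (fst e + step (snd e)), rot (snd e))"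

lemma edge_list_mirror:
  "edge_list (- \<i> * (p + displacement u)) (map rot (rev u)) = rev (map mirror (edge_list p u))"
proof (induction u arbitrary: p)
  case (Cons x u)
  then show ?case
    using Cons[of "p + step x"] by (simp add: edge_list_append mirror_def algebra_simps)
qed simp

lemma subst_mirror: "subst S (mirror e) = rev (map mirror (subst S e))"
proof -
  have "subst S (mirror e) = edge_list (- \<i> * (stretch S * fst e + displacement (theta_letter S (snd e))))
      (map rot (rev (theta_letter S (snd e))))"
    by (simp add: subst_def mirror_def theta_letter_rot displacement_theta_letter algebra_simps)
  then show ?thesis unfolding edge_list_mirror by (simp add: subst_def)
qed

lemma rnext_mirror_lnext: "rnext (mirror (lnext e)) = mirror e"
  by (simp add: rnext_def mirror_def lnext_def algebra_simps)

lemma lnext_mirror_rnext: "lnext (mirror (rnext e)) = mirror e"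
  by (simp add: rnext_def mirror_def lnext_def algebra_simps)

lemma mirror_cycle_lnext: "cycle rnext (mirror e) = mirror ` cycle lnext e"
proof -
  have 1: "rnext (mirror f) = mirror (lnext (lnext (lnext f)))" for f
    using rnext_mirror_lnext[of "lnext (lnext (lnext f))"] by simp
  show ?thesis unfolding cycle_def 1 by auto
qed

lemma mirror_cycle_rnext: "cycle lnext (mirror e) = mirror ` cycle rnext e"
proof -
  have 1: "lnext (mirror f) = mirror (rnext (rnext (rnext f)))" for f
    using lnext_mirror_rnext[of "rnext (rnext (rnext f))"] by simp
  show ?thesis unfolding cycle_def 1 by auto
qed

lemma mirror_surj: "\<exists>e'. e = mirror e'"
proof
  show "e = mirror (\<i> * fst e - step (rot (rot (rot (snd e)))), rot (rot (rot (snd e))))"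
    by (simp add: mirror_def prod_eq_iff algebra_simps)
qed

lemma subst_set_mirror: "subst_set S (mirror ` X) = mirror ` subst_set S X"
  by (auto simp: subst_set_def subst_mirror)

lemma face_closed_rnext:
  assumes "face_closed lnext S"
  shows "face_closed rnext S"
  unfolding face_closed_def
proof (intro allI ballI)
  fix e f assume f: "f \<in> subst_set S (cycle rnext e)"
  obtain e' where e': "e = mirror e'" using mirror_surj by blast
  let ?X = "subst_set S (cycle lnext e')"
  have X: "subst_set S (cycle rnext e) = mirror ` ?X"
    unfolding e' mirror_cycle_lnext subst_set_mirror ..
  then obtain g where g: "g \<in> ?X" "f = mirror g" using f by auto
  have "lnext (lnext (lnext g)) \<in> ?X" using assms g(1) unfolding face_closed_def by blast
  moreover have "rnext f = mirror (lnext (lnext (lnext g)))"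
    unfolding g(2) using rnext_mirror_lnext[of "lnext (lnext (lnext g))"] by simp
  ultimately show "rnext f \<in> subst_set S (cycle rnext e)" unfolding X by blast
qed

section \<open>Counting edges on incomplete faces\<close>

definition closed_in :: "(edge \<Rightarrow> edge) \<Rightarrow> edge list \<Rightarrow> edge \<Rightarrow> bool" where
  "closed_in nx es f \<longleftrightarrow> cycle nx f \<subseteq> set es"

text \<open>Let \<open>M\<close> be the length of the images under \<open>\<theta>^k\<close>, each of which contains an edge \<open>g\<close> together with
its face. By \<open>face_closed\<close>, all edges in the image of such a \<open>g\<close> under a further power have their face completely
inside the total image. So an edge with an incomplete face descends from one of at most \<open>M - 1\<close>
edges, and has an incomplete face in the image of that edge already.\<close>

lemma open_edges_bound:
  assumes closed: "\<And>n. face_closed nx (fold_power S n)"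
    and some: "\<And>e. \<exists>g\<in>set (subst (fold_power S k) e). closed_in nx (subst (fold_power S k) e) g"
  shows "length (filter (\<lambda>f. \<not> closed_in nx (subst (fold_power S (k * j)) e) f) (subst (fold_power S (k * j)) e))
    \<le> (fold_count S ^ k - 1) ^ j"
proof (induction j arbitrary: e)
  case 0
  show ?case by (simp add: subst_def theta_letter_Nil)
next
  case (Suc j)
  let ?P = "fold_power S k" and ?Q = "fold_power S (k * j)" and ?W = "fold_power S (k * Suc j)"
  let ?gs = "subst ?P e"
  let ?B = "(fold_count S ^ k - 1) ^ j"
  have W: "subst ?W e = concat (map (subst ?Q) ?gs)"
    using subst_fold_power_add[of S "k * j" k e] by (simp add: add.commute)
  have setW: "set (subst ?W e) = subst_set ?Q (set ?gs)" unfolding W by (simp add: subst_set_def)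
  have one: "length (filter (\<lambda>f. \<not> closed_in nx (subst ?W e) f) (subst ?Q g))
      \<le> (if closed_in nx ?gs g then 0 else ?B)" if g: "g \<in> set ?gs" for g
  proof (cases "closed_in nx ?gs g")
    case True
    have "closed_in nx (subst ?W e) f" if "f \<in> set (subst ?Q g)" for f
    proof -
      have "f \<in> subst_set ?Q (cycle nx g)" using that by (auto simp: subst_set_def cycle_def)
      then have "cycle nx f \<subseteq> subst_set ?Q (cycle nx g)" by (rule face_closed_cycle[OF closed])
      also have "\<dots> \<subseteq> subst_set ?Q (set ?gs)" using True by (intro subst_set_mono) (simp add: closed_in_def)
      finally show ?thesis unfolding closed_in_def setW .
    qed
    then have "filter (\<lambda>f. \<not> closed_in nx (subst ?W e) f) (subst ?Q g) = []"
      by (simp add: filter_empty_conv)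
    then show ?thesis using True by simp
  next
    case False
    have sub: "set (subst ?Q g) \<subseteq> set (subst ?W e)" unfolding setW subst_set_def using g by blast
    have "length (filter (\<lambda>f. \<not> closed_in nx (subst ?W e) f) (subst ?Q g))
        = length (filter (\<lambda>f. \<not> closed_in nx (subst ?W e) f)
            (filter (\<lambda>f. \<not> closed_in nx (subst ?Q g) f) (subst ?Q g)))"
      unfolding filter_filter using sub by (intro arg_cong[of _ _ length] filter_cong) (auto simp: closed_in_def)
    also have "\<dots> \<le> length (filter (\<lambda>f. \<not> closed_in nx (subst ?Q g) f) (subst ?Q g))"
      by (rule length_filter_le)
    also have "\<dots> \<le> ?B" by (rule Suc.IH)
    finally show ?thesis using False by simp
  qed
  have sums: "sum_list (map F gs) \<le> length (filter (\<lambda>g. \<not> closed_in nx ?gs g) gs) * ?B"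
    if "\<And>g. g \<in> set gs \<Longrightarrow> F g \<le> (if closed_in nx ?gs g then 0 else ?B)" for F :: "edge \<Rightarrow> nat" and gs
    using that
  proof (induction gs)
    case (Cons g gs)
    have "F g \<le> (if closed_in nx ?gs g then 0 else ?B)" using Cons.prems by simp
    moreover have "sum_list (map F gs) \<le> length (filter (\<lambda>g. \<not> closed_in nx ?gs g) gs) * ?B"
      using Cons by simp
    ultimately show ?case by (auto split: if_splits)
  qed simp
  have "length (filter (\<lambda>f. \<not> closed_in nx (subst ?W e) f) (subst ?W e))
      = sum_list (map (\<lambda>g. length (filter (\<lambda>f. \<not> closed_in nx (subst ?W e) f) (subst ?Q g))) ?gs)"
  proof -
    have "length (filter P (concat (map F gs))) = sum_list (map (\<lambda>g. length (filter P (F g))) gs)"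
      for P :: "edge \<Rightarrow> bool" and F :: "edge \<Rightarrow> edge list" and gs
      by (induction gs) auto
    then show ?thesis unfolding W .
  qed
  also have "\<dots> \<le> length (filter (\<lambda>g. \<not> closed_in nx ?gs g) ?gs) * ?B"
    using one by (rule sums)
  also have "\<dots> \<le> (fold_count S ^ k - 1) * ?B"
  proof (rule mult_le_mono1)
    obtain g where "g \<in> set ?gs" "closed_in nx ?gs g" using some by blast
    then have "length (filter (\<lambda>g. \<not> closed_in nx ?gs g) ?gs) < length ?gs"
      by (intro length_filter_less[of g]) auto
    then show "length (filter (\<lambda>g. \<not> closed_in nx ?gs g) ?gs) \<le> fold_count S ^ k - 1"
      using fold_count_fold_power[of S k] by (simp add: fold_count_def)
  qed
  finally show ?case by simp
qed

section \<open>A complete face on the limit curve\<close>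

text \<open>The edges of the loop form \<open>m\<close> complete left faces, around which \<open>lnext\<close> permutes them. As there are
\<open>2m + 2\<close> left turns, some face has at least three edges followed by a left turn; three of them are
consecutive around the face, and a left turn leads from such an edge to the next edge of the same face.\<close>

lemma loop_three_left_turns:
  assumes "S \<noteq> []" "maximally_simple S"
  obtains j where "\<And>i. i < 3 \<Longrightarrow> loop_letter S (Suc (j + i)) = rot (loop_letter S (j + i))"
proof -
  interpret turning_loop "loop_word S" using assms(1) by (rule turning_loop_word)
  have dist: "distinct (edge_list 0 (loop_word S))" using loop_left_closed(1) assms by blast
  interpret simple_turning_loop "loop_word S" using dist by unfold_locales
  define E where "E = edge_at ` {..<n}"
  define T where "T = edge_at ` {j. j < n \<and> loop_word S ! nxt j = rot (loop_word S ! j)}"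
  define t where "t e = (if e \<in> T then 1 else 0 :: nat)" for e
  have fin: "finite E" by (simp add: E_def)
  have inj: "inj_on edge_at {..<n}" using edge_at_inj by (auto simp: inj_on_def)
  have edges: "set (edge_list 0 (loop_word S)) = E"
    unfolding E_def by (rule set_edge_list)
  have closed: "lnext e \<in> E" if "e \<in> E" for e
    using loop_left_closed(2)[OF assms] that unfolding edges by blast
  have cE: "card E = 4 * fold_count S"
    unfolding E_def using inj by (simp add: card_image length_loop_word)
  have "card T = card {j. j < n \<and> loop_word S ! nxt j = rot (loop_word S ! j)}"
    unfolding T_def by (intro card_image inj_on_subset[OF inj]) auto
  then have cT: "card T = 2 * fold_count S + 2" using loop_left_turns by simp
  have TE: "T \<subseteq> E" by (auto simp: T_def E_def)
  have sum1: "(\<Sum>e\<in>E. t e) = 2 * fold_count S + 2"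
  proof -
    have "(\<Sum>e\<in>E. t e) = card (E \<inter> T)" unfolding t_def using fin by (simp add: sum.If_cases Int_def)
    then show ?thesis using TE cT by (simp add: Int_absorb1)
  qed
  \<comment> \<open>Summing over \<open>E\<close> counts each edge in each of the four positions around its face.\<close>
  have bij: "bij_betw lnext E E"
    by (rule bij_betwI[of _ _ _ "\<lambda>e. lnext (lnext (lnext e))"]) (auto intro: closed)
  have shiftsum: "(\<Sum>e\<in>E. F (lnext e)) = (\<Sum>e\<in>E. F e)" for F :: "edge \<Rightarrow> nat"
    using sum.reindex_bij_betw[OF bij, of F] .
  have "\<exists>e. e \<in> T \<and> lnext e \<in> T \<and> lnext (lnext e) \<in> T"
  proof (rule ccontr)
    assume none: "\<not> ?thesis"
    have le: "t e + t (lnext e) + t (lnext (lnext e)) + t (lnext (lnext (lnext e))) \<le> 2" for e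
    proof -
      have "\<not> (e \<in> T \<and> lnext e \<in> T \<and> lnext (lnext e) \<in> T)"
        "\<not> (lnext e \<in> T \<and> lnext (lnext e) \<in> T \<and> lnext (lnext (lnext e)) \<in> T)"
        "\<not> (lnext (lnext e) \<in> T \<and> lnext (lnext (lnext e)) \<in> T \<and> e \<in> T)"
        "\<not> (lnext (lnext (lnext e)) \<in> T \<and> e \<in> T \<and> lnext e \<in> T)"
        using none lnext4[of e] lnext4[of "lnext e"] by metis+
      then show ?thesis by (auto simp: t_def)
    qed
    have "(\<Sum>e\<in>E. t e + t (lnext e) + t (lnext (lnext e)) + t (lnext (lnext (lnext e)))) \<le> (\<Sum>e\<in>E. 2)"
      by (rule sum_mono) (rule le)
    also have "\<dots> = 8 * fold_count S" by (simp add: cE)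
    finally have "4 * (\<Sum>e\<in>E. t e) \<le> 8 * fold_count S"
      using shiftsum[of t] shiftsum[of "\<lambda>e. t (lnext e)"] shiftsum[of "\<lambda>e. t (lnext (lnext e))"]
      by (simp add: sum.distrib)
    then show False using sum1 by simp
  qed
  then obtain e where e: "e \<in> T" "lnext e \<in> T" "lnext (lnext e) \<in> T" by blast
  have step: "\<exists>k<n. k = nxt j \<and> edge_at k = lnext (edge_at j)"
    if "j < n" "loop_word S ! nxt j = rot (loop_word S ! j)" for j
    using that vtx_nxt[of j] nxt_less by (auto simp: edge_at_def lnext_def)
  have turn_at: "loop_word S ! nxt j = rot (loop_word S ! j)" if jT: "j < n" "edge_at j \<in> T" for j
  proof -
    obtain i where i: "i < n" "loop_word S ! nxt i = rot (loop_word S ! i)" "edge_at j = edge_at i"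
      using jT(2) unfolding T_def by blast
    then have "i = j" using edge_at_inj jT(1) by blast
    then show ?thesis using i(2) by simp
  qed
  obtain j where j: "j < n" "e = edge_at j" using e(1) TE unfolding E_def by blast
  have 0: "loop_word S ! nxt j = rot (loop_word S ! j)" using turn_at j e(1) by blast
  have e1: "edge_at (nxt j) = lnext e" using step[OF j(1) 0] j(2) by blast
  have 1: "loop_word S ! nxt (nxt j) = rot (loop_word S ! nxt j)"
    using turn_at[of "nxt j"] e(2) e1 nxt_less by metis
  have e2: "edge_at (nxt (nxt j)) = lnext (lnext e)" using step[OF nxt_less 1] e1 by metis
  have 2: "loop_word S ! nxt (nxt (nxt j)) = rot (loop_word S ! nxt (nxt j))"
    using turn_at[of "nxt (nxt j)"] e(3) e2 nxt_less by metis
  have letters: "loop_word S ! (i mod n) = loop_letter S i" for i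
    using nth_loop_word[of S i] by (simp add: length_loop_word)
  have "nxt (nxt j) = Suc (Suc j) mod n" "nxt (nxt (nxt j)) = Suc (Suc (Suc j)) mod n" "j mod n = j"
    using j(1) by (simp_all add: mod_Suc_eq)
  then have "loop_letter S (Suc j) = rot (loop_letter S j)"
    "loop_letter S (Suc (Suc j)) = rot (loop_letter S (Suc j))"
    "loop_letter S (Suc (Suc (Suc j))) = rot (loop_letter S (Suc (Suc j)))"
    using 0 1 2 letters by metis+
  then have "loop_letter S (Suc (j + i)) = rot (loop_letter S (j + i))" if "i < 3" for i
    using that by (auto simp: numeral_3_eq_3 less_Suc_eq)
  then show ?thesis by (rule that)
qed

lemma limit_letter_block:
  assumes "S \<noteq> []" "r < fold_count S"
  shows "dir_seq (fold_limit S) (fold_count S * t + r) = theta_letter S (dir_seq (fold_limit S) t) ! r"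
proof -
  have "subst S (limit_edge S t) = map (\<lambda>r. limit_edge S (fold_count S * t + r)) [0..<fold_count S]"
    using subst_limit_edge[OF assms(1), of 1 t] by (simp add: fold_conv_Nil_left)
  then have "snd (subst S (limit_edge S t) ! r) = snd (limit_edge S (fold_count S * t + r))"
    using assms(2) by simp
  moreover have "subst S (limit_edge S t) ! r = edge_list (stretch S * limit_vertex S t)
      (theta_letter S (dir_seq (fold_limit S) t)) ! r"
    by (simp add: subst_def limit_edge_def)
  ultimately show ?thesis
    using assms(2) by (simp add: nth_edge_list limit_edge_def fold_count_def)
qed

lemma dir_seq_0 [simp]: "dir_seq s 0 = La"
  by (simp add: dir_seq_def weight_def)

text \<open>For horizontal \<open>y\<close> the curve starts with the required turn \<open>ab\<close>. For vertical \<open>y\<close>, the second turn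
is either left, giving \<open>bc\<close>, or right, and then \<open>\<theta>(a)\<close> starts with \<open>aba\<close> and \<open>\<theta>(b)\<close> ends with
\<open>\<sigma>\<tau>(aba) = bcb\<close>.\<close>

lemma limit_left_turn:
  assumes S: "folding_string S" and m: "3 \<le> fold_count S"
  obtains t where "dir_seq (fold_limit S) t = y \<or> dir_seq (fold_limit S) t = rot (rot y)"
    "dir_seq (fold_limit S) (Suc t) = rot (dir_seq (fold_limit S) t)"
proof -
  let ?d = "dir_seq (fold_limit S)" and ?m = "fold_count S"
  have ne: "S \<noteq> []" using S by (simp add: folding_string_def)
  have first: "?d t = theta_letter S La ! t" if "t < ?m" for t
    using limit_letter_block[OF ne that, of 0] by simp
  have d1: "?d 1 = Lb"
  proof -
    obtain S' where "S = D # S'" using S by (cases S) (auto simp: folding_string_def)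
    moreover have "walk Lb S' ! 0 = Lb" by (cases S') auto
    ultimately show ?thesis using first[of 1] m by (simp add: dir_word_walk)
  qed
  show ?thesis
  proof (cases "horizontal y")
    case True
    then have "La = y \<or> La = rot (rot y)" by (cases y) (auto simp: horizontal_def)
    then show ?thesis using that[of 0] d1 by simp
  next
    case False
    then have y: "Lb = y \<or> Lb = rot (rot y)" by (cases y) (auto simp: horizontal_def)
    show ?thesis
    proof (cases "?d 2 = Lc")
      case True
      then show ?thesis using that[of 1] y d1 by (simp add: numeral_2_eq_2)
    next
      case False
      have "?d 2 = turn (fold_limit S 1) Lb" using dir_seq_Suc[of "fold_limit S" 1] d1
        by (simp add: numeral_2_eq_2)
      then have d2: "?d 2 = La" using False by (cases "fold_limit S 1") auto
      have tb: "theta_letter S Lb ! (?m - Suc i) = rot (?d i)" if "i < ?m" for i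
      proof -
        have "length (dir_word S) = ?m" by (simp add: dir_word_walk fold_count_def)
        then have "theta_letter S Lb ! (?m - Suc i) = rot (theta_letter S La ! i)"
          using that by (simp add: rev_nth)
        then show ?thesis using first[OF that] by simp
      qed
      define t where "t = ?m * 1 + (?m - Suc 2)"
      have "?m * 1 + (?m - Suc 1) = Suc t" using m by (simp add: t_def)
      moreover have "?d (?m * 1 + (?m - Suc 1)) = Lc"
        using limit_letter_block[OF ne, of "?m - Suc 1" 1] tb[of 1] m d1 by simp
      ultimately have "?d (Suc t) = Lc" by simp
      moreover have "?d t = Lb"
        unfolding t_def using limit_letter_block[OF ne, of "?m - Suc 2" 1] tb[of 2] m d1 d2 by simp
      ultimately show ?thesis using that[of t] y by simp
    qed
  qed
qed

lemma theta_letter_rot2: "theta_letter S (rot (rot x)) = map (rot \<circ> rot) (theta_letter S x)"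
  by (simp add: theta_letter_rot rev_map)

text \<open>Three consecutive turns of the loop meet at most one junction when \<open>m \<ge> 3\<close>, so they lie in
\<open>\<theta>(y \<sigma>y)\<close> for some letter \<open>y\<close>. The curve contains \<open>y \<sigma>y\<close> or the same turn rotated by \<open>\<sigma>\<^sup>2\<close>, and \<open>\<theta>\<close> commutes
with \<open>\<sigma>\<^sup>2\<close>. The only string with \<open>m = 2\<close> belongs to the dragon curve, where
the turns with index 7 to 9 are left.\<close>

lemma limit_three_left_turns:
  assumes S: "folding_string S" "maximally_simple S"
  obtains j where "\<And>i. i < 3 \<Longrightarrow> dir_seq (fold_limit S) (Suc (j + i)) = rot (dir_seq (fold_limit S) (j + i))"
proof (cases "3 \<le> fold_count S")
  case True
  let ?d = "dir_seq (fold_limit S)" and ?m = "fold_count S"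
  have ne: "S \<noteq> []" using S by (simp add: folding_string_def)
  obtain j where j: "\<And>i. i < 3 \<Longrightarrow> loop_letter S (Suc (j + i)) = rot (loop_letter S (j + i))"
    using loop_three_left_turns[OF ne S(2)] by blast
  define q where "q = j div ?m"
  define r where "r = j mod ?m"
  define y where "y = (rot ^^ q) La"
  have jq: "j = ?m * q + r" and r: "r < ?m" using True by (simp_all add: q_def r_def)
  obtain t where t: "?d t = y \<or> ?d t = rot (rot y)" "?d (Suc t) = rot (?d t)"
    using limit_left_turn[OF S(1) True] by blast
  have split: "\<exists>b c. b < 2 \<and> c < ?m \<and> r + i = ?m * b + c" if "i \<le> 3" for i
  proof (cases "r + i < ?m")
    case True
    then show ?thesis by (intro exI[of _ 0] exI[of _ "r + i"]) simp
  next
    case False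
    then show ?thesis using r that \<open>3 \<le> ?m\<close>
      by (intro exI[of _ 1] exI[of _ "r + i - ?m"]) auto
  qed
  have ll: "loop_letter S (?m * (q + b) + c) = theta_letter S ((rot ^^ b) y) ! c" if "c < ?m" for b c
  proof -
    have "(?m * (q + b) + c) div ?m = b + q" "(?m * (q + b) + c) mod ?m = c"
      using that by (simp_all only: div_mult_self4 mod_mult_self4) auto
    then show ?thesis by (simp add: loop_letter_def y_def funpow_add)
  qed
  have dd: "?d (?m * (t + b) + c) = theta_letter S ((rot ^^ b) (?d t)) ! c" if "c < ?m" "b < 2" for b c
  proof -
    have "b = 0 \<or> b = 1" using that by auto
    then show ?thesis using limit_letter_block[OF ne that(1), of "t + b"] t(2) by auto
  qed
  have same: "?d (?m * t + r + i) = (if ?d t = y then loop_letter S (j + i) else rot (rot (loop_letter S (j + i))))"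
    if i: "i \<le> 3" for i
  proof -
    obtain b c where bc: "b < 2" "c < ?m" "r + i = ?m * b + c" using split[OF i] by blast
    have 1: "?m * t + r + i = ?m * (t + b) + c" "j + i = ?m * (q + b) + c"
      using bc(3) jq by (simp_all add: algebra_simps)
    show ?thesis
    proof (cases "?d t = y")
      case True
      then show ?thesis unfolding 1 using ll[OF bc(2), of b] dd[OF bc(2,1)] by simp
    next
      case False
      then have "?d t = rot (rot y)" using t(1) by simp
      moreover have "(rot ^^ b) (rot (rot y)) = rot (rot ((rot ^^ b) y))" by (simp add: funpow_swap1)
      ultimately have "?d (?m * (t + b) + c) = theta_letter S (rot (rot ((rot ^^ b) y))) ! c"
        using dd[OF bc(2,1)] by simp
      also have "\<dots> = rot (rot (theta_letter S ((rot ^^ b) y) ! c))"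
        unfolding theta_letter_rot2 using bc(2) by (simp add: fold_count_def)
      finally show ?thesis unfolding 1 using ll[OF bc(2), of b] False by simp
    qed
  qed
  have "?d (Suc (?m * t + r + i)) = rot (?d (?m * t + r + i))" if "i < 3" for i
    using same[of i] same[of "Suc i"] j[OF that] that by (simp split: if_splits)
  then show ?thesis by (rule that)
next
  case False
  obtain S' where S': "S = D # S'" using S by (cases S) (auto simp: folding_string_def)
  then have SD: "S = [D]" using False by (cases S') (auto simp: fold_count_def)
  have fl: "fold_limit S i = D" if "i \<in> {7, 8, 9}" for i
  proof -
    have "fold_power S 4 = [D, D, U, D, D, U, U, D, D, D, U, U, D, U, U]"
      by (simp add: SD numeral_eq_Suc bar_def)
    then show ?thesis using fold_limit_prefix[of S i 4] that SD by auto
  qed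
  have "dir_seq (fold_limit S) (Suc (7 + i)) = rot (dir_seq (fold_limit S) (7 + i))" if "i < 3" for i
  proof -
    have "7 + i \<in> {7, 8, 9}" using that by auto
    then show ?thesis using dir_seq_Suc[of "fold_limit S" "7 + i"] fl[of "7 + i"] by (simp del: dir_seq_0)
  qed
  then show ?thesis by (rule that)
qed

lemma cycle_in_limit:
  assumes "folding_string S" "maximally_simple S"
  obtains k f where "f \<in> set (subst (fold_power S k) (0, La))"
    "cycle lnext f \<subseteq> set (subst (fold_power S k) (0, La))"
proof -
  have ne: "S \<noteq> []" using assms by (simp add: folding_string_def)
  obtain j where j: "\<And>i. i < 3 \<Longrightarrow>
      dir_seq (fold_limit S) (Suc (j + i)) = rot (dir_seq (fold_limit S) (j + i))"
    using limit_three_left_turns[OF assms] by blast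
  have step: "limit_edge S (Suc (j + i)) = lnext (limit_edge S (j + i))" if "i < 3" for i
    using j[OF that] by (simp add: limit_edge_def lnext_def limit_vertex_Suc)
  have cyc: "cycle lnext (limit_edge S j) = limit_edge S ` {j, Suc j, Suc (Suc j), Suc (Suc (Suc j))}"
    using step[of 0] step[of 1] step[of 2] by (simp add: cycle_def numeral_2_eq_2)
  let ?k = "Suc (Suc (Suc j))"
  have "?k < fold_count S ^ ?k" by (rule less_fold_count_power[OF ne])
  then have "{j, Suc j, Suc (Suc j), ?k} \<subseteq> {0..<fold_count S ^ ?k}" by auto
  then have "cycle lnext (limit_edge S j) \<subseteq> set (subst (fold_power S ?k) (0, La))"
    unfolding subst_prefix[OF ne] cyc set_map set_upt by (rule image_mono)
  moreover from this have "limit_edge S j \<in> set (subst (fold_power S ?k) (0, La))"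
    by (auto simp: cycle_def)
  ultimately show ?thesis by (intro that)
qed

definition has_face :: "(edge \<Rightarrow> edge) \<Rightarrow> crease list \<Rightarrow> dir \<Rightarrow> bool" where
  "has_face nx S y \<longleftrightarrow> (\<forall>p. \<exists>f\<in>set (subst S (p, y)). closed_in nx (subst S (p, y)) f)"

lemma has_face_lnextI:
  assumes "f \<in> set (subst S (p, y))" "cycle lnext f \<subseteq> set (subst S (p, y))"
  shows "has_face lnext S y"
  unfolding has_face_def
proof
  fix q
  have e: "(q, y) = shift (q - p) (p, y)" by (simp add: shift_def)
  let ?s = "shift (stretch S * (q - p))"
  have s: "set (subst S (q, y)) = ?s ` set (subst S (p, y))" unfolding e subst_shift by simp
  have "cycle lnext (?s f) = ?s ` cycle lnext f" by (simp add: cycle_def lnext_shift)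
  then show "\<exists>f\<in>set (subst S (q, y)). closed_in lnext (subst S (q, y)) f"
    unfolding closed_in_def s using assms by (intro bexI[of _ "?s f"]) auto
qed

lemma mirror_eq: "\<exists>p'. (p, rot y) = mirror (p', y)"
  by (rule exI[of _ "\<i> * p - step y"]) (simp add: mirror_def algebra_simps)

lemma has_face_mirror:
  assumes "\<And>f. cycle nx' (mirror f) = mirror ` cycle nx f" "has_face nx S y"
  shows "has_face nx' S (rot y)"
  unfolding has_face_def
proof
  fix p
  obtain p' where p': "(p, rot y) = mirror (p', y)" using mirror_eq by blast
  have s: "set (subst S (p, rot y)) = mirror ` set (subst S (p', y))" unfolding p' subst_mirror by simp
  obtain f where "f \<in> set (subst S (p', y))" "cycle nx f \<subseteq> set (subst S (p', y))"
    using assms(2) unfolding has_face_def closed_in_def by blast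
  then show "\<exists>f\<in>set (subst S (p, rot y)). closed_in nx' (subst S (p, rot y)) f"
    unfolding closed_in_def s by (intro bexI[of _ "mirror f"]) (auto simp: assms(1))
qed

lemma has_face_Suc:
  assumes "z \<in> set (theta_letter S y)" "has_face nx (fold_power S n) z"
  shows "has_face nx (fold_power S (Suc n)) y"
  unfolding has_face_def
proof
  fix p
  have "map snd (edge_list r u) = u" for r u by (induction u arbitrary: r) auto
  then have "map snd (subst S (p, y)) = theta_letter S y" by (simp add: subst_def del: theta_letter.simps)
  then have "z \<in> set (map snd (subst S (p, y)))" using assms(1) by (simp del: set_map)
  then obtain q where q: "(q, z) \<in> set (subst S (p, y))" by force
  have "subst (fold_power S (Suc n)) (p, y) = concat (map (subst (fold_power S n)) (subst S (p, y)))"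
    using subst_fold_power_add[of S n 1] by (simp add: fold_conv_Nil_left)
  then have sub: "set (subst (fold_power S n) (q, z)) \<subseteq> set (subst (fold_power S (Suc n)) (p, y))"
    using q by auto
  obtain f where "f \<in> set (subst (fold_power S n) (q, z))" "cycle nx f \<subseteq> set (subst (fold_power S n) (q, z))"
    using assms(2) unfolding has_face_def closed_in_def by blast
  then show "\<exists>f\<in>set (subst (fold_power S (Suc n)) (p, y)). closed_in nx (subst (fold_power S (Suc n)) (p, y)) f"
    unfolding closed_in_def using sub by blast
qed

text \<open>A complete left face in the image of \<open>a\<close> gives, by \<open>mirror\<close>, left faces in the images of horizontal and
right faces in those of vertical letters. One more application of \<open>\<theta>\<close> mixes the two, since every \<open>\<theta>(y)\<close>
contains both kinds of letters.\<close>

lemma has_faces: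
  assumes "folding_string S" "maximally_simple S"
  obtains k where "0 < k" "\<And>y. has_face lnext (fold_power S k) y" "\<And>y. has_face rnext (fold_power S k) y"
proof -
  have ne: "S \<noteq> []" using assms by (simp add: folding_string_def)
  obtain n f where f: "f \<in> set (subst (fold_power S n) (0, La))"
    "cycle lnext f \<subseteq> set (subst (fold_power S n) (0, La))"
    using cycle_in_limit[OF assms] by blast
  let ?S = "fold_power S n"
  have a: "has_face lnext ?S La" using f by (rule has_face_lnextI)
  have b: "has_face rnext ?S Lb" using has_face_mirror[OF mirror_cycle_lnext a] by simp
  have c: "has_face lnext ?S Lc" using has_face_mirror[OF mirror_cycle_rnext b] by simp
  have d: "has_face rnext ?S Ld" using has_face_mirror[OF mirror_cycle_lnext c] by simp
  have both: "\<exists>z z'. z \<in> set (theta_letter S y) \<and> z' \<in> set (theta_letter S y) \<and> horizontal z \<and> \<not> horizontal z'" for y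
  proof -
    have l: "0 < length S" using ne by simp
    obtain c where "theta_letter S y ! Suc 0 = turn c (theta_letter S y ! 0)"
      using theta_letter_nth_Suc[OF l] by blast
    then have "horizontal (theta_letter S y ! Suc 0) \<longleftrightarrow> \<not> horizontal (theta_letter S y ! 0)"
      by (cases c) auto
    moreover have "theta_letter S y ! Suc 0 \<in> set (theta_letter S y)" "theta_letter S y ! 0 \<in> set (theta_letter S y)"
      using l by (simp_all del: theta_letter.simps)
    ultimately show ?thesis by metis
  qed
  have "has_face lnext (fold_power S (Suc n)) y \<and> has_face rnext (fold_power S (Suc n)) y" for y
  proof -
    obtain z z' where z: "z \<in> set (theta_letter S y)" "z' \<in> set (theta_letter S y)" "horizontal z" "\<not> horizontal z'"
      using both by blast
    have "z = La \<or> z = Lc" "z' = Lb \<or> z' = Ld" using z(3,4) by (cases z; cases z'; simp add: horizontal_def)+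
    then show ?thesis using has_face_Suc[OF z(1)] has_face_Suc[OF z(2)] a b c d by blast
  qed
  then show ?thesis by (intro that[of "Suc n"]) auto
qed

section \<open>Maximally simple implies planefilling\<close>

lemma grid_norm1_nat:
  assumes "p \<in> grid_points" "q \<in> grid_points"
  obtains k :: nat where "norm1 (p - q) = real k"
proof -
  obtain a b c d :: int where "Re p = of_int a" "Im p = of_int b" "Re q = of_int c" "Im q = of_int d"
    using assms unfolding grid_points_def by (auto elim!: Ints_cases)
  then have "norm1 (p - q) = real (nat (\<bar>a - c\<bar> + \<bar>b - d\<bar>))" by (simp add: norm1_def)
  then show ?thesis by (rule that)
qed

lemma norm_le_norm1: "norm z \<le> norm1 z"
  unfolding norm1_def by (rule cmod_le)

lemma norm1_le_norm: "norm1 z \<le> 2 * norm z"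
  using abs_Re_le_cmod[of z] abs_Im_le_cmod[of z] by (simp add: norm1_def)

lemma grid_neighbour:
  assumes "z \<in> grid_points" "c \<in> grid_points" "norm1 (z - c) = real (Suc k)"
  obtains y where "z - step y \<in> grid_points" "norm1 (z - step y - c) = real k"
proof -
  obtain a b a' b' :: int where z: "Re z = of_int a" "Im z = of_int b" and c: "Re c = of_int a'" "Im c = of_int b'"
    using assms unfolding grid_points_def by (auto elim!: Ints_cases)
  have grid: "z - step y \<in> grid_points" for y
    using assms(1) by (cases y) (auto simp: grid_points_def)
  have n: "\<bar>real_of_int a - of_int a'\<bar> + \<bar>real_of_int b - of_int b'\<bar> = real k + 1"
    using assms(3) by (simp add: norm1_def z c)
  have one: "1 \<le> \<bar>real_of_int x - of_int x'\<bar>" if "x \<noteq> x'" for x x' :: int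
  proof -
    have "1 \<le> \<bar>x - x'\<bar>" using that by simp
    then show ?thesis by linarith
  qed
  consider "a > a'" | "a < a'" | "a = a'" "b > b'" | "a = a'" "b < b'"
    using n by (cases a a' rule: linorder_cases; cases b b' rule: linorder_cases) auto
  then show ?thesis
  proof cases
    case 1
    then have "norm1 (z - step La - c) = real k" using n one[of a a'] by (simp add: norm1_def z c)
    then show ?thesis using that grid by blast
  next
    case 2
    then have "norm1 (z - step Lc - c) = real k" using n one[of a a'] by (simp add: norm1_def z c)
    then show ?thesis using that grid by blast
  next
    case 3
    then have "norm1 (z - step Lb - c) = real k" using n one[of b b'] by (simp add: norm1_def z c)
    then show ?thesis using that grid by blast
  next
    case 4
    then have "norm1 (z - step Ld - c) = real k" using n one[of b b'] by (simp add: norm1_def z c)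
    then show ?thesis using that grid by blast
  qed
qed

text \<open>If a valid edge of \<open>X\<close> starts at \<open>p\<close>, completing faces puts all valid edges at \<open>p\<close> into \<open>X\<close>, and then
an edge starting at each neighbour of \<open>p\<close>. Induction on the distance from \<open>e\<close> reaches every grid point that is
close enough; the margin 2 is there because preceding edges start one step further out.\<close>

lemma fill_around:
  assumes e: "e \<in> X" "valid e"
    and closed: "\<And>f. f \<in> X \<Longrightarrow> norm1 (fst f - fst e) \<le> T \<Longrightarrow>
        cycle lnext f \<subseteq> X \<and> cycle rnext f \<subseteq> X"
    and z: "valid (z, x)" "norm1 (z - fst e) \<le> T - 2" and T: "2 \<le> T"
  shows "(z, x) \<in> X"
proof -
  define c where "c = fst e"
  have c: "c \<in> grid_points" using valid_grid[OF e(2)] by (simp add: c_def)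
  have tri: "norm1 (a + step y - c) \<le> norm1 (a - c) + 1" "norm1 (a - step y - c) \<le> norm1 (a - c) + 1" for a y
  proof -
    have "norm1 (step y) = 1" by (cases y) (auto simp: norm1_def)
    then show "norm1 (a + step y - c) \<le> norm1 (a - c) + 1" "norm1 (a - step y - c) \<le> norm1 (a - c) + 1"
      by (simp_all add: norm1_def)
  qed
  have nexts: "(p + step y, rot y) \<in> X" "(p + step y, rot (rot (rot y))) \<in> X"
    "(p - step y', y') \<in> X"
    if f: "(p, y) \<in> X" "norm1 (p - c) \<le> T" and y': "y' = rot y \<or> y' = rot (rot (rot y))" for p y y'
  proof -
    have "cycle lnext (p, y) \<subseteq> X" "cycle rnext (p, y) \<subseteq> X" using closed[of "(p, y)"] f by (auto simp: c_def)
    then show "(p + step y, rot y) \<in> X" "(p + step y, rot (rot (rot y))) \<in> X"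
      and "(p - step y', y') \<in> X"
      using y' by (auto simp: cycle_def lnext_def rnext_def)
  qed
  have both: "(p, rot (rot y)) \<in> X" if "(p, y) \<in> X" "norm1 (p - c) \<le> T - 1" for p y
  proof -
    let ?y = "rot (rot (rot y))"
    have "(p - step ?y, ?y) \<in> X" using nexts(3)[of p y ?y] that by simp
    moreover have "norm1 (p - step ?y - c) \<le> T" using tri(2)[of p ?y] that(2) by linarith
    ultimately have "(p - step ?y + step ?y, rot (rot (rot ?y))) \<in> X"
      by (intro nexts(2)) auto
    then show ?thesis by simp
  qed
  have full: "(p, y') \<in> X" if "(p, y) \<in> X" "valid (p, y)" "valid (p, y')" "norm1 (p - c) \<le> T - 1" for p y y'
    using both[OF that(1,4)] valid_same_tail[OF that(2), of y'] that(1,3) by auto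
  obtain k :: nat where k: "norm1 (z - c) = real k"
    using grid_norm1_nat valid_grid[OF z(1)] c by auto
  have "valid (z, x) \<Longrightarrow> norm1 (z - c) = real k \<Longrightarrow> norm1 (z - c) \<le> T - 2 \<Longrightarrow> (z, x) \<in> X"
  proof (induction k arbitrary: z x)
    case 0
    then have "Re (z - c) = 0" "Im (z - c) = 0" unfolding norm1_def by linarith+
    then have "z = c" by (simp add: complex_eq_iff)
    moreover have "(c, snd e) \<in> X" using e(1) by (simp add: c_def)
    moreover have "valid (c, snd e)" using e(2) by (simp add: c_def)
    ultimately show ?case using full[of c "snd e" x] 0 by simp
  next
    case (Suc k)
    obtain y where y: "z - step y \<in> grid_points" "norm1 (z - step y - c) = real k"
      using grid_neighbour[OF _ c Suc.prems(2)] valid_grid[OF Suc.prems(1)] by auto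
    let ?p = "z - step y"
    have near: "norm1 (?p - c) \<le> T - 2" using y(2) Suc.prems by simp
    obtain w where w: "valid (?p, w)" using grid_valid[OF y(1)] by blast
    have inX: "(?p, v) \<in> X" if "valid (?p, v)" for v using Suc.IH[OF that y(2) near] .
    have "\<exists>v. (z, v) \<in> X \<and> valid (z, v)"
    proof (cases "horizontal w \<longleftrightarrow> horizontal y")
      case True
      then have "valid (?p, y)" using w by (auto simp: valid_def)
      then have "(?p + step y, rot y) \<in> X" "valid (?p + step y, rot y)"
        using nexts(1)[of ?p y "rot y"] inX near valid_head[of ?p y "rot y"] by auto
      then show ?thesis by auto
    next
      case False
      then have v: "valid (?p, rot y)" using w by (auto simp: valid_def)
      have "(?p - step (rot (rot y)), rot (rot y)) \<in> X"
        using nexts(3)[of ?p "rot y" "rot (rot y)"] inX[OF v] near by simp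
      then have "(z, rot (rot y)) \<in> X" by simp
      moreover have "valid (z, rot (rot y))"
        using valid_rnext[OF valid_rnext[OF valid_rnext[OF v]]] by (simp add: rnext_def)
      ultimately show ?thesis by blast
    qed
    then show ?case using full Suc.prems by force
  qed
  then show ?thesis using z k by (simp add: c_def)
qed

text \<open>Among the first \<open>M^j\<close> edges of the curve, at most \<open>2 (M - 1)^j\<close> border an incomplete face. A fixed radius around them reaches only a constant multiple of that number of edges, so for
large \<open>j\<close> some edge is out of their reach.\<close>

theorem planefilling_if_maximally_simple:
  assumes S: "folding_string S" "self_avoiding S" "maximally_simple S"
  shows "planefilling S"
  unfolding planefilling_def
proof (intro allI impI)
  fix R :: real assume R: "0 < R"
  have ne: "S \<noteq> []" using S by (simp add: folding_string_def)
  \<comment> \<open>\<open>norm1\<close> is at most twice the norm, and \<open>fill_around\<close> loses 2 at the boundary.\<close>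
  define T where "T = 2 * R + 2"
  define Q where "Q = 4 * (2 * T + 1)\<^sup>2"
  have inj: "limit_edge S a = limit_edge S b \<longleftrightarrow> a = b" for a b
    using inj_limit_edge[OF S(2)] by (rule inj_eq)
  obtain k where k: "0 < k" "\<And>y. has_face lnext (fold_power S k) y" "\<And>y. has_face rnext (fold_power S k) y"
    using has_faces S by blast
  define M where "M = fold_count S ^ k"
  have M: "2 \<le> M"
  proof -
    have "fold_count S ^ 1 \<le> fold_count S ^ k"
      using k(1) fold_count_ge_2[OF ne] by (intro power_increasing) auto
    then show ?thesis using fold_count_ge_2[OF ne] by (simp add: M_def)
  qed
  have lc: "face_closed lnext S" using ne S(3) by (rule face_closed_lnext)
  have closed: "face_closed lnext (fold_power S n)" "face_closed rnext (fold_power S n)" for n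
    using face_closed_power[OF lc] face_closed_power[OF face_closed_rnext[OF lc]] by auto
  define pre where "pre j = subst (fold_power S (k * j)) (0, La)" for j
  have pre: "pre j = map (limit_edge S) [0..<M ^ j]" for j
    unfolding pre_def subst_prefix[OF ne] M_def power_mult ..
  define bad where "bad nx j = {b. b < M ^ j \<and> \<not> closed_in nx (pre j) (limit_edge S b)}" for nx j
  have card_bad: "card (bad nx j) \<le> (M - 1) ^ j"
    if "\<And>n. face_closed nx (fold_power S n)" "\<And>y. has_face nx (fold_power S k) y" for nx j
  proof -
    have "length (filter (\<lambda>f. \<not> closed_in nx (pre j) f) (pre j)) \<le> (M - 1) ^ j"
      unfolding pre_def M_def using that(2) by (intro open_edges_bound that(1)) (auto simp: has_face_def)
    moreover have "length (filter (\<lambda>f. \<not> closed_in nx (pre j) f) (pre j)) = card (bad nx j)"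
      unfolding length_filter_conv_card bad_def by (intro arg_cong[of _ _ card]) (auto simp: pre)
    ultimately show ?thesis by simp
  qed
  define B where "B j = bad lnext j \<union> bad rnext j" for j
  have finB: "finite (B j)" for j by (auto simp: B_def bad_def)
  have cardB: "card (B j) \<le> 2 * (M - 1) ^ j" for j
    using card_Un_le[of "bad lnext j" "bad rnext j"] card_bad[of lnext j, OF closed(1) k(2)]
      card_bad[of rnext j, OF closed(2) k(3)] by (simp add: B_def)
  have T: "0 \<le> T" using R by (simp add: T_def)
  define near where "near b = {i. norm1 (limit_vertex S i - limit_vertex S b) \<le> T}" for b
  have near: "finite (near b)" "real (card (near b)) \<le> Q" for b
  proof -
    let ?D = "(cball (limit_vertex S b) T \<inter> grid_points) \<times> (UNIV :: dir set)"
    have fin: "finite (cball (limit_vertex S b) T \<inter> grid_points)" by (intro finite_grid) simp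
    then have finD: "finite ?D" by simp
    have sub: "limit_edge S ` near b \<subseteq> ?D"
    proof
      fix f assume "f \<in> limit_edge S ` near b"
      then obtain i where i: "norm1 (limit_vertex S i - limit_vertex S b) \<le> T" "f = limit_edge S i"
        by (auto simp: near_def)
      have "norm (limit_vertex S i - limit_vertex S b) \<le> T" using norm_le_norm1 i(1) order_trans by blast
      then have "fst f \<in> cball (limit_vertex S b) T"
        by (simp add: i(2) limit_edge_def dist_norm norm_minus_commute)
      moreover have "fst f \<in> grid_points" unfolding i(2) by (rule valid_grid[OF valid_limit_edge])
      ultimately show "f \<in> ?D" by (cases f) auto
    qed
    have injn: "inj_on (limit_edge S) (near b)" using inj by (auto simp: inj_on_def)
    show "finite (near b)" using finite_imageD[OF finite_subset[OF sub finD] injn] .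
    have "card (near b) \<le> card ?D" using card_mono[OF finD sub] card_image[OF injn] by simp
    then have "real (card (near b)) \<le> 4 * real (card (cball (limit_vertex S b) T \<inter> grid_points))"
      by (simp add: card_cartesian_product)
    then show "real (card (near b)) \<le> Q"
      using card_grid_cball_le[OF T, of "limit_vertex S b"] by (simp add: Q_def)
  qed
  have "\<exists>j. \<exists>i<M ^ j. \<forall>b\<in>B j. i \<notin> near b"
  proof (rule ccontr)
    assume none: "\<not> ?thesis"
    have le: "real M ^ j \<le> 2 * Q * (real M - 1) ^ j" for j
    proof -
      have "{..<M ^ j} \<subseteq> (\<Union>b\<in>B j. near b)" using none by auto
      then have "card {..<M ^ j} \<le> card (\<Union>b\<in>B j. near b)"
        using finB near(1) by (intro card_mono) auto
      also have "\<dots> \<le> (\<Sum>b\<in>B j. card (near b))" using finB by (rule card_UN_le)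
      finally have "real (M ^ j) \<le> (\<Sum>b\<in>B j. real (card (near b)))"
        by (simp only: card_lessThan of_nat_sum[symmetric] of_nat_le_iff)
      also have "\<dots> \<le> (\<Sum>b\<in>B j. Q)" using near(2) by (intro sum_mono)
      also have "\<dots> = real (card (B j)) * Q" by simp
      also have "\<dots> \<le> real (2 * (M - 1) ^ j) * Q"
        using cardB[of j] by (intro mult_right_mono) (simp_all only: of_nat_le_iff, simp add: Q_def)
      finally show ?thesis using M by (simp add: of_nat_diff mult_ac)
    qed
    define q where "q = real M / (real M - 1)"
    have "1 < q" using M by (simp add: q_def)
    then obtain j where "2 * Q < q ^ j" using real_arch_pow by blast
    moreover have "q ^ j \<le> 2 * Q" using le[of j] M by (simp add: q_def power_divide divide_le_eq)
    ultimately show False by simp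
  qed
  then obtain j i where i: "i < M ^ j" "\<And>b. b \<in> B j \<Longrightarrow> i \<notin> near b" by blast
  let ?c = "limit_vertex S i"
  let ?X = "set (pre j)"
  have X: "?X \<subseteq> limit_edges S" by (auto simp: pre)
  have edge: "(z, x) \<in> limit_edges S" if "valid (z, x)" "z \<in> cball ?c R" for z x
  proof -
    have "(z, x) \<in> ?X"
    proof (rule fill_around[of "limit_edge S i" ?X T])
      show "limit_edge S i \<in> ?X" using i(1) by (simp add: pre)
      show "valid (limit_edge S i)" by (rule valid_limit_edge)
      show "valid (z, x)" by (rule that(1))
      show "2 \<le> T" using R by (simp add: T_def)
      have "norm (z - ?c) \<le> R" using that(2) by (simp add: dist_norm norm_minus_commute)
      then show "norm1 (z - fst (limit_edge S i)) \<le> T - 2"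
        using norm1_le_norm[of "z - ?c"] by (simp add: T_def limit_edge_def)
      fix f assume f: "f \<in> ?X" "norm1 (fst f - fst (limit_edge S i)) \<le> T"
      then obtain b where b: "b < M ^ j" "f = limit_edge S b" by (auto simp: pre)
      then have "i \<in> near b" using f(2) by (simp add: near_def limit_edge_def norm1_minus_commute)
      then have "b \<notin> B j" using i(2) by blast
      then show "cycle lnext f \<subseteq> ?X \<and> cycle rnext f \<subseteq> ?X"
        using b by (auto simp: B_def bad_def closed_in_def)
    qed
    then show ?thesis using X by blast
  qed
  have "card {l. limit_vertex S l = z} = 2" if z: "z \<in> cball ?c R \<inter> grid_points" for z
  proof -
    obtain x where x: "valid (z, x)" using grid_valid z by blast
    then have "valid (z, rot (rot x))" using valid_same_tail by blast
    then show ?thesis using edge x z vertex_full[OF S(2) x] by blast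
  qed
  then show "\<exists>c. \<forall>z\<in>cball c R \<inter> grid_points. card {j. limit_vertex S j = z} = 2" by blast
qed

theorem theorem2:
  fixes S :: "crease list"
  assumes "folding_string S" and "self_avoiding S"
  shows "planefilling S \<longleftrightarrow> maximally_simple S"
  using maximally_simple_if_planefilling planefilling_if_maximally_simple assms
  by (auto simp: folding_string_def)

end
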